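(* Suppose that $X$ is a non-compact proper metric space which is coarsely geodesic and has coarse bounded geometry. Then $X$ is coarsely equivalent to $\mathbb{Z}$ if and only if the Higson corona $\nu X$ of $X$ is a topological sum of two indecomposable continua, each of which is homeomorphic to $\nu\mathbb{N}$.
   Context: $\mathbb{R}_+=[0,\infty)$. $\mathbb{N}$ (natural numbers) and $\mathbb{Z}$ (integers) carry the metric $d(x,y)=|x-y|$. A metric space $(X,d_X)$ is proper if every closed ball $B(x,r)=\{y\in X : d_X(x,y)\le r\}$ is compact. Coarse equivalence: A (not necessarily continuous) function $f:X\to Y$ between metric spaces is a coarse map if (a) there is a non-decreasing function $\sigma:\mathbb{R}_+\to\mathbb{R}_+$ with $d_Y(f(x),f(x'))\le\sigma(d_X(x,x'))$ for all $x,x'\in X$, and (b) $f^{-1}(B)$ is bounded for every bounded $B\subset Y$. Two maps $f,g:X\to Y$ are close if there is $r>0$ with $d_Y(f(x),g(x))<r$ for all $x\in X$. A coarse map $f:X\to Y$ is a coarse equivalence if there is a coarse map $g:Y\to X$ such that $g\circ f$ is close to $\mathrm{id}_X$ and $f\circ g$ is close to $\mathrm{id}_Y$; then $X$ and $Y$ are called coarsely equivalent. A metric space is coarsely geodesic if it is coarsely equivalent to a geodesic metric space. A subset $A\subset X$ is a net if there is $r>0$ such that for every $x\in X$ there is $a\in A$ with $d_X(x,a)<r$. A metric space $X$ has coarse bounded geometry if there exist a net $A$ of $X$ and a function $\lambda:\mathbb{R}_+\to\mathbb{R}_+$ such that $\#(A\cap B(x,t))\le\lambda(t)$ for every $x\in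 X$ and $t>0$. Higson corona: for a proper metric space $X$, let $C_H(X)$ be the set of bounded continuous functions $f:X\to\mathbb{R}$ such that for all $r>0$ and $\varepsilon>0$ there is a compact $K\subset X$ with $\operatorname{diam} f(B(x,r))<\varepsilon$ for all $x\in X\setminus K$. The evaluation map $e:X\to\prod_{f\in C_H(X)}[\inf f,\sup f]$, $(e(x))_f=f(x)$, is a topological embedding; the Higson compactification $X^\nu$ is the closure of $e(X)$ (with $X$ identified with $e(X)$), and the Higson corona is $\nu X=X^\nu\setminus X$. A continuum is a non-empty compact connected Hausdorff space; it is decomposable if it is the union of two of its proper subcontinua (subcontinua not equal to the whole space), and indecomposable otherwise. *)

theory Defs
  imports "HOL-Analysis.Analysis"
begin

text \<open>
  A metric space is a set in a type of class \<^class>\<open>metric_space\<close>, with the restricted metric.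
  In particular the natural numbers and the integers with the metric \<open>\<bar>x - y\<bar>\<close> are the sets
  \<open>\<nat>\<close> and \<open>\<int>\<close> of real numbers. The closed ball of radius \<open>r\<close> about \<open>x\<close> in \<open>X\<close> is
  \<open>X \<inter> cball x r\<close>.
\<close>

definition proper_metric :: "'a::metric_space set \<Rightarrow> bool" where
  "proper_metric X \<longleftrightarrow> (\<forall>x\<in>X. \<forall>r. compact (X \<inter> cball x r))"

definition coarse_map :: "'a::metric_space set \<Rightarrow> 'b::metric_space set \<Rightarrow> ('a \<Rightarrow> 'b) \<Rightarrow> bool" where
  "coarse_map X Y f \<longleftrightarrow>
     f \<in> X \<rightarrow> Y \<and>
     (\<exists>\<sigma>::real \<Rightarrow> real. \<sigma> \<in> {0..} \<rightarrow> {0..} \<and> mono_on {0..} \<sigma> \<and>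
        (\<forall>x\<in>X. \<forall>x'\<in>X. dist (f x) (f x') \<le> \<sigma> (dist x x'))) \<and>
     (\<forall>B\<subseteq>Y. bounded B \<longrightarrow> bounded (X \<inter> f -` B))"

definition close_maps :: "'a set \<Rightarrow> ('a \<Rightarrow> 'b::metric_space) \<Rightarrow> ('a \<Rightarrow> 'b) \<Rightarrow> bool" where
  "close_maps X f g \<longleftrightarrow> (\<exists>r>0. \<forall>x\<in>X. dist (f x) (g x) < r)"

definition coarse_equivalence ::
  "'a::metric_space set \<Rightarrow> 'b::metric_space set \<Rightarrow> ('a \<Rightarrow> 'b) \<Rightarrow> bool" where
  "coarse_equivalence X Y f \<longleftrightarrow>
     coarse_map X Y f \<and>
     (\<exists>g. coarse_map Y X g \<and> close_maps X (g \<circ> f) id \<and> close_maps Y (f \<circ> g) id)"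

definition coarsely_equivalent :: "'a::metric_space set \<Rightarrow> 'b::metric_space set \<Rightarrow> bool" where
  "coarsely_equivalent X Y \<longleftrightarrow> (\<exists>f. coarse_equivalence X Y f)"

definition geodesic_metric :: "'a::metric_space set \<Rightarrow> bool" where
  "geodesic_metric X \<longleftrightarrow>
     (\<forall>x\<in>X. \<forall>y\<in>X. \<exists>\<gamma>::real \<Rightarrow> 'a.
        \<gamma> \<in> {0..dist x y} \<rightarrow> X \<and> \<gamma> 0 = x \<and> \<gamma> (dist x y) = y \<and>
        (\<forall>s\<in>{0..dist x y}. \<forall>t\<in>{0..dist x y}. dist (\<gamma> s) (\<gamma> t) = \<bar>s - t\<bar>))"

text \<open>
  HOL cannot quantify over the type in which the geodesic space lives, so that type is a
  parameter. In a hypothesis of a theorem with a free type variable \<open>'b\<close>, the assumption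
  \<open>coarsely_geodesic TYPE('b) X\<close> is existential over geodesic spaces in all types.
\<close>

definition coarsely_geodesic :: "'b::metric_space itself \<Rightarrow> 'a::metric_space set \<Rightarrow> bool" where
  "coarsely_geodesic (_::'b itself) X \<longleftrightarrow>
     (\<exists>Y::'b set. geodesic_metric Y \<and> coarsely_equivalent X Y)"

definition net_in :: "'a::metric_space set \<Rightarrow> 'a set \<Rightarrow> bool" where
  "net_in X A \<longleftrightarrow> A \<subseteq> X \<and> (\<exists>r>0. \<forall>x\<in>X. \<exists>a\<in>A. dist x a < r)"

definition coarse_bounded_geometry :: "'a::metric_space set \<Rightarrow> bool" where
  "coarse_bounded_geometry X \<longleftrightarrow>
     (\<exists>A. \<exists>\<Lambda>::real \<Rightarrow> real. net_in X A \<and> \<Lambda> \<in> {0..} \<rightarrow> {0..} \<and>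
        (\<forall>x\<in>X. \<forall>t>0. finite (A \<inter> cball x t) \<and> real (card (A \<inter> cball x t)) \<le> \<Lambda> t))"

text \<open>
  Extensionality makes the elements of \<open>higson_functions X\<close> correspond exactly to functions
  on \<open>X\<close>.
\<close>

definition higson_functions :: "'a::metric_space set \<Rightarrow> ('a \<Rightarrow> real) set" where
  "higson_functions X =
     {f \<in> extensional X. continuous_on X f \<and> bounded (f ` X) \<and>
        (\<forall>r>0. \<forall>\<epsilon>>0. \<exists>K\<subseteq>X. compact K \<and>
           (\<forall>x\<in>X - K. diameter (f ` (X \<inter> cball x r)) < \<epsilon>))}"

definition higson_cube :: "'a::metric_space set \<Rightarrow> (('a \<Rightarrow> real) \<Rightarrow> real) topology" where
  "higson_cube X =
     product_topology (\<lambda>f. top_of_set {Inf (f ` X)..Sup (f ` X)}) (higson_functions X)"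

definition higson_embedding :: "'a::metric_space set \<Rightarrow> 'a \<Rightarrow> ('a \<Rightarrow> real) \<Rightarrow> real" where
  "higson_embedding X x = (\<lambda>f\<in>higson_functions X. f x)"

definition higson_compactification ::
  "'a::metric_space set \<Rightarrow> (('a \<Rightarrow> real) \<Rightarrow> real) topology" where
  "higson_compactification X =
     subtopology (higson_cube X) (higson_cube X closure_of (higson_embedding X ` X))"

definition higson_corona :: "'a::metric_space set \<Rightarrow> (('a \<Rightarrow> real) \<Rightarrow> real) topology" where
  "higson_corona X =
     subtopology (higson_compactification X)
       (topspace (higson_compactification X) - higson_embedding X ` X)"

definition continuum_space :: "'a topology \<Rightarrow> bool" where
  "continuum_space T \<longleftrightarrow>
     topspace T \<noteq> {} \<and> compact_space T \<and> connected_space T \<and> Hausdorff_space T"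

definition proper_subcontinuum :: "'a topology \<Rightarrow> 'a set \<Rightarrow> bool" where
  "proper_subcontinuum T A \<longleftrightarrow> A \<subset> topspace T \<and> continuum_space (subtopology T A)"

definition decomposable :: "'a topology \<Rightarrow> bool" where
  "decomposable T \<longleftrightarrow>
     (\<exists>A B. proper_subcontinuum T A \<and> proper_subcontinuum T B \<and> A \<union> B = topspace T)"

definition indecomposable_continuum :: "'a topology \<Rightarrow> bool" where
  "indecomposable_continuum T \<longleftrightarrow> continuum_space T \<and> \<not> decomposable T"

end

theory Submission
  imports Defs
begin

text \<open>
  For a subset \<open>A\<close> of \<open>X\<close> let \<open>A'\<close> be the set of points of the corona in the closure of \<open>A\<close>
  (\<open>corona_trace X A\<close>, and \<open>cl A\<close> in the abstract setting). Then
  \<open>A'\<close> and \<open>B'\<close> are disjoint iff \<open>A\<close> and \<open>B\<close> diverge from each other, and the sets \<open>A'\<close> form a base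
  of the closed sets. Hence the corona is determined up to homeomorphism by the divergence relation,
  which a coarse equivalence preserves; this gives the corona of the integers as two disjoint
  copies of that of the naturals, and the latter is indecomposable by a parity argument.

  Conversely, replace \<open>X\<close> by a net carrying an integer-valued geodesic metric with finite balls.
  A splitting of the corona into two indecomposable continua comes from a partition of the net
  into two divergent parts \<open>B\<close>, \<open>C\<close>, each of which contains a geodesic ray by Koenig's lemma.
  If some infinite \<open>E \<subseteq> B\<close> diverged from the ray in \<open>B\<close>, the points closer to the ray than to
  \<open>E \<union> C\<close>, by a factor of two, would give a proper subcontinuum with nonempty interior, which an
  indecomposable continuum does not have. So \<open>B\<close> and \<open>C\<close> lie at bounded distance from rays.
\<close>

text \<open>Corona points have no usable description, so each topological assertion is reduced to
  divergence of subsets: a trace is empty iff its set is bounded, and a splitting of the space into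
  two closed pieces lifts to a splitting of the set into divergent parts. In the net, bounded means
  finite, and divergent complementary parts are joined by finitely many edges. This is what the
  coarsely geodesic hypothesis buys: a geodesic from one part to the other must use one of these
  edges, so connectedness of a trace becomes a finiteness count. The factor two is chosen for this
  count. Divergence of the set from \<open>E \<union> C\<close>, and of its complement from the ray,
  would already hold with factor one. With factor two, a vertex x whose geodesic to a ray vertex r
  passes through y satisfies 2 d(x,y) \<le> d(x,y) + d(x,r) and 2 d(x,r) \<le> d(x,e) \<le> d(x,y) +
  d(y,e) for a fixed e in \<open>E\<close>, hence d(x,y) \<le> d(y,e): only finitely many x belong
  to each y. Factor one would leave d(x,y) unbounded.\<close>

section \<open>Compact spaces modelled by a divergence relation\<close>

text \<open>\<open>cl\<close> respects unions but not intersections or complements. So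
  \<open>p \<notin> cl (V - A)\<close> is stronger than \<open>p \<in> cl A\<close>: it says that
  \<open>cl A\<close> is a neighbourhood of \<open>p\<close>, and \<open>base\<close> says that such
  neighbourhoods are arbitrarily small. The locale is used for the corona over the whole space, over
  a net, over parts of these, and over the naturals.\<close>

locale boundary_model =
  fixes T :: "'p topology" and V :: "'v set" and cl :: "'v set \<Rightarrow> 'p set"
    and dv :: "'v set \<Rightarrow> 'v set \<Rightarrow> bool"
  assumes compact: "compact_space T" and Hausdorff: "Hausdorff_space T"
    and closedin_cl: "A \<subseteq> V \<Longrightarrow> closedin T (cl A)"
    and cl_empty: "cl {} = {}"
    and cl_Un: "A \<subseteq> V \<Longrightarrow> B \<subseteq> V \<Longrightarrow> cl (A \<union> B) = cl A \<union> cl B"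
    and cl_V: "cl V = topspace T"
    and dv_iff: "A \<subseteq> V \<Longrightarrow> B \<subseteq> V \<Longrightarrow> dv A B \<longleftrightarrow> cl A \<inter> cl B = {}"
    and base: "openin T U \<Longrightarrow> p \<in> U \<Longrightarrow> \<exists>A\<subseteq>V. p \<notin> cl (V - A) \<and> cl A \<subseteq> U"
begin

lemma cl_mono: "A \<subseteq> B \<Longrightarrow> B \<subseteq> V \<Longrightarrow> cl A \<subseteq> cl B"
  using cl_Un[of A B] by (auto simp: subset_Un_eq)

lemma cl_subset: "A \<subseteq> V \<Longrightarrow> cl A \<subseteq> topspace T"
  using closedin_cl closedin_subset by blast

lemma cl_Diff: "A \<subseteq> V \<Longrightarrow> topspace T = cl A \<union> cl (V - A)"
  using cl_Un[of A "V - A"] cl_V by (simp add: Un_absorb1)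

lemma cl_UN: "finite F \<Longrightarrow> (\<And>i. i \<in> F \<Longrightarrow> A i \<subseteq> V) \<Longrightarrow> cl (\<Union>i\<in>F. A i) = (\<Union>i\<in>F. cl (A i))"
proof (induction F rule: finite_induct)
  case empty
  then show ?case by (simp add: cl_empty)
next
  case (insert x F)
  then show ?case using cl_Un[of "A x" "\<Union>i\<in>F. A i"] by (simp add: UN_subset_iff)
qed

text \<open>Compactness of \<open>C\<close> glues the sets that \<open>base\<close> supplies at its
  points. The conclusion \<open>C \<inter> cl (V - A) = {}\<close> is preferred to
  \<open>C \<subseteq> cl A\<close> because it makes \<open>cl A\<close> a neighbourhood of
  \<open>C\<close>.\<close>

lemma separate:
  assumes C: "closedin T C" and D: "closedin T D" and CD: "C \<inter> D = {}"
  obtains A where "A \<subseteq> V" "C \<inter> cl (V - A) = {}" "cl A \<inter> D = {}"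
proof -
  have "\<exists>A\<subseteq>V. p \<notin> cl (V - A) \<and> cl A \<subseteq> topspace T - D" if "p \<in> C" for p
    using base[of "topspace T - D" p] that C D CD closedin_subset by blast
  then obtain A where A: "\<And>p. p \<in> C \<Longrightarrow> A p \<subseteq> V \<and> p \<notin> cl (V - A p) \<and> cl (A p) \<subseteq> topspace T - D"
    by metis
  have "compactin T C"
    using C compact closedin_compact_space by blast
  moreover have "\<forall>p\<in>C. openin T (topspace T - cl (V - A p))"
    by (simp add: closedin_cl openin_diff)
  moreover have "C \<subseteq> (\<Union>p\<in>C. topspace T - cl (V - A p))"
    using closedin_subset[OF C] by (auto dest: A)
  ultimately have "\<exists>\<F>. finite \<F> \<and> \<F> \<subseteq> (\<lambda>p. topspace T - cl (V - A p)) ` C \<and> C \<subseteq> \<Union>\<F>"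
    unfolding compactin_def by simp
  then obtain F where F: "finite F" "F \<subseteq> C" "C \<subseteq> (\<Union>p\<in>F. topspace T - cl (V - A p))"
    by (metis finite_subset_image)
  let ?A = "\<Union>p\<in>F. A p"
  have sub: "?A \<subseteq> V" using A F by blast
  have "cl (V - ?A) \<subseteq> cl (V - A p)" if "p \<in> F" for p
    using that by (intro cl_mono) auto
  then have "C \<inter> cl (V - ?A) = {}" using F(3) by blast
  moreover have "cl ?A \<inter> D = {}"
    using cl_UN[OF F(1), of A] A F(2) by blast
  ultimately show thesis using that sub by blast
qed

lemma separate2:
  assumes C: "closedin T C" and D: "closedin T D" and CD: "C \<inter> D = {}"
  obtains A B where "A \<subseteq> V" "B \<subseteq> V" "C \<inter> cl (V - A) = {}" "D \<inter> cl (V - B) = {}" "cl A \<inter> cl B = {}"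
proof -
  obtain A where A: "A \<subseteq> V" "C \<inter> cl (V - A) = {}" "cl A \<inter> D = {}"
    using separate[OF assms] .
  obtain B where B: "B \<subseteq> V" "D \<inter> cl (V - B) = {}" "cl B \<inter> cl A = {}"
    using separate[OF D closedin_cl[OF A(1)]] A(3) by blast
  show thesis using that[of A B] A B by blast
qed

lemma closedin_point: "p \<in> topspace T \<Longrightarrow> closedin T {p}"
  by (rule closedin_Hausdorff_singleton[OF Hausdorff])

lemma separate_point:
  assumes "p \<in> topspace T" "closedin T D" "p \<notin> D"
  obtains A where "A \<subseteq> V" "p \<notin> cl (V - A)" "cl A \<inter> D = {}"
  using separate[OF closedin_point[OF assms(1)] assms(2)] assms(3) by auto

lemma separate2_point:
  assumes "p \<in> topspace T" "closedin T D" "p \<notin> D"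
  obtains A B where "A \<subseteq> V" "B \<subseteq> V" "p \<notin> cl (V - A)" "D \<inter> cl (V - B) = {}" "cl A \<inter> cl B = {}"
  using separate2[OF closedin_point[OF assms(1)] assms(2)] assms(3) by auto

text \<open>The passage from topology to combinatorics: when \<open>C\<close> and \<open>D\<close>
  cover the space, the approximation given by \<open>separate\<close> is forced to be exact.\<close>

lemma clopen_partition:
  assumes "closedin T C" "closedin T D" "C \<inter> D = {}" "C \<union> D = topspace T"
  obtains A where "A \<subseteq> V" "cl A = C" "cl (V - A) = D"
proof -
  obtain A where A: "A \<subseteq> V" "C \<inter> cl (V - A) = {}" "cl A \<inter> D = {}"
    using separate[OF assms(1-3)] .
  have eq: "cl A \<union> cl (V - A) = C \<union> D"
    using cl_Diff[OF A(1)] assms(4) by simp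
  have "cl A \<subseteq> C" "cl (V - A) \<subseteq> D" "C \<subseteq> cl A" "D \<subseteq> cl (V - A)"
    using eq A(2,3) by blast+
  then show thesis using that[OF A(1)] by auto
qed

lemma dv_self: "A \<subseteq> V \<Longrightarrow> dv A A \<longleftrightarrow> cl A = {}"
  using dv_iff[of A A] by simp

lemma restrict:
  assumes W: "W \<subseteq> V"
  shows "boundary_model (subtopology T (cl W)) W cl dv"
proof
  show "compact_space (subtopology T (cl W))"
    using closedin_compact_space[OF compact closedin_cl[OF W]] compact_space_subtopology by blast
  show "Hausdorff_space (subtopology T (cl W))"
    by (simp add: Hausdorff Hausdorff_space_subtopology)
  show "closedin (subtopology T (cl W)) (cl A)" if "A \<subseteq> W" for A
    using that W closedin_cl[of A] cl_mono[of A W] by (metis closedin_subset_topspace order_trans)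
  show "cl {} = {}" by (rule cl_empty)
  show "cl (A \<union> B) = cl A \<union> cl B" if "A \<subseteq> W" "B \<subseteq> W" for A B
    using that W cl_Un by auto
  show "cl W = topspace (subtopology T (cl W))"
    using cl_subset[OF W] by auto
  show "dv A B \<longleftrightarrow> cl A \<inter> cl B = {}" if "A \<subseteq> W" "B \<subseteq> W" for A B
    using that W dv_iff by auto
  show "\<exists>A\<subseteq>W. p \<notin> cl (W - A) \<and> cl A \<subseteq> U" if U: "openin (subtopology T (cl W)) U" "p \<in> U" for U p
  proof -
    obtain U' where U': "openin T U'" "U = U' \<inter> cl W"
      using U(1) by (auto simp: openin_subtopology)
    obtain A where A: "A \<subseteq> V" "p \<notin> cl (V - A)" "cl A \<subseteq> U'"
      using base[OF U'(1), of p] U(2) U'(2) by blast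
    have "cl (W - A \<inter> W) \<subseteq> cl (V - A)" using W by (intro cl_mono) auto
    moreover have "cl (A \<inter> W) \<subseteq> cl A" by (rule cl_mono) (use A(1) in auto)
    moreover have "cl (A \<inter> W) \<subseteq> cl W" by (rule cl_mono) (use W in auto)
    ultimately show ?thesis
      using A U'(2) by (intro exI[of _ "A \<inter> W"]) auto
  qed
qed

lemma connectedI:
  assumes "\<And>A. A \<subseteq> V \<Longrightarrow> dv A (V - A) \<Longrightarrow> cl A = {} \<or> cl (V - A) = {}"
  shows "connected_space T"
  unfolding connected_space_closedin
proof clarify
  fix C D assume *: "closedin T C" "closedin T D" "topspace T \<subseteq> C \<union> D" "C \<inter> D = {}" "C \<noteq> {}" "D \<noteq> {}"
  then have "C \<union> D = topspace T" by (simp add: closedin_subset subset_antisym)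
  then obtain A where A: "A \<subseteq> V" "cl A = C" "cl (V - A) = D"
    using clopen_partition[OF *(1,2,4)] by metis
  then have "dv A (V - A)" using dv_iff * by auto
  then show False using assms[OF A(1)] A(2,3) *(5,6) by simp
qed

end

text \<open>A point \<open>p\<close> is sent to a point lying in the traces of the images of all
  neighbourhoods of \<open>p\<close>. Divergence passes disjointness of traces back and forth, which
  yields continuity and injectivity. \<open>h\<close> need not be injective, and it need only be
  onto at the level of traces.\<close>

theorem boundary_model_homeomorphic:
  assumes M1: "boundary_model T1 V1 cl1 dv1" and M2: "boundary_model T2 V2 cl2 dv2"
    and h: "h \<in> V1 \<rightarrow> V2" and onto: "cl2 (h ` V1) = topspace T2"
    and dv: "\<And>A B. A \<subseteq> V1 \<Longrightarrow> B \<subseteq> V1 \<Longrightarrow> dv1 A B \<longleftrightarrow> dv2 (h ` A) (h ` B)"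
  shows "T1 homeomorphic_space T2"
proof -
  interpret M1: boundary_model T1 V1 cl1 dv1 by (rule M1)
  interpret M2: boundary_model T2 V2 cl2 dv2 by (rule M2)
  have hV: "h ` A \<subseteq> V2" if "A \<subseteq> V1" for A using that h by auto
  have disj: "cl1 A \<inter> cl1 B = {} \<longleftrightarrow> cl2 (h ` A) \<inter> cl2 (h ` B) = {}" if "A \<subseteq> V1" "B \<subseteq> V1" for A B
    using dv[OF that] M1.dv_iff[OF that] M2.dv_iff[OF hV hV, OF that] by simp
  \<comment> \<open>The sets \<open>A\<close> with \<open>p \<notin> cl1 (V1 - A)\<close> are closed
    under intersection, because \<open>cl1\<close> sends a union of complements to the union of
    their traces. Hence the traces of their images have the finite intersection property, and
    compactness of \<open>T2\<close> yields some \<open>q\<close>.\<close>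
  define P where "P p q \<longleftrightarrow> q \<in> topspace T2 \<and> (\<forall>A\<subseteq>V1. p \<notin> cl1 (V1 - A) \<longrightarrow> q \<in> cl2 (h ` A))" for p q
  have ex: "\<exists>q. P p q" if p: "p \<in> topspace T1" for p
  proof -
    let ?U = "{A. A \<subseteq> V1 \<and> p \<notin> cl1 (V1 - A)}"
    have fin: "\<exists>A\<in>?U. cl2 (h ` A) \<subseteq> topspace T2 \<inter> \<Inter>F" if "finite F" "F \<subseteq> (\<lambda>A. cl2 (h ` A)) ` ?U" for F
      using that
    proof (induction F rule: finite_induct)
      case empty
      show ?case using M1.cl_empty onto by (intro bexI[of _ V1]) auto
    next
      case (insert C F)
      then obtain A where A: "A \<in> ?U" "cl2 (h ` A) \<subseteq> topspace T2 \<inter> \<Inter>F" by auto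
      obtain B where B: "B \<in> ?U" "C = cl2 (h ` B)" using insert.prems by auto
      have "V1 - A \<inter> B = (V1 - A) \<union> (V1 - B)" by blast
      then have "A \<inter> B \<in> ?U"
        using A(1) B(1) M1.cl_Un[of "V1 - A" "V1 - B"] by auto
      moreover have "cl2 (h ` (A \<inter> B)) \<subseteq> cl2 (h ` A)"
        by (rule M2.cl_mono) (use A(1) hV in auto)
      moreover have "cl2 (h ` (A \<inter> B)) \<subseteq> cl2 (h ` B)"
        by (rule M2.cl_mono) (use B(1) hV in auto)
      ultimately show ?case using A(2) B(2) by blast
    qed
    have ne: "cl2 (h ` A) \<noteq> {}" if "A \<in> ?U" for A
      using that p M1.cl_Diff[of A] disj[of A A] by auto
    have "\<Inter>(insert (topspace T2) ((\<lambda>A. cl2 (h ` A)) ` ?U)) \<noteq> {}"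
      using M2.compact unfolding compact_space_fip
    proof (elim allE[of _ "insert (topspace T2) ((\<lambda>A. cl2 (h ` A)) ` ?U)"] impE)
      show "(\<forall>C\<in>insert (topspace T2) ((\<lambda>A. cl2 (h ` A)) ` ?U). closedin T2 C) \<and>
        (\<forall>F. finite F \<and> F \<subseteq> insert (topspace T2) ((\<lambda>A. cl2 (h ` A)) ` ?U) \<longrightarrow> \<Inter>F \<noteq> {})"
      proof (intro conjI allI impI ballI)
        fix C assume "C \<in> insert (topspace T2) ((\<lambda>A. cl2 (h ` A)) ` ?U)"
        then show "closedin T2 C" using M2.closedin_cl hV by auto
      next
        fix F assume F: "finite F \<and> F \<subseteq> insert (topspace T2) ((\<lambda>A. cl2 (h ` A)) ` ?U)"
        then have "finite (F - {topspace T2})" "F - {topspace T2} \<subseteq> (\<lambda>A. cl2 (h ` A)) ` ?U" by auto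
        from fin[OF this] obtain A where A: "A \<in> ?U" "cl2 (h ` A) \<subseteq> topspace T2 \<inter> \<Inter>(F - {topspace T2})"
          by (rule bexE)
        from ne[OF A(1)] obtain q where "q \<in> cl2 (h ` A)" by auto
        then have "q \<in> \<Inter>F" using A(2) by auto
        then show "\<Inter>F \<noteq> {}" by auto
      qed
    qed
    then obtain q where "q \<in> topspace T2" "\<And>A. A \<in> ?U \<Longrightarrow> q \<in> cl2 (h ` A)" by auto
    then have "P p q" by (simp add: P_def)
    then show ?thesis ..
  qed
  have PT: "q \<in> topspace T2" if "P p q" for p q using that by (simp add: P_def)
  have PD: "q \<in> cl2 (h ` A)" if "P p q" "A \<subseteq> V1" "p \<notin> cl1 (V1 - A)" for p q A
    using that by (simp add: P_def)
  have PDc: "q \<in> cl2 (h ` (V1 - A))" if "P p q" "A \<subseteq> V1" "p \<notin> cl1 A" for p q A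
    using that PD[of p q "V1 - A"] by (simp add: double_diff)
  \<comment> \<open>This extends the defining property from neighbourhoods of \<open>p\<close> to
    every set whose trace contains \<open>p\<close>. If \<open>q\<close> had a neighbourhood
    \<open>B\<close> away from the image of \<open>A\<close>, the preimage of \<open>B\<close> would
    miss \<open>p\<close> in its trace, so its complement would be a neighbourhood of
    \<open>p\<close> and push \<open>q\<close> into \<open>cl2 (V2 - B)\<close>.\<close>
  have Pcl: "q \<in> cl2 (h ` A)" if Pq: "P p q" and A: "A \<subseteq> V1" "p \<in> cl1 A" for p q A
  proof (rule ccontr)
    assume nq: "q \<notin> cl2 (h ` A)"
    have q: "q \<in> topspace T2" using PT[OF Pq] .
    obtain B where B: "B \<subseteq> V2" "q \<notin> cl2 (V2 - B)" "cl2 B \<inter> cl2 (h ` A) = {}"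
      using M2.separate_point[OF q M2.closedin_cl[OF hV[OF A(1)]] nq] .
    let ?B = "V1 \<inter> h -` B"
    have "cl2 (h ` ?B) \<subseteq> cl2 B" using B(1) by (intro M2.cl_mono) auto
    then have "cl1 ?B \<inter> cl1 A = {}" using disj[of ?B A] A(1) B(3) by auto
    then have "q \<in> cl2 (h ` (V1 - ?B))" using PDc[OF Pq, of ?B] A(2) by auto
    moreover have "cl2 (h ` (V1 - ?B)) \<subseteq> cl2 (V2 - B)" using h by (intro M2.cl_mono) auto
    ultimately show False using B(2) by blast
  qed
  define \<phi> where "\<phi> p = (SOME q. P p q)" for p
  have \<phi>: "P p (\<phi> p)" if "p \<in> topspace T1" for p
    unfolding \<phi>_def using ex[OF that] by (rule someI_ex)
  have \<phi>T: "\<phi> p \<in> topspace T2" if "p \<in> topspace T1" for p using PT[OF \<phi>[OF that]] .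
  have cont: "continuous_map T1 T2 \<phi>"
    unfolding continuous_map_closedin
  proof (intro conjI allI impI)
    show "\<phi> \<in> topspace T1 \<rightarrow> topspace T2" using \<phi>T by blast
    fix C assume C: "closedin T2 C"
    have "openin T1 (topspace T1 - {x \<in> topspace T1. \<phi> x \<in> C})"
    proof (subst openin_subopen, rule ballI)
      fix p assume "p \<in> topspace T1 - {x \<in> topspace T1. \<phi> x \<in> C}"
      then have p: "p \<in> topspace T1" "\<phi> p \<notin> C" by auto
      obtain B D where BD: "B \<subseteq> V2" "D \<subseteq> V2" "\<phi> p \<notin> cl2 (V2 - B)" "C \<inter> cl2 (V2 - D) = {}" "cl2 B \<inter> cl2 D = {}"
        using M2.separate2_point[OF \<phi>T[OF p(1)] C p(2)] .
      let ?D = "V1 \<inter> h -` D"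
      have "\<phi> p \<in> cl2 B" using BD(3) \<phi>T[OF p(1)] M2.cl_Diff[OF BD(1)] by auto
      have "p \<notin> cl1 ?D"
      proof
        assume "p \<in> cl1 ?D"
        then have "\<phi> p \<in> cl2 (h ` ?D)" using Pcl[OF \<phi>[OF p(1)], of ?D] by auto
        moreover have "cl2 (h ` ?D) \<subseteq> cl2 D" using BD(2) by (intro M2.cl_mono) auto
        ultimately show False using \<open>\<phi> p \<in> cl2 B\<close> BD(5) by blast
      qed
      moreover have "\<phi> w \<notin> C" if w: "w \<in> topspace T1" "w \<notin> cl1 ?D" for w
      proof -
        have "\<phi> w \<in> cl2 (h ` (V1 - ?D))"
          using PDc[OF \<phi>[OF w(1)] _ w(2)] by auto
        moreover have "cl2 (h ` (V1 - ?D)) \<subseteq> cl2 (V2 - D)" using h by (intro M2.cl_mono) auto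
        ultimately show ?thesis using BD(4) by blast
      qed
      ultimately show "\<exists>S. openin T1 S \<and> p \<in> S \<and> S \<subseteq> topspace T1 - {x \<in> topspace T1. \<phi> x \<in> C}"
        using p(1) by (intro exI[of _ "topspace T1 - cl1 ?D"]) (auto simp: M1.closedin_cl openin_diff)
    qed
    then show "closedin T1 {x \<in> topspace T1. \<phi> x \<in> C}"
      by (simp add: closedin_def)
  qed
  have inj: "inj_on \<phi> (topspace T1)"
  proof (rule inj_onI, rule ccontr)
    fix p p' assume p: "p \<in> topspace T1" "p' \<in> topspace T1" "\<phi> p = \<phi> p'" "p \<noteq> p'"
    have "p \<notin> {p'}" using p(4) by simp
    from M1.separate2_point[OF p(1) M1.closedin_point[OF p(2)] this]
    obtain A B where AB: "A \<subseteq> V1" "B \<subseteq> V1" "p \<notin> cl1 (V1 - A)" "{p'} \<inter> cl1 (V1 - B) = {}" "cl1 A \<inter> cl1 B = {}" .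
    then have "\<phi> p \<in> cl2 (h ` A)" "\<phi> p' \<in> cl2 (h ` B)"
      using PD[OF \<phi>[OF p(1)]] PD[OF \<phi>[OF p(2)]] by auto
    then show False using disj[OF AB(1,2)] AB(5) p(3) by auto
  qed
  \<comment> \<open>The image is compact, hence closed. A missed point would have a neighbourhood
    \<open>B\<close> away from the image, the preimage of \<open>B\<close> would then have empty
    trace, and \<open>onto\<close> would put the point into \<open>cl2 (V2 - B)\<close>.\<close>
  have "topspace T2 \<subseteq> \<phi> ` topspace T1"
  proof (rule ccontr)
    assume "\<not> topspace T2 \<subseteq> \<phi> ` topspace T1"
    then obtain q where q: "q \<in> topspace T2" "q \<notin> \<phi> ` topspace T1" by blast
    have "compactin T2 (\<phi> ` topspace T1)"
      using image_compactin[OF _ cont] M1.compact compact_space_def by blast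
    then have "closedin T2 (\<phi> ` topspace T1)"
      using M2.Hausdorff compactin_imp_closedin by blast
    then obtain B where B: "B \<subseteq> V2" "q \<notin> cl2 (V2 - B)" "cl2 B \<inter> \<phi> ` topspace T1 = {}"
      by (rule M2.separate_point[OF q(1) _ q(2)])
    let ?B = "V1 \<inter> h -` B"
    have le: "cl2 (h ` ?B) \<subseteq> cl2 B" using B(1) by (intro M2.cl_mono) auto
    have "cl1 ?B = {}"
    proof (rule ccontr)
      assume "cl1 ?B \<noteq> {}"
      then obtain p where p: "p \<in> cl1 ?B" by auto
      then have pT: "p \<in> topspace T1" using M1.cl_subset[of ?B] by auto
      then have "\<phi> p \<in> cl2 (h ` ?B)" using Pcl[OF \<phi>[OF pT], of ?B] p by auto
      then show False using le B(3) pT by auto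
    qed
    then have "cl2 (h ` ?B) = {}" using disj[of ?B ?B] by auto
    moreover have "h ` V1 = h ` ?B \<union> h ` (V1 - ?B)" by auto
    then have "cl2 (h ` V1) = cl2 (h ` ?B) \<union> cl2 (h ` (V1 - ?B))"
      using M2.cl_Un[of "h ` ?B" "h ` (V1 - ?B)"] hV by auto
    moreover have "cl2 (h ` (V1 - ?B)) \<subseteq> cl2 (V2 - B)" using h by (intro M2.cl_mono) auto
    ultimately show False using onto q(1) B(2) by auto
  qed
  then have "\<phi> ` topspace T1 = topspace T2" using \<phi>T by blast
  then have "homeomorphic_map T1 T2 \<phi>"
    using continuous_imp_homeomorphic_map[OF cont M1.compact M2.Hausdorff] inj by simp
  then show ?thesis by (rule homeomorphic_map_imp_homeomorphic_space)
qed

section \<open>Interiors of subcontinua\<close>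

text \<open>If the complement of \<open>K\<close> is connected, its closure misses \<open>U\<close>,
  so it and \<open>K\<close> are proper subcontinua that cover. If the complement splits into open
  \<open>G\<close> and \<open>H\<close>, then \<open>K \<union> G\<close> and
  \<open>K \<union> H\<close> do the same.\<close>

lemma indecomposable_no_interior:
  assumes T: "indecomposable_continuum T" and K: "closedin T K" "connectedin T K" "K \<noteq> topspace T"
    and U: "openin T U" "U \<noteq> {}" "U \<subseteq> K"
  shows False
proof -
  have cT: "compact_space T" "Hausdorff_space T" "connected_space T" "\<not> decomposable T"
    using T by (auto simp: indecomposable_continuum_def continuum_space_def)
  have KT: "K \<subseteq> topspace T" using K(1) closedin_subset by blast
  have cont: "proper_subcontinuum T A" if "closedin T A" "connectedin T A" "A \<noteq> {}" "A \<noteq> topspace T" for A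
    using that cT closedin_subset[OF that(1)] closedin_compact_space[OF cT(1) that(1)]
    by (auto simp: proper_subcontinuum_def continuum_space_def connectedin_def
        compact_space_subtopology Hausdorff_space_subtopology)
  have KD: "E1 \<inter> K = {} \<or> E2 \<inter> K = {}"
    if "closedin T E1" "closedin T E2" "K \<subseteq> E1 \<union> E2" "E1 \<inter> E2 \<inter> K = {}" for E1 E2
    using K(2) that unfolding connectedin_closedin by simp
  let ?O = "topspace T - K"
  have KUconn: "connectedin T (K \<union> G)" "closedin T (K \<union> G)"
    if G: "openin T G" "openin T H" "G \<inter> H = {}" "G \<union> H = ?O" for G H
  proof -
    have GT: "G \<subseteq> topspace T" using G(1) openin_subset by blast
    have eq: "K \<union> G = topspace T - H" using G KT by blast
    then show cl: "closedin T (K \<union> G)" using G(2) openin_subset[OF G(2)] by (simp add: closedin_def double_diff)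
    show "connectedin T (K \<union> G)"
      unfolding connectedin_closedin
    proof (intro conjI notI)
      show "K \<union> G \<subseteq> topspace T" using KT GT by blast
    next
      assume "\<exists>E1 E2. closedin T E1 \<and> closedin T E2 \<and> K \<union> G \<subseteq> E1 \<union> E2 \<and>
        E1 \<inter> E2 \<inter> (K \<union> G) = {} \<and> E1 \<inter> (K \<union> G) \<noteq> {} \<and> E2 \<inter> (K \<union> G) \<noteq> {}"
      then obtain E1 E2 where E: "closedin T E1" "closedin T E2" "K \<union> G \<subseteq> E1 \<union> E2"
        "E1 \<inter> E2 \<inter> (K \<union> G) = {}" "E1 \<inter> (K \<union> G) \<noteq> {}" "E2 \<inter> (K \<union> G) \<noteq> {}" by auto
      define P where "P = E1 \<inter> (K \<union> G)"
      define Q where "Q = E2 \<inter> (K \<union> G)"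
      have PQ12: "closedin T P" "closedin T Q"
        using E(1,2) cl unfolding P_def Q_def by (auto intro: closedin_Int)
      have PQ36: "P \<union> Q = K \<union> G" "P \<inter> Q = {}" "P \<noteq> {}" "Q \<noteq> {}"
        using E(3-6) unfolding P_def Q_def by blast+
      note PQ = PQ12 PQ36
      \<comment> \<open>In a splitting of \<open>K \<union> G\<close> the connected \<open>K\<close>
        lies on one side. The other side is closed, and it is also open since it lies within
        \<open>G\<close>, so it would be a nonempty proper clopen set of a connected space.\<close>
      have bad: False if PQ: "closedin T P" "closedin T Q" "P \<union> Q = K \<union> G" "P \<inter> Q = {}" "Q \<noteq> {}" "K \<subseteq> P" for P Q
      proof -
        have "Q = G \<inter> (topspace T - P)" using PQ closedin_subset[OF PQ(2)] by blast
        then have "openin T Q" using G(1) PQ(1) by (simp add: openin_Int openin_diff)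
        then have "Q = topspace T" using PQ(2,5) cT(3) by (auto simp: connected_space_clopen_in)
        moreover have "K \<noteq> {}" using U by auto
        ultimately show False using PQ KT by blast
      qed
      have "K \<subseteq> P \<union> Q" using PQ(3) by blast
      then have "K \<inter> P = {} \<or> K \<inter> Q = {}"
        using KD[OF PQ(1,2)] PQ(4) by (auto simp: Int_commute)
      then have "K \<subseteq> P \<or> K \<subseteq> Q" using \<open>K \<subseteq> P \<union> Q\<close> by blast
      then show False using bad[of P Q] bad[of Q P] PQ by (auto simp: Un_commute Int_commute)
    qed
  qed
  have One: "?O \<noteq> {}" using K(3) KT by blast
  show False
  proof (cases "connectedin T ?O")
    case True
    let ?L = "T closure_of ?O"
    have "connectedin T ?L" using True by (rule connectedin_closure_of)
    moreover have "?L \<subseteq> topspace T - U"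
      using U by (intro closure_of_minimal) auto
    moreover have "?O \<subseteq> ?L" by (simp add: closure_of_subset)
    moreover have "U \<subseteq> topspace T" using U openin_subset by blast
    ultimately have "proper_subcontinuum T ?L" using cont[of ?L] One U(2) by auto
    moreover have "proper_subcontinuum T K" using cont[OF K(1,2)] K(3) U by auto
    moreover have "K \<union> ?L = topspace T" using \<open>?O \<subseteq> ?L\<close> KT closure_of_subset_topspace[of T ?O] by blast
    ultimately show False using cT(4) unfolding decomposable_def by metis
  next
    case False
    have oO: "openin T ?O" using K(1) by auto
    have "\<exists>G H. openin T G \<and> G \<subseteq> ?O \<and> openin T H \<and> H \<subseteq> ?O \<and> ?O \<subseteq> G \<union> H \<and>
        G \<inter> H = {} \<and> G \<noteq> {} \<and> H \<noteq> {}"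
      using False unfolding connectedin_def connected_space_def openin_open_subtopology[OF oO]
      by (simp add: Int_absorb1 conj_assoc) metis
    then obtain G H where GH': "openin T G" "openin T H" "G \<subseteq> ?O" "H \<subseteq> ?O" "?O \<subseteq> G \<union> H"
        "G \<inter> H = {}" "G \<noteq> {}" "H \<noteq> {}" by (elim exE conjE)
    then have GH: "openin T G" "openin T H" "G \<union> H = ?O" "G \<inter> H = {}" "G \<noteq> {}" "H \<noteq> {}"
      by (simp_all add: subset_antisym)
    have GT: "G \<subseteq> topspace T" "H \<subseteq> topspace T" using GH openin_subset by blast+
    have "proper_subcontinuum T (K \<union> G)"
      using KUconn[OF GH(1,2,4,3)] cont[of "K \<union> G"] U GH(3-6) GT by blast
    moreover have "proper_subcontinuum T (K \<union> H)"
      using KUconn[OF GH(2,1)] cont[of "K \<union> H"] U GH(3-6) GT by blast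
    moreover have "K \<union> G \<union> (K \<union> H) = topspace T" using GH(3) KT GT by blast
    ultimately show False using cT(4) unfolding decomposable_def by metis
  qed
qed

section \<open>The Higson corona\<close>

text \<open>This is asymptotic disjointness, the complement of the proximity that defines the
  corona. It suffices to bound the side of \<open>A\<close>: the partners in \<open>B\<close> lie
  within \<open>r\<close> of it, which is the content of \<open>divergent_sym\<close>.\<close>

definition divergent :: "'a::metric_space set \<Rightarrow> 'a set \<Rightarrow> bool" where
  "divergent A B \<longleftrightarrow> (\<forall>r. bounded {a \<in> A. \<exists>b\<in>B. dist a b \<le> r})"

definition corona_trace :: "'a::metric_space set \<Rightarrow> 'a set \<Rightarrow> (('a \<Rightarrow> real) \<Rightarrow> real) set" where
  "corona_trace X A =
     topspace (higson_corona X) \<inter> higson_cube X closure_of (higson_embedding X ` A)"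

lemma bounded_near:
  fixes M N :: "'a::metric_space set"
  assumes "bounded M" and "\<And>x. x \<in> N \<Longrightarrow> \<exists>m\<in>M. dist x m \<le> r"
  shows "bounded N"
proof -
  obtain c R where "\<And>m. m \<in> M \<Longrightarrow> dist c m \<le> R" using assms(1) unfolding bounded_def by blast
  then have "dist c x \<le> R + r" if "x \<in> N" for x
    using assms(2)[OF that] by (meson add_mono dist_commute_lessI dist_triangle2 order_trans)
  then show ?thesis unfolding bounded_def by blast
qed

lemma divergent_sym:
  assumes "divergent A B" shows "divergent B A"
  unfolding divergent_def
proof
  fix r
  show "bounded {b \<in> B. \<exists>a\<in>A. dist b a \<le> r}"
  proof (rule bounded_near)
    show "bounded {a \<in> A. \<exists>b\<in>B. dist a b \<le> r}" using assms by (simp add: divergent_def)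
    fix x assume "x \<in> {b \<in> B. \<exists>a\<in>A. dist b a \<le> r}"
    then obtain a where a: "x \<in> B" "a \<in> A" "dist x a \<le> r" by auto
    then have "a \<in> {a \<in> A. \<exists>b\<in>B. dist a b \<le> r}" using dist_commute[of x a] by auto
    then show "\<exists>m\<in>{a \<in> A. \<exists>b\<in>B. dist a b \<le> r}. dist x m \<le> r"
      using a(3) by (rule rev_bexI)
  qed
qed

lemma proper_metric_bounded_subset_compact:
  assumes "proper_metric X" "S \<subseteq> X" "bounded S"
  obtains K where "K \<subseteq> X" "compact K" "S \<subseteq> K"
proof (cases "S = {}")
  case True
  then show thesis using that[of "{}"] by simp
next
  case False
  then obtain x where x: "x \<in> S" by blast
  obtain R where "\<forall>y\<in>S. dist x y \<le> R" using assms(3) bounded_any_center[of S x] by blast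
  then have "S \<subseteq> X \<inter> cball x R" using assms(2) by auto
  moreover have "compact (X \<inter> cball x R)" using assms(1,2) x by (auto simp: proper_metric_def)
  ultimately show thesis by (intro that[of "X \<inter> cball x R"]) auto
qed

lemma higson_functionsI:
  assumes "continuous_on X f" "bounded (f ` X)"
    and osc: "\<And>r \<epsilon>. 0 < r \<Longrightarrow> 0 < \<epsilon> \<Longrightarrow>
      \<exists>K\<subseteq>X. compact K \<and> (\<forall>x\<in>X - K. \<forall>y\<in>X. dist x y \<le> r \<longrightarrow> \<bar>f x - f y\<bar> \<le> \<epsilon>)"
  shows "restrict f X \<in> higson_functions X"
proof -
  have "\<exists>K\<subseteq>X. compact K \<and> (\<forall>x\<in>X - K. diameter (restrict f X ` (X \<inter> cball x r)) < \<epsilon>)"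
    if "0 < r" "0 < \<epsilon>" for r \<epsilon>
  proof -
    \<comment> \<open>Two points of a ball are compared through its centre, which doubles the
      oscillation; thirds leave room for the strict inequality.\<close>
    have "\<exists>K\<subseteq>X. compact K \<and> (\<forall>x\<in>X - K. \<forall>y\<in>X. dist x y \<le> r \<longrightarrow> \<bar>f x - f y\<bar> \<le> \<epsilon> / 3)"
      by (rule osc) (use that in auto)
    then obtain K where K: "K \<subseteq> X" "compact K"
      and osc: "\<And>x y. x \<in> X - K \<Longrightarrow> y \<in> X \<Longrightarrow> dist x y \<le> r \<Longrightarrow> \<bar>f x - f y\<bar> \<le> \<epsilon> / 3"
      by metis
    have "diameter (restrict f X ` (X \<inter> cball x r)) < \<epsilon>" if x: "x \<in> X - K" for x
    proof -
      have "diameter (restrict f X ` (X \<inter> cball x r)) \<le> 2 * \<epsilon> / 3"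
      proof (rule diameter_le)
        show "restrict f X ` (X \<inter> cball x r) \<noteq> {} \<or> 0 \<le> 2 * \<epsilon> / 3" using \<open>0 < \<epsilon>\<close> by simp
        fix u v assume "u \<in> restrict f X ` (X \<inter> cball x r)" "v \<in> restrict f X ` (X \<inter> cball x r)"
        then obtain y z where "u = f y" "v = f z" "y \<in> X" "z \<in> X" "dist x y \<le> r" "dist x z \<le> r" by auto
        then have "\<bar>f x - f y\<bar> \<le> \<epsilon> / 3" "\<bar>f x - f z\<bar> \<le> \<epsilon> / 3" "norm (u - v) = \<bar>f y - f z\<bar>"
          using osc[OF x, of y] osc[OF x, of z] by auto
        then show "norm (u - v) \<le> 2 * \<epsilon> / 3" by arith
      qed
      then show ?thesis using \<open>0 < \<epsilon>\<close> by simp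
    qed
    then show ?thesis using K by blast
  qed
  moreover have "continuous_on X (restrict f X)" using assms(1) by (simp cong: continuous_on_cong)
  moreover have "restrict f X ` X = f ` X" by auto
  ultimately show ?thesis using assms(2) by (simp add: higson_functions_def)
qed

lemma higson_functions_osc:
  assumes f: "f \<in> higson_functions X" and "0 < r" "0 < \<epsilon>"
  obtains K where "K \<subseteq> X" "compact K"
    "\<And>x y. x \<in> X - K \<Longrightarrow> y \<in> X \<Longrightarrow> dist x y \<le> r \<Longrightarrow> \<bar>f x - f y\<bar> < \<epsilon>"
proof -
  have "\<exists>K\<subseteq>X. compact K \<and> (\<forall>x\<in>X - K. diameter (f ` (X \<inter> cball x r)) < \<epsilon>)"
    using assms unfolding higson_functions_def by blast
  then obtain K where K: "K \<subseteq> X" "compact K" "\<And>x. x \<in> X - K \<Longrightarrow> diameter (f ` (X \<inter> cball x r)) < \<epsilon>"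
    by metis
  have "\<bar>f x - f y\<bar> < \<epsilon>" if "x \<in> X - K" "y \<in> X" "dist x y \<le> r" for x y
  proof -
    have "bounded (f ` (X \<inter> cball x r))"
      by (rule bounded_subset[of "f ` X"]) (use f in \<open>auto simp: higson_functions_def\<close>)
    moreover have "f x \<in> f ` (X \<inter> cball x r)" "f y \<in> f ` (X \<inter> cball x r)"
      using that \<open>0 < r\<close> by auto
    ultimately have "dist (f x) (f y) \<le> diameter (f ` (X \<inter> cball x r))"
      by (rule diameter_bounded_bound)
    then show ?thesis using K(3)[OF that(1)] by (simp add: dist_real_def)
  qed
  then show thesis using that K(1,2) by blast
qed

lemma higson_functions_bounds:
  assumes "f \<in> higson_functions X" "x \<in> X"
  shows "f x \<in> {Inf (f ` X)..Sup (f ` X)}"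
proof -
  have "bounded (f ` X)" using assms(1) by (simp add: higson_functions_def)
  then have "bdd_above (f ` X)" "bdd_below (f ` X)"
    by (simp_all add: bounded_imp_bdd_above bounded_imp_bdd_below)
  then show ?thesis using assms(2) by (simp add: cINF_lower cSUP_upper)
qed

section \<open>The cube, and the corona as a closed subset of it\<close>

lemma compact_higson_cube: "compact_space (higson_cube X)"
  unfolding higson_cube_def compact_space_product_topology
  by (simp add: compact_space_subtopology)

lemma Hausdorff_higson_cube: "Hausdorff_space (higson_cube X)"
  unfolding higson_cube_def Hausdorff_space_product_topology
  by (simp add: Hausdorff_space_subtopology)

lemma continuous_map_higson_embedding:
  "continuous_map (top_of_set X) (higson_cube X) (higson_embedding X)"
  unfolding higson_cube_def continuous_map_componentwise
proof (intro conjI ballI)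
  show "higson_embedding X ` topspace (top_of_set X) \<subseteq> extensional (higson_functions X)"
    by (auto simp: higson_embedding_def)
  fix f assume f: "f \<in> higson_functions X"
  then have "continuous_on X f" by (simp add: higson_functions_def)
  moreover have "(\<lambda>x. higson_embedding X x f) = f" using f by (auto simp: higson_embedding_def)
  ultimately show "continuous_map (top_of_set X) (top_of_set {Inf (f ` X)..Sup (f ` X)})
      (\<lambda>x. higson_embedding X x f)"
    using higson_functions_bounds[OF f] by auto
qed

lemma higson_embedding_in_cube: "A \<subseteq> X \<Longrightarrow> higson_embedding X ` A \<subseteq> topspace (higson_cube X)"
  using continuous_map_image_subset_topspace[OF continuous_map_higson_embedding, of X] by auto

lemma closedin_higson_embedding_compact:
  assumes "K \<subseteq> X" "compact K"
  shows "closedin (higson_cube X) (higson_embedding X ` K)"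
proof (rule compactin_imp_closedin[OF Hausdorff_higson_cube])
  have "compactin (top_of_set X) K" using assms by (simp add: compactin_subtopology)
  then show "compactin (higson_cube X) (higson_embedding X ` K)"
    using continuous_map_higson_embedding by (rule image_compactin)
qed

lemma continuous_map_higson_coordinate:
  assumes "f \<in> higson_functions X"
  shows "continuous_map (higson_cube X) euclideanreal (\<lambda>p. p f)"
  using continuous_map_product_projection[OF assms] unfolding higson_cube_def
  by (rule continuous_map_into_fulltopology)

lemma closure_coordinate_in_closed:
  assumes f: "f \<in> higson_functions X" and A: "A \<subseteq> X" and C: "closed C" "\<And>a. a \<in> A \<Longrightarrow> f a \<in> C"
    and p: "p \<in> higson_cube X closure_of (higson_embedding X ` A)"
  shows "p f \<in> C"
proof -
  have "closedin (higson_cube X) {p \<in> topspace (higson_cube X). p f \<in> C}"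
    using closedin_continuous_map_preimage[OF continuous_map_higson_coordinate[OF f]] C(1) by simp
  moreover have "higson_embedding X ` A \<subseteq> {p \<in> topspace (higson_cube X). p f \<in> C}"
    using higson_embedding_in_cube[OF A] C(2) f by (auto simp: higson_embedding_def)
  ultimately show ?thesis using p closure_of_minimal by blast
qed

lemma topspace_higson_corona:
  "topspace (higson_corona X) =
     higson_cube X closure_of (higson_embedding X ` X) - higson_embedding X ` X"
  using closure_of_subset_topspace[of "higson_cube X" "higson_embedding X ` X"]
  by (auto simp: higson_corona_def higson_compactification_def)

lemma higson_corona_eq_subtopology:
  "higson_corona X = subtopology (higson_cube X) (topspace (higson_corona X))"
proof -
  let ?C = "higson_cube X closure_of (higson_embedding X ` X)"
  have "topspace (higson_compactification X) = ?C"
    using closure_of_subset_topspace[of "higson_cube X" "higson_embedding X ` X"]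
    by (auto simp: higson_compactification_def)
  moreover have "?C \<inter> (?C - higson_embedding X ` X) = ?C - higson_embedding X ` X" by blast
  ultimately show ?thesis
    unfolding topspace_higson_corona
    by (simp add: higson_corona_def higson_compactification_def subtopology_subtopology)
qed

text \<open>The image of a compact set is already closed and consists of points of \<open>X\<close>,
  so it contributes nothing at infinity.\<close>

lemma closure_tail:
  assumes "A \<subseteq> X" "K \<subseteq> X" "compact K" "p \<notin> higson_embedding X ` X"
    and "p \<in> higson_cube X closure_of (higson_embedding X ` A)"
  shows "p \<in> higson_cube X closure_of (higson_embedding X ` (A - K))"
proof -
  have "higson_cube X closure_of (higson_embedding X ` (A \<inter> K)) \<subseteq> higson_embedding X ` K"
    by (rule closure_of_minimal) (use closedin_higson_embedding_compact assms in auto)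
  moreover have "higson_embedding X ` A = higson_embedding X ` (A \<inter> K) \<union> higson_embedding X ` (A - K)"
    by blast
  ultimately show ?thesis using assms(2,4,5) image_mono[OF assms(2), of "higson_embedding X"]
    unfolding closure_of_Un by (metis (no_types, lifting) UnE closure_of_Un subsetD)
qed

text \<open>The bumps single out the corona inside the closure of \<open>X\<close>: all of them
  vanish at a corona point, while the image of \<open>x\<close> has value 1 at the bump about
  \<open>x\<close>. This makes the corona an intersection of closed sets. For the oscillation,
  beyond radius \<open>r + 1\<close> both values compared are 0.\<close>

lemma bump_in_higson_functions:
  assumes X: "proper_metric X" and x: "x \<in> X"
  shows "(\<lambda>z\<in>X. max 0 (1 - dist z x)) \<in> higson_functions X"
proof (rule higson_functionsI)
  show "continuous_on X (\<lambda>z. max 0 (1 - dist z x))" by (intro continuous_intros)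
  show "bounded ((\<lambda>z. max 0 (1 - dist z x)) ` X)"
    by (rule bounded_subset[of "{0..1}"]) auto
  fix r \<epsilon> :: real assume "0 < r" "0 < \<epsilon>"
  have "compact (X \<inter> cball x (r + 1))" using X x by (simp add: proper_metric_def)
  moreover have "\<bar>max 0 (1 - dist z x) - max 0 (1 - dist y x)\<bar> \<le> \<epsilon>"
    if "z \<in> X - X \<inter> cball x (r + 1)" "dist z y \<le> r" for z y
  proof -
    have "r + 1 < dist z x" using that(1) by (auto simp: dist_commute)
    moreover have "dist z x \<le> dist z y + dist y x" by (rule dist_triangle)
    ultimately show ?thesis using that(2) \<open>0 < r\<close> \<open>0 < \<epsilon>\<close> by auto
  qed
  ultimately show "\<exists>K\<subseteq>X. compact K \<and> (\<forall>z\<in>X - K. \<forall>y\<in>X. dist z y \<le> r \<longrightarrow>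
      \<bar>max 0 (1 - dist z x) - max 0 (1 - dist y x)\<bar> \<le> \<epsilon>)"
    by (intro exI[of _ "X \<inter> cball x (r + 1)"]) auto
qed

lemma bump_vanishes:
  assumes X: "proper_metric X" and x: "x \<in> X" and A: "A \<subseteq> X - cball x 1"
    and p: "p \<in> higson_cube X closure_of (higson_embedding X ` A)"
  shows "p (\<lambda>z\<in>X. max 0 (1 - dist z x)) = 0"
proof -
  have "p (\<lambda>z\<in>X. max 0 (1 - dist z x)) \<in> {0}"
    by (rule closure_coordinate_in_closed[OF bump_in_higson_functions[OF X x] _ _ _ p])
      (use A in \<open>auto simp: dist_commute\<close>)
  then show ?thesis by simp
qed

lemma bump_eq_0_outside:
  assumes X: "proper_metric X" and p: "\<And>x. x \<in> X \<Longrightarrow> p (\<lambda>z\<in>X. max 0 (1 - dist z x)) = 0"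
  shows "p \<notin> higson_embedding X ` X"
proof
  assume "p \<in> higson_embedding X ` X"
  then obtain x where x: "x \<in> X" "p = higson_embedding X x" by blast
  then have "p (\<lambda>z\<in>X. max 0 (1 - dist z x)) = 1"
    using bump_in_higson_functions[OF X x(1)] by (simp add: higson_embedding_def)
  then show False using p[OF x(1)] by simp
qed

lemma topspace_higson_corona_bumps:
  assumes X: "proper_metric X"
  shows "topspace (higson_corona X) = {p \<in> higson_cube X closure_of (higson_embedding X ` X).
    \<forall>x\<in>X. p (\<lambda>z\<in>X. max 0 (1 - dist z x)) = 0}"
proof -
  have "p (\<lambda>z\<in>X. max 0 (1 - dist z x)) = 0"
    if "p \<in> topspace (higson_corona X)" "x \<in> X" for p x
  proof -
    have "compact (X \<inter> cball x 1)" using X that(2) by (simp add: proper_metric_def)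
    then have "p \<in> higson_cube X closure_of (higson_embedding X ` (X - (X \<inter> cball x 1)))"
      using that(1) by (intro closure_tail) (auto simp: topspace_higson_corona)
    then show ?thesis by (rule bump_vanishes[OF X that(2), rotated]) auto
  qed
  moreover have "p \<notin> higson_embedding X ` X"
    if "\<forall>x\<in>X. p (\<lambda>z\<in>X. max 0 (1 - dist z x)) = 0" for p
    using bump_eq_0_outside[OF X] that by blast
  ultimately show ?thesis unfolding topspace_higson_corona by auto
qed

lemma closedin_topspace_higson_corona:
  assumes X: "proper_metric X"
  shows "closedin (higson_cube X) (topspace (higson_corona X))"
proof (cases "X = {}")
  case True
  then show ?thesis by (simp add: topspace_higson_corona)
next
  case False
  have "closedin (higson_cube X) (higson_cube X closure_of (higson_embedding X ` X) \<inter>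
      (\<Inter>x\<in>X. {p \<in> topspace (higson_cube X). p (\<lambda>z\<in>X. max 0 (1 - dist z x)) \<in> {0}}))"
    using False bump_in_higson_functions[OF X]
    by (intro closedin_Int closedin_closure_of closedin_INT
        closedin_continuous_map_preimage[OF continuous_map_higson_coordinate]) auto
  moreover have "higson_cube X closure_of (higson_embedding X ` X) \<inter>
      (\<Inter>x\<in>X. {p \<in> topspace (higson_cube X). p (\<lambda>z\<in>X. max 0 (1 - dist z x)) \<in> {0}})
      = topspace (higson_corona X)"
    using closure_of_subset_topspace[of "higson_cube X" "higson_embedding X ` X"] False
    unfolding topspace_higson_corona_bumps[OF X] by auto
  ultimately show ?thesis by simp
qed

text \<open>Here \<open>a\<close> and \<open>b\<close> stand for the distances of a point to two
  sets, and \<open>d\<close> for the distance moved. The numerator contributes \<open>d\<close> and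
  the denominator \<open>2 * d\<close>; the estimate is good where \<open>a + b\<close> is
  large.\<close>

lemma quotient_oscillation:
  fixes a b a' b' d :: real
  assumes "0 \<le> a" "0 \<le> b" "0 \<le> a'" "0 \<le> b'" "\<bar>a - a'\<bar> \<le> d" "\<bar>b - b'\<bar> \<le> d"
  shows "\<bar>a / (1 + a + b) - a' / (1 + a' + b')\<bar> \<le> 3 * d / (1 + a + b)"
proof -
  define D D' where "D = 1 + a + b" and "D' = 1 + a' + b'"
  have D: "D > 0" "D' > 0" "a' \<le> D'" "\<bar>D' - D\<bar> \<le> 2 * d" using assms by (auto simp: D_def D'_def)
  have "a / D - a' / D' = ((a - a') * D' + a' * (D' - D)) / (D * D')"
    using D by (simp add: field_simps)
  also have "\<bar>\<dots>\<bar> = \<bar>(a - a') * D' + a' * (D' - D)\<bar> / (D * D')"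
    using D by (simp add: abs_mult)
  also have "\<dots> \<le> (3 * d * D') / (D * D')"
  proof (rule divide_right_mono)
    have "\<bar>(a - a') * D' + a' * (D' - D)\<bar> \<le> \<bar>(a - a') * D'\<bar> + \<bar>a' * (D' - D)\<bar>" by (rule abs_triangle_ineq)
    also have "\<bar>(a - a') * D'\<bar> \<le> d * D'" using assms(5) D by (simp add: abs_mult mult_right_mono)
    also have "\<bar>a' * (D' - D)\<bar> \<le> D' * (2 * d)"
      using assms(3) D unfolding abs_mult by (intro mult_mono) auto
    finally show "\<bar>(a - a') * D' + a' * (D' - D)\<bar> \<le> 3 * d * D'" by (simp add: algebra_simps)
  qed (use D in auto)
  also have "\<dots> = 3 * d / D" using D by simp
  finally show ?thesis by (simp add: D_def D'_def)
qed

text \<open>\<open>f\<close> is the Urysohn quotient of the two distances, with 1 added to the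
  denominator because \<open>A\<close> and \<open>B\<close> may meet. Divergence says that the
  points near both sets form a bounded set, and elsewhere \<open>quotient_oscillation\<close> makes
  the variation small, so \<open>f\<close> extends to the corona. Empty sets are split off because
  \<open>infdist\<close> to the empty set is 0 by convention.\<close>

lemma divergent_imp_disjoint:
  assumes X: "proper_metric X" and A: "A \<subseteq> X" and B: "B \<subseteq> X" and div: "divergent A B"
  shows "corona_trace X A \<inter> corona_trace X B = {}"
proof (cases "A = {} \<or> B = {}")
  case True
  then show ?thesis by (auto simp: corona_trace_def)
next
  case False
  then have ne: "A \<noteq> {}" "B \<noteq> {}" by auto
  define f where "f x = infdist x A / (1 + infdist x A + infdist x B)" for x
  have pos: "0 \<le> infdist x A" "0 \<le> infdist x B" for x by (simp_all add: infdist_nonneg)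
  have near: "\<exists>a\<in>C. dist x a \<le> s" if "C \<noteq> {}" "infdist x C < s" for x s C
    using cINF_less_iff[of C "dist x"] that bdd_below_image_dist[of x C]
    unfolding infdist_def by (auto intro: less_imp_le)
  have f: "restrict f X \<in> higson_functions X"
  proof (rule higson_functionsI)
    have "1 + infdist x A + infdist x B \<noteq> 0" for x using pos[of x] by linarith
    then show "continuous_on X f" unfolding f_def by (intro continuous_intros) auto
    have "f x \<in> {0..1}" for x using pos[of x] by (simp add: f_def divide_le_eq)
    then show "bounded (f ` X)" by (intro bounded_subset[OF bounded_closed_interval[of 0 1]]) auto
    fix r \<epsilon> :: real assume re: "0 < r" "0 < \<epsilon>"
    \<comment> \<open>Chosen so that 3r divided by the sum of the two distances is at most
      \<open>\<epsilon>\<close> once that sum reaches \<open>s\<close>.\<close>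
    define s where "s = 3 * r / \<epsilon>"
    let ?S = "{x \<in> X. infdist x A + infdist x B < s}"
    have "bounded ?S"
    proof (rule bounded_near[of "{a \<in> A. \<exists>b\<in>B. dist a b \<le> 2 * s}" _ s])
      show "bounded {a \<in> A. \<exists>b\<in>B. dist a b \<le> 2 * s}" using div by (simp add: divergent_def)
      fix x assume "x \<in> ?S"
      then have "infdist x A < s" "infdist x B < s" using pos[of x] by auto
      from near[OF ne(1) this(1)] near[OF ne(2) this(2)]
      obtain a b where "a \<in> A" "b \<in> B" "dist x a \<le> s" "dist x b \<le> s" by auto
      moreover from this have "dist a b \<le> 2 * s" using dist_triangle3[of a b x] by simp
      ultimately show "\<exists>m\<in>{a \<in> A. \<exists>b\<in>B. dist a b \<le> 2 * s}. dist x m \<le> s" by blast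
    qed
    then obtain K where K: "K \<subseteq> X" "compact K" "?S \<subseteq> K"
      using proper_metric_bounded_subset_compact[OF X, of ?S] by auto
    have "\<bar>f x - f y\<bar> \<le> \<epsilon>" if "x \<in> X - K" "dist x y \<le> r" for x y
    proof -
      have "\<bar>f x - f y\<bar> \<le> 3 * dist x y / (1 + infdist x A + infdist x B)"
        unfolding f_def by (rule quotient_oscillation) (auto simp: infdist_nonneg infdist_triangle_abs)
      also have "\<dots> \<le> 3 * r / (1 + infdist x A + infdist x B)"
        using that(2) pos[of x] by (intro divide_right_mono) auto
      also have "\<dots> \<le> \<epsilon>"
      proof -
        have "s \<le> infdist x A + infdist x B" using that(1) K(3) by force
        then have "3 * r \<le> \<epsilon> * (infdist x A + infdist x B)"
          using re by (simp add: s_def pos_divide_le_eq mult.commute)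
        then have "3 * r \<le> \<epsilon> * (1 + infdist x A + infdist x B)"
          using re by (simp add: algebra_simps)
        then show ?thesis using pos[of x] by (simp add: divide_le_eq)
      qed
      finally show ?thesis .
    qed
    then show "\<exists>K\<subseteq>X. compact K \<and> (\<forall>x\<in>X - K. \<forall>y\<in>X. dist x y \<le> r \<longrightarrow> \<bar>f x - f y\<bar> \<le> \<epsilon>)"
      using K by blast
  qed
  have False if p: "p \<in> corona_trace X A" "p \<in> corona_trace X B" for p
  proof -
    have "p (restrict f X) \<in> {0}"
      by (rule closure_coordinate_in_closed[OF f A])
        (use p(1) A in \<open>auto simp: f_def corona_trace_def\<close>)
    \<comment> \<open>Off a compact set a point of \<open>B\<close> has distance at least 2 from
      \<open>A\<close> and distance 0 from \<open>B\<close>, so \<open>f\<close> is at least 2/3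
      there, whereas \<open>f\<close> is 0 on \<open>A\<close>.\<close>
    have "bounded {b \<in> B. \<exists>a\<in>A. dist b a \<le> 2}" using divergent_sym[OF div] by (simp add: divergent_def)
    then obtain K where K: "K \<subseteq> X" "compact K" "{b \<in> B. \<exists>a\<in>A. dist b a \<le> 2} \<subseteq> K"
      using proper_metric_bounded_subset_compact[OF X, of "{b \<in> B. \<exists>a\<in>A. dist b a \<le> 2}"] B by auto
    have "p (restrict f X) \<in> {1 / 2..}"
    proof (rule closure_coordinate_in_closed[OF f])
      show "B - K \<subseteq> X" "closed {1 / 2 :: real..}" using B by auto
      show "p \<in> higson_cube X closure_of (higson_embedding X ` (B - K))"
        using p(2) K(1,2) B by (intro closure_tail) (auto simp: corona_trace_def topspace_higson_corona)
      fix b assume b: "b \<in> B - K"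
      then have "2 \<le> infdist b A" using near[OF ne(1), of b 2] K(3) by force
      moreover have "infdist b B = 0" using b by simp
      ultimately show "restrict f X b \<in> {1 / 2..}" using b B by (auto simp: f_def divide_simps)
    qed
    then show False using \<open>p (restrict f X) \<in> {0}\<close> by simp
  qed
  then show ?thesis by blast
qed

text \<open>The closures of the tails \<open>M - K\<close> have the finite intersection property,
  since finitely many compact sets cannot cover an unbounded set. A common point lies in the corona
  because every bump vanishes on some tail.\<close>

lemma corona_point_unbounded:
  assumes X: "proper_metric X" and M: "M \<subseteq> X" "\<not> bounded M"
  obtains p where "p \<in> topspace (higson_corona X)"
    "\<And>K. K \<subseteq> X \<Longrightarrow> compact K \<Longrightarrow> p \<in> higson_cube X closure_of (higson_embedding X ` (M - K))"
proof -
  let ?G = "\<lambda>K. higson_cube X closure_of (higson_embedding X ` (M - K))"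
  let ?\<U> = "?G ` {K. K \<subseteq> X \<and> compact K}"
  have "\<Inter>?\<U> \<noteq> {}"
    using compact_higson_cube[of X] unfolding compact_space_fip
  proof (elim allE[of _ ?\<U>] impE)
    show "(\<forall>C\<in>?\<U>. closedin (higson_cube X) C) \<and> (\<forall>\<F>. finite \<F> \<and> \<F> \<subseteq> ?\<U> \<longrightarrow> \<Inter>\<F> \<noteq> {})"
    proof (intro conjI allI impI)
      show "\<forall>C\<in>?\<U>. closedin (higson_cube X) C" by auto
      fix \<F> assume "finite \<F> \<and> \<F> \<subseteq> ?\<U>"
      then obtain \<K> where \<K>: "finite \<K>" "\<K> \<subseteq> {K. K \<subseteq> X \<and> compact K}" "\<F> = ?G ` \<K>"
        by (meson finite_subset_image)
      have "bounded (\<Union>\<K>)" using \<K>(1,2) by (intro bounded_Union) (auto intro: compact_imp_bounded)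
      then have "\<not> M \<subseteq> \<Union>\<K>" using M(2) bounded_subset by blast
      then obtain m where m: "m \<in> M" "m \<notin> \<Union>\<K>" by blast
      have "higson_embedding X m \<in> ?G K" if "K \<in> \<K>" for K
      proof -
        have "higson_embedding X ` (M - K) \<subseteq> ?G K"
          by (rule closure_of_subset) (use higson_embedding_in_cube[of "M - K" X] M(1) in auto)
        then show ?thesis using m that by auto
      qed
      then show "\<Inter>\<F> \<noteq> {}" using \<K>(3) by auto
    qed
  qed
  then obtain p where p: "\<And>K. K \<subseteq> X \<Longrightarrow> compact K \<Longrightarrow> p \<in> ?G K" by auto
  have "p (\<lambda>z\<in>X. max 0 (1 - dist z x)) = 0" if "x \<in> X" for x
  proof (rule bump_vanishes[OF X that])
    show "p \<in> ?G (X \<inter> cball x 1)" using p[of "X \<inter> cball x 1"] X that by (simp add: proper_metric_def)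
    show "M - X \<inter> cball x 1 \<subseteq> X - cball x 1" using M(1) by auto
  qed
  moreover have "p \<in> higson_cube X closure_of (higson_embedding X ` X)"
    using p[of "{}"] closure_of_mono[of "higson_embedding X ` M" "higson_embedding X ` X"] M(1) by auto
  ultimately have "p \<in> topspace (higson_corona X)" by (simp add: topspace_higson_corona_bumps[OF X])
  then show thesis using that p by blast
qed

text \<open>If infinitely far out there are points of \<open>A\<close> with partners in
  \<open>B\<close> at distance at most \<open>r\<close>, a corona point in the closure of all tails
  of these points is also in the closure of \<open>B\<close>: far out, finitely many Higson
  functions cannot tell a point from its partner.\<close>

lemma disjoint_imp_divergent:
  assumes X: "proper_metric X" and A: "A \<subseteq> X" and B: "B \<subseteq> X"
    and disj: "corona_trace X A \<inter> corona_trace X B = {}"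
  shows "divergent A B"
proof (rule ccontr)
  assume "\<not> divergent A B"
  then obtain r0 where r0: "\<not> bounded {a \<in> A. \<exists>b\<in>B. dist a b \<le> r0}" by (auto simp: divergent_def)
  \<comment> \<open>\<open>higson_functions_osc\<close> asks for a positive radius; enlarging
    \<open>r0\<close> keeps the set unbounded.\<close>
  define r where "r = max r0 1"
  define M where "M = {a \<in> A. \<exists>b\<in>B. dist a b \<le> r}"
  have "\<not> bounded M" using r0 bounded_subset[of M "{a \<in> A. \<exists>b\<in>B. dist a b \<le> r0}"]
    unfolding M_def r_def by force
  moreover have MX: "M \<subseteq> X" using A by (auto simp: M_def)
  ultimately obtain p where p: "p \<in> topspace (higson_corona X)"
    and pK: "\<And>K. K \<subseteq> X \<Longrightarrow> compact K \<Longrightarrow> p \<in> higson_cube X closure_of (higson_embedding X ` (M - K))"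
    using corona_point_unbounded[OF X] by metis
  have pcube: "p \<in> topspace (higson_cube X)"
    using pK[of "{}"] closure_of_subset_topspace[of "higson_cube X"] by auto
  have "p \<in> higson_cube X closure_of (higson_embedding X ` A)"
    using pK[of "{}"] closure_of_mono[of "higson_embedding X ` M" "higson_embedding X ` A"]
    by (auto simp: M_def)
  moreover have "p \<in> higson_cube X closure_of (higson_embedding X ` B)"
    unfolding in_closure_of
  proof (intro conjI allI impI)
    show "p \<in> topspace (higson_cube X)" by (rule pcube)
    fix T assume T: "p \<in> T \<and> openin (higson_cube X) T"
    let ?I = "\<lambda>f. {Inf (f ` X)..Sup (f ` X)} :: real set"
    let ?H = "higson_functions X"
    obtain U where U: "finite {f \<in> ?H. U f \<noteq> ?I f}" "\<And>f. f \<in> ?H \<Longrightarrow> openin (top_of_set (?I f)) (U f)"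
      "p \<in> PiE ?H U" "PiE ?H U \<subseteq> T"
      using T unfolding higson_cube_def openin_product_topology_alt by auto
    \<comment> \<open>Only the finitely many coordinates in \<open>F\<close> constrain the basic
      neighbourhood. Half of the tolerance \<open>\<delta> f\<close> is spent on approximating
      \<open>p\<close> by \<open>m\<close>, the other half on moving from \<open>m\<close> to its
      partner \<open>b\<close> off the compact set \<open>L\<close>.\<close>
    define F where "F = {f \<in> ?H. U f \<noteq> ?I f}"
    have "\<exists>\<delta>>0. \<forall>y\<in>?I f. \<bar>y - p f\<bar> < \<delta> \<longrightarrow> y \<in> U f" if "f \<in> ?H" for f
    proof -
      have "p f \<in> U f" using U(3) that by auto
      then show ?thesis using U(2)[OF that] unfolding openin_euclidean_subtopology_iff
        by (auto simp: dist_real_def)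
    qed
    then obtain \<delta> where \<delta>: "\<And>f. f \<in> ?H \<Longrightarrow> \<delta> f > 0"
      "\<And>f y. f \<in> ?H \<Longrightarrow> y \<in> ?I f \<Longrightarrow> \<bar>y - p f\<bar> < \<delta> f \<Longrightarrow> y \<in> U f" by metis
    have "\<exists>K. K \<subseteq> X \<and> compact K \<and> (\<forall>x\<in>X - K. \<forall>y\<in>X. dist x y \<le> r \<longrightarrow> \<bar>f x - f y\<bar> < \<delta> f / 2)"
      if "f \<in> ?H" for f
    proof -
      have "0 < r" "0 < \<delta> f / 2" using \<delta>(1)[OF that] by (auto simp: r_def)
      from higson_functions_osc[OF that this] show ?thesis by metis
    qed
    then obtain K where K: "\<And>f. f \<in> ?H \<Longrightarrow> K f \<subseteq> X" "\<And>f. f \<in> ?H \<Longrightarrow> compact (K f)"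
      "\<And>f x y. f \<in> ?H \<Longrightarrow> x \<in> X - K f \<Longrightarrow> y \<in> X \<Longrightarrow> dist x y \<le> r \<Longrightarrow> \<bar>f x - f y\<bar> < \<delta> f / 2"
      by metis
    have FH: "F \<subseteq> ?H" "finite F" using U(1) by (auto simp: F_def)
    define L where "L = (\<Union>f\<in>F. K f)"
    have "compact L" "L \<subseteq> X" unfolding L_def using FH K(1,2) by (auto intro!: compact_UN)
    then have pL: "p \<in> higson_cube X closure_of (higson_embedding X ` (M - L))" using pK by simp
    define W where "W = (\<Inter>f\<in>F. {q \<in> topspace (higson_cube X). q f \<in> ball (p f) (\<delta> f / 2)}) \<inter> topspace (higson_cube X)"
    have "openin (higson_cube X) W"
      unfolding W_def
    proof (rule openin_INT[OF FH(2)])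
      fix f assume "f \<in> F"
      then show "openin (higson_cube X) {q \<in> topspace (higson_cube X). q f \<in> ball (p f) (\<delta> f / 2)}"
        by (intro openin_continuous_map_preimage[OF continuous_map_higson_coordinate])
          (use FH(1) in auto)
    qed
    moreover have "p \<in> W" unfolding W_def using pcube FH \<delta>(1) by auto
    ultimately obtain m where m: "m \<in> M - L" "higson_embedding X m \<in> W"
      using pL unfolding in_closure_of by blast
    obtain b where b: "b \<in> B" "dist m b \<le> r" using m(1) by (auto simp: M_def)
    have mX: "m \<in> X" "b \<in> X" using m(1) MX b(1) B by auto
    have "f b \<in> U f" if f: "f \<in> ?H" for f
    proof (cases "f \<in> F")
      case True
      have "\<bar>p f - f m\<bar> < \<delta> f / 2"
        using m(2) True f unfolding W_def by (auto simp: higson_embedding_def dist_real_def)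
      moreover have "\<bar>f m - f b\<bar> < \<delta> f / 2"
        using K(3)[OF f _ mX(2) b(2)] m(1) mX(1) True by (auto simp: L_def)
      ultimately show ?thesis
        using \<delta>(2)[OF f higson_functions_bounds[OF f mX(2)]] by linarith
    next
      case False
      then show ?thesis using f higson_functions_bounds[OF f mX(2)] by (auto simp: F_def)
    qed
    then have "higson_embedding X b \<in> PiE ?H U" by (auto simp: higson_embedding_def)
    then show "\<exists>y. y \<in> higson_embedding X ` B \<and> y \<in> T" using U(4) b(1) by blast
  qed
  ultimately show False using disj p by (auto simp: corona_trace_def)
qed

theorem higson_corona_model:
  assumes X: "proper_metric X"
  shows "boundary_model (higson_corona X) X (corona_trace X) divergent"
proof
  let ?C = "higson_cube X" and ?e = "higson_embedding X" and ?N = "topspace (higson_corona X)"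
  have N: "closedin ?C ?N" by (rule closedin_topspace_higson_corona[OF X])
  have NX: "?N = ?C closure_of (?e ` X) - ?e ` X" by (rule topspace_higson_corona)
  have eq: "subtopology ?C ?N = higson_corona X" by (rule higson_corona_eq_subtopology[symmetric])
  have "compact_space (subtopology ?C ?N)"
    by (intro compact_space_subtopology closedin_compact_space[OF compact_higson_cube N])
  then show "compact_space (higson_corona X)" by (simp only: eq)
  have "Hausdorff_space (subtopology ?C ?N)"
    by (intro Hausdorff_space_subtopology Hausdorff_higson_cube)
  then show "Hausdorff_space (higson_corona X)" by (simp only: eq)
  have "closedin (subtopology ?C ?N) (corona_trace X A)" for A
    unfolding closedin_subtopology corona_trace_def
    by (intro exI[of _ "?C closure_of (?e ` A)"]) auto
  then show "closedin (higson_corona X) (corona_trace X A)" for A by (simp only: eq)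
  show "corona_trace X {} = {}" by (simp add: corona_trace_def)
  show "corona_trace X (A \<union> B) = corona_trace X A \<union> corona_trace X B" for A B
    by (auto simp: corona_trace_def image_Un closure_of_Un)
  show "corona_trace X X = topspace (higson_corona X)"
    using NX by (auto simp: corona_trace_def)
  show "divergent A B \<longleftrightarrow> corona_trace X A \<inter> corona_trace X B = {}" if "A \<subseteq> X" "B \<subseteq> X" for A B
    using divergent_imp_disjoint[OF X that] disjoint_imp_divergent[OF X that] by blast
  show "\<exists>A\<subseteq>X. p \<notin> corona_trace X (X - A) \<and> corona_trace X A \<subseteq> U"
    if U: "openin (higson_corona X) U" "p \<in> U" for U p
  proof -
    have "openin (subtopology ?C ?N) U" using U(1) by (simp only: eq)
    then obtain O1 where O1: "openin ?C O1" "U = O1 \<inter> ?N" by (auto simp: openin_subtopology)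
    \<comment> \<open>Regularity places an open \<open>G\<close> and a closed \<open>D\<close>
      between \<open>p\<close> and \<open>O1\<close>: \<open>G\<close> keeps \<open>p\<close> out of
      the closure of the complement of \<open>?A\<close>, and \<open>D\<close> contains the closure
      of \<open>?A\<close>.\<close>
    have "regular_space ?C"
      by (rule compact_Hausdorff_imp_regular_space[OF compact_higson_cube Hausdorff_higson_cube])
    then obtain G D where GD: "openin ?C G" "closedin ?C D" "p \<in> G" "G \<subseteq> D" "D \<subseteq> O1"
      using O1 U(2) unfolding neighbourhood_base_of_closedin[symmetric] neighbourhood_base_of
      by (metis IntD1)
    let ?A = "{x \<in> X. ?e x \<in> G}"
    have "p \<notin> ?C closure_of (?e ` (X - ?A))"
      unfolding in_closure_of using GD(1,3) by blast
    moreover have "?C closure_of (?e ` ?A) \<subseteq> D"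
      by (rule closure_of_minimal) (use GD in auto)
    ultimately show ?thesis
      using GD(5) O1(2) by (intro exI[of _ ?A]) (auto simp: corona_trace_def)
  qed
qed

section \<open>Indecomposability of the corona of the naturals\<close>

text \<open>Finite stands in for bounded, as balls are finite where this is used. The metric is an
  argument because the path metric of a net lives on points that already carry another
  metric.\<close>

definition graph_divergent :: "('v \<Rightarrow> 'v \<Rightarrow> nat) \<Rightarrow> 'v set \<Rightarrow> 'v set \<Rightarrow> bool" where
  "graph_divergent \<rho> A B \<longleftrightarrow> (\<forall>n. finite {a \<in> A. \<exists>b\<in>B. \<rho> a b \<le> n})"

definition nat_dist :: "nat \<Rightarrow> nat \<Rightarrow> nat" where
  "nat_dist m n = nat \<bar>int m - int n\<bar>"

lemma graph_divergentD: "graph_divergent \<rho> A B \<Longrightarrow> finite {a \<in> A. \<exists>b\<in>B. \<rho> a b \<le> n}"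
  by (simp add: graph_divergent_def)

lemma graph_divergent_self:
  assumes "\<And>a. a \<in> A \<Longrightarrow> \<rho> a a = 0"
  shows "graph_divergent \<rho> A A \<longleftrightarrow> finite A"
proof
  assume "graph_divergent \<rho> A A"
  then have "finite {a \<in> A. \<exists>b\<in>A. \<rho> a b \<le> 0}" by (rule graph_divergentD)
  moreover have "{a \<in> A. \<exists>b\<in>A. \<rho> a b \<le> 0} = A" using assms by auto
  ultimately show "finite A" by simp
qed (simp add: graph_divergent_def)

lemma nat_exit:
  assumes "a \<in> A" "b \<notin> A" "a \<le> b"
  shows "\<exists>k::nat\<ge>a. k \<in> A \<and> Suc k \<notin> A"
  using assms(3,2)
proof (induction b rule: dec_induct)
  case base
  then show ?case using assms(1) by simp
next
  case (step n)
  then show ?case by (cases "n \<in> A") auto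
qed

locale nat_boundary_model = boundary_model T "UNIV :: nat set" cl "graph_divergent nat_dist"
  for T :: "'p topology" and cl
begin

lemma cl_empty_iff: "cl A = {} \<longleftrightarrow> finite A"
  using dv_self[of A] graph_divergent_self[of A nat_dist] by (simp add: nat_dist_def)

lemma connected: "connected_space T"
proof (rule connectedI)
  fix A :: "nat set" assume dv: "graph_divergent nat_dist A (UNIV - A)"
  have "finite A \<or> finite (UNIV - A)"
  proof (rule ccontr)
    \<comment> \<open>Divergence leaves only finitely many places where the successor exits
      \<open>A\<close>, but two infinite complementary sets produce such an exit beyond every
      bound.\<close>
    assume inf: "\<not> (finite A \<or> finite (UNIV - A))"
    obtain N where N: "\<And>a. a \<in> A \<Longrightarrow> \<exists>b\<in>UNIV - A. nat_dist a b \<le> 1 \<Longrightarrow> a < N"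
      using graph_divergentD[OF dv, of 1] unfolding finite_nat_set_iff_bounded by auto
    obtain a where a: "a \<in> A" "a \<ge> N" using inf infinite_nat_iff_unbounded_le by blast
    obtain b where b: "b \<notin> A" "b \<ge> a" using inf infinite_nat_iff_unbounded_le[of "UNIV - A"] by blast
    obtain k where k: "k \<ge> a" "k \<in> A" "Suc k \<notin> A" using nat_exit[OF a(1) b] by blast
    then have "k < N" by (intro N bexI[of _ "Suc k"]) (auto simp: nat_dist_def)
    then show False using k(1) a(2) by simp
  qed
  then show "cl A = {} \<or> cl (UNIV - A) = {}" by (simp add: cl_empty_iff)
qed

text \<open>
  Two proper subcontinua \<open>P\<close>, \<open>Q\<close> covering the space yield infinite sets \<open>A\<close>, \<open>B\<close> of naturals with
  \<open>cl A \<subseteq> P\<close> and \<open>cl B\<close> disjoint from \<open>P\<close>. Cutting the naturals at points \<open>b n\<close> deep in \<open>B\<close>, with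
  points of \<open>A\<close> in between, and separating the resulting intervals by the parity of their index
  disconnects \<open>P\<close>.
\<close>

lemma not_decomposable: "\<not> decomposable T"
proof
  assume "decomposable T"
  then obtain P Q where PQ: "proper_subcontinuum T P" "proper_subcontinuum T Q" "P \<union> Q = topspace T"
    unfolding decomposable_def by blast
  have closed: "closedin T C" if "proper_subcontinuum T C" for C
  proof (rule compactin_imp_closedin[OF Hausdorff])
    show "compactin T C"
      using that by (auto simp: proper_subcontinuum_def continuum_space_def compactin_subspace)
  qed
  obtain p where p: "p \<in> topspace T" "p \<notin> Q" using PQ(2) by (auto simp: proper_subcontinuum_def)
  obtain q where q: "q \<in> topspace T" "q \<notin> P" using PQ(1) by (auto simp: proper_subcontinuum_def)
  obtain A where A: "p \<notin> cl (UNIV - A)" "cl A \<inter> Q = {}"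
    by (rule separate_point[OF p(1) closed[OF PQ(2)] p(2)])
  obtain B where B: "q \<notin> cl (UNIV - B)" "cl B \<inter> P = {}"
    by (rule separate_point[OF q(1) closed[OF PQ(1)] q(2)])
  \<comment> \<open>\<open>B'\<close> diverges from the complement of \<open>B\<close>, so the
    distance of its points to that complement tends to infinity. With the cuts placed in
    \<open>B'\<close>, points outside \<open>B\<close> on opposite sides of a far cut are far
    apart.\<close>
  obtain B' where B': "q \<notin> cl (UNIV - B')" "cl B' \<inter> cl (UNIV - B) = {}"
    by (rule separate_point[OF q(1) closedin_cl B(1)]) auto
  have AP: "cl A \<subseteq> P" using A(2) PQ(3) cl_subset[of A] by blast
  have infA: "infinite A" using A(1) p(1) cl_Diff[of A] cl_empty_iff[of A] by auto
  have infB': "infinite B'" using B'(1) q(1) cl_Diff[of B'] cl_empty_iff[of B'] by auto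
  have dvB: "graph_divergent nat_dist B' (UNIV - B)" using B'(2) dv_iff by simp
  have "\<exists>b. \<forall>n. b n \<in> B' \<and> (\<exists>a\<in>A. b n < a \<and> a < b (Suc n))"
  proof (rule dependent_nat_choice[where P = "\<lambda>_ x. x \<in> B'", THEN ex_forward])
    show "\<exists>x. x \<in> B'" using infB' by (metis finite.emptyI equals0I)
    fix x :: nat assume "x \<in> B'"
    obtain a where "a \<in> A" "x < a" using infA infinite_nat_iff_unbounded by blast
    moreover obtain y where "y \<in> B'" "a < y" using infB' infinite_nat_iff_unbounded by blast
    ultimately show "\<exists>y. y \<in> B' \<and> (\<exists>a\<in>A. x < a \<and> a < y)" by blast
  qed auto
  then obtain b where "\<forall>n. b n \<in> B' \<and> (\<exists>a\<in>A. b n < a \<and> a < b (Suc n))" by blast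
  then obtain a where b: "\<And>n. b n \<in> B'" and a: "\<And>n. a n \<in> A" "\<And>n. b n < a n" "\<And>n. a n < b (Suc n)"
    by metis
  have mono: "strict_mono b" unfolding strict_mono_Suc_iff using a(2,3) less_trans by blast
  have fin: "finite {k. b k \<le> m}" for m
  proof (rule finite_subset)
    show "{k. b k \<le> m} \<subseteq> {..m}"
      using strict_mono_imp_increasing[OF mono] by (auto intro: order_trans)
  qed simp
  \<comment> \<open>The number of cuts up to \<open>m\<close> is the index of the interval
    containing \<open>m\<close>; \<open>E\<close> collects the intervals of even index.\<close>
  define E where "E = {m. even (card {k. b k \<le> m})}"
  have cross: "\<exists>k. min m m' < b k \<and> b k \<le> max m m'" if "m \<in> E" "m' \<notin> E" for m m'
  proof (rule ccontr)
    assume "\<not> ?thesis"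
    then have "b k \<le> m \<longleftrightarrow> b k \<le> m'" for k by (metis le_max_iff_disj min_less_iff_disj not_less)
    then show False using that by (simp add: E_def)
  qed
  \<comment> \<open>Two numbers of different parity class have a cut \<open>b k\<close> between
    them. If they lie outside \<open>B\<close> at distance at most \<open>n\<close>, this cut is
    within \<open>n\<close> of the complement of \<open>B\<close>, and only finitely many points of
    \<open>B'\<close> are.\<close>
  have "graph_divergent nat_dist (E - B) (UNIV - E - B)"
    unfolding graph_divergent_def
  proof
    fix n
    let ?F = "{x \<in> B'. \<exists>y\<in>UNIV - B. nat_dist x y \<le> n}"
    have "{m \<in> E - B. \<exists>m'\<in>UNIV - E - B. nat_dist m m' \<le> n} \<subseteq> (\<Union>x\<in>?F. {m. m \<le> x + n})"
    proof
      fix m assume "m \<in> {m \<in> E - B. \<exists>m'\<in>UNIV - E - B. nat_dist m m' \<le> n}"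
      then obtain m' where m: "m \<in> E" "m \<notin> B" "m' \<notin> E" "nat_dist m m' \<le> n" by auto
      then obtain k where "min m m' < b k" "b k \<le> max m m'" using cross by blast
      then have "nat_dist (b k) m \<le> n" using m(4) unfolding nat_dist_def by linarith
      then have "b k \<in> ?F" "m \<le> b k + n" using b m(2) by (auto simp: nat_dist_def)
      then show "m \<in> (\<Union>x\<in>?F. {m. m \<le> x + n})" by blast
    qed
    moreover have "finite (\<Union>x\<in>?F. {m. m \<le> x + n})" using graph_divergentD[OF dvB, of n] by auto
    ultimately show "finite {m \<in> E - B. \<exists>m'\<in>UNIV - E - B. nat_dist m m' \<le> n}" by (rule finite_subset)
  qed
  then have disj: "cl (E - B) \<inter> cl (UNIV - E - B) = {}" using dv_iff by simp
  have PB: "P \<subseteq> cl (E - B) \<union> cl (UNIV - E - B)"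
  proof -
    have "UNIV - B = (E - B) \<union> (UNIV - E - B)" by blast
    then have "cl (UNIV - B) = cl (E - B) \<union> cl (UNIV - E - B)"
      using cl_Un[of "E - B" "UNIV - E - B"] by simp
    then show ?thesis using cl_Diff[of B] B(2) PQ(3) by auto
  qed
  \<comment> \<open>The cuts below \<open>a n\<close> are those with index 0 to \<open>n\<close>,
    which are \<open>n + 1\<close> many; hence \<open>a n\<close> lies in \<open>E\<close> exactly
    for odd \<open>n\<close>, and \<open>A\<close> meets both classes infinitely often.\<close>
  have card: "card {k. b k \<le> a n} = Suc n" for n
  proof -
    have "{k. b k \<le> a n} = {..n}"
    proof (intro set_eqI iffI)
      fix k assume "k \<in> {k. b k \<le> a n}"
      then have "b k < b (Suc n)" using a(3)[of n] by simp
      then show "k \<in> {..n}" using mono by (simp add: strict_mono_less)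
    next
      fix k assume "k \<in> {..n}"
      then have "b k \<le> b n" using mono by (simp add: strict_mono_less_eq)
      then show "k \<in> {k. b k \<le> a n}" using a(2)[of n] by simp
    qed
    then show ?thesis by simp
  qed
  have "inj a"
  proof (rule strict_mono_imp_inj_on)
    show "strict_mono a" unfolding strict_mono_Suc_iff using a(2,3) less_trans by blast
  qed
  have "m \<le> 2 * m + 1 \<and> odd (2 * m + 1)" "m \<le> 2 * m \<and> even (2 * m)" for m :: nat by auto
  then have "infinite {n :: nat. odd n}" "infinite {n :: nat. even n}"
    unfolding infinite_nat_iff_unbounded_le mem_Collect_eq by metis+
  then have inf: "infinite (a ` {n. odd n})" "infinite (a ` {n. even n})"
    using \<open>inj a\<close> by (auto simp: finite_image_iff inj_on_subset)
  have meets: "P \<inter> cl (C - B) \<noteq> {}" if "infinite (A \<inter> C)" for C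
  proof -
    have "cl (A \<inter> C) \<noteq> {}" using that cl_empty_iff by blast
    moreover have "cl (A \<inter> C) \<subseteq> cl B \<union> cl (C - B)"
    proof -
      have "cl (A \<inter> C) \<subseteq> cl (B \<union> (C - B))" by (rule cl_mono) auto
      then show ?thesis using cl_Un[of B "C - B"] by simp
    qed
    moreover have "cl (A \<inter> C) \<subseteq> P" using cl_mono[of "A \<inter> C" A] AP by auto
    ultimately show ?thesis using B(2) by blast
  qed
  have "a ` {n. odd n} \<subseteq> A \<inter> E" "a ` {n. even n} \<subseteq> A \<inter> (UNIV - E)"
    using a(1) card by (auto simp: E_def)
  then have ne: "P \<inter> cl (E - B) \<noteq> {}" "P \<inter> cl (UNIV - E - B) \<noteq> {}"
    using meets[of E] meets[of "UNIV - E"] inf by (metis finite_subset)+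
  have "connectedin T P" using PQ(1) unfolding proper_subcontinuum_def continuum_space_def connectedin_def
    by auto
  moreover have "closedin T (cl (E - B))" "closedin T (cl (UNIV - E - B))" by (simp_all add: closedin_cl)
  ultimately show False using PB disj ne unfolding connectedin_closedin
    by (metis (no_types, lifting) Int_commute inf_bot_left)
qed

lemma indecomposable: "indecomposable_continuum T"
proof -
  have "topspace T \<noteq> {}" using cl_empty_iff[of UNIV] cl_V by simp
  then show ?thesis
    using compact Hausdorff connected not_decomposable
    by (simp add: indecomposable_continuum_def continuum_space_def)
qed

end

section \<open>Coarse embeddings and nets\<close>

text \<open>A separate bound for each scale replaces a monotone control function; suprema recover
  the latter. The two clauses are control from above and effective properness.\<close>

definition coarse_embedding :: "'b::metric_space set \<Rightarrow> 'a::metric_space set \<Rightarrow> ('b \<Rightarrow> 'a) \<Rightarrow> bool" where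
  "coarse_embedding Y X h \<longleftrightarrow> h \<in> Y \<rightarrow> X \<and>
     (\<forall>s. \<exists>t. \<forall>y\<in>Y. \<forall>y'\<in>Y. dist y y' \<le> s \<longrightarrow> dist (h y) (h y') \<le> t) \<and>
     (\<forall>s. \<exists>t. \<forall>y\<in>Y. \<forall>y'\<in>Y. dist (h y) (h y') \<le> s \<longrightarrow> dist y y' \<le> t)"

lemma coarse_embedding_upper:
  "coarse_embedding Y X h \<Longrightarrow> \<exists>t. \<forall>y\<in>Y. \<forall>y'\<in>Y. dist y y' \<le> s \<longrightarrow> dist (h y) (h y') \<le> t"
  by (simp add: coarse_embedding_def)

lemma coarse_embedding_lower:
  "coarse_embedding Y X h \<Longrightarrow> \<exists>t. \<forall>y\<in>Y. \<forall>y'\<in>Y. dist (h y) (h y') \<le> s \<longrightarrow> dist y y' \<le> t"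
  by (simp add: coarse_embedding_def)

lemma coarse_embedding_imp_coarse_map:
  assumes h: "coarse_embedding Y X h"
  shows "coarse_map Y X h"
proof -
  \<comment> \<open>Inserting 0 keeps the set nonempty and makes its supremum nonnegative.\<close>
  define S where "S s = insert 0 {dist (h y) (h y') | y y'. y \<in> Y \<and> y' \<in> Y \<and> dist y y' \<le> s}" for s
  define \<sigma> where "\<sigma> s = Sup (S s)" for s
  have bdd: "bdd_above (S s)" for s
  proof -
    obtain t where "\<And>y y'. y \<in> Y \<Longrightarrow> y' \<in> Y \<Longrightarrow> dist y y' \<le> s \<Longrightarrow> dist (h y) (h y') \<le> t"
      using coarse_embedding_upper[OF h, of "s"] by blast
    then show ?thesis unfolding S_def by (intro bdd_aboveI[of _ "max 0 t"]) (auto simp: le_max_iff_disj)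
  qed
  have "\<sigma> \<in> {0..} \<rightarrow> {0..}"
    unfolding \<sigma>_def using cSup_upper[OF _ bdd, of 0] by (auto simp: S_def)
  moreover have "mono_on {0..} \<sigma>"
    unfolding \<sigma>_def
    by (intro mono_onI cSup_subset_mono bdd) (auto simp: S_def intro: order_trans)
  moreover have "\<forall>y\<in>Y. \<forall>y'\<in>Y. dist (h y) (h y') \<le> \<sigma> (dist y y')"
    unfolding \<sigma>_def by (intro ballI cSup_upper[OF _ bdd]) (auto simp: S_def)
  moreover have "bounded (Y \<inter> h -` B)" if B: "bounded B" for B
  proof -
    obtain s where s: "\<forall>x\<in>B. \<forall>y\<in>B. dist x y \<le> s" using B unfolding bounded_two_points by blast
    obtain t where "\<And>y y'. y \<in> Y \<Longrightarrow> y' \<in> Y \<Longrightarrow> dist (h y) (h y') \<le> s \<Longrightarrow> dist y y' \<le> t"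
      using coarse_embedding_lower[OF h, of "s"] by blast
    then show ?thesis unfolding bounded_two_points using s by (intro exI[of _ t]) auto
  qed
  moreover have "h \<in> Y \<rightarrow> X" using h by (simp add: coarse_embedding_def)
  ultimately show ?thesis unfolding coarse_map_def by blast
qed

text \<open>A coarse inverse \<open>f\<close> chooses for \<open>x\<close> some point whose image is
  within \<open>r\<close>; both control bounds of \<open>f\<close> follow from those of
  \<open>h\<close> at a cost of \<open>2 * r\<close>.\<close>

lemma coarsely_equivalentI:
  assumes h: "coarse_embedding Y X h" and net: "\<And>x. x \<in> X \<Longrightarrow> \<exists>y\<in>Y. dist x (h y) \<le> r"
  shows "coarsely_equivalent X Y"
proof -
  obtain f where f: "\<And>x. x \<in> X \<Longrightarrow> f x \<in> Y" "\<And>x. x \<in> X \<Longrightarrow> dist x (h (f x)) \<le> r"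
    using net by metis
  have hX: "h y \<in> X" if "y \<in> Y" for y using h that by (auto simp: coarse_embedding_def)
  have emb: "coarse_embedding X Y f"
    unfolding coarse_embedding_def
  proof (intro conjI allI)
    show "f \<in> X \<rightarrow> Y" using f(1) by blast
    fix s
    obtain t where t: "\<And>y y'. y \<in> Y \<Longrightarrow> y' \<in> Y \<Longrightarrow> dist (h y) (h y') \<le> s + 2 * r \<Longrightarrow> dist y y' \<le> t"
      using coarse_embedding_lower[OF h, of "s + 2 * r"] by blast
    have "dist (f x) (f x') \<le> t" if "x \<in> X" "x' \<in> X" "dist x x' \<le> s" for x x'
    proof (rule t)
      show "f x \<in> Y" "f x' \<in> Y" using f that by auto
      have "dist (h (f x)) (h (f x')) \<le> dist x (h (f x)) + dist x x' + dist x' (h (f x'))"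
        by metric
      then show "dist (h (f x)) (h (f x')) \<le> s + 2 * r" using f(2)[OF that(1)] f(2)[OF that(2)] that(3) by linarith
    qed
    then show "\<exists>t. \<forall>y\<in>X. \<forall>y'\<in>X. dist y y' \<le> s \<longrightarrow> dist (f y) (f y') \<le> t" by blast
    obtain t where t: "\<And>y y'. y \<in> Y \<Longrightarrow> y' \<in> Y \<Longrightarrow> dist y y' \<le> s \<Longrightarrow> dist (h y) (h y') \<le> t"
      using coarse_embedding_upper[OF h, of "s"] by blast
    have "dist x x' \<le> t + 2 * r" if "x \<in> X" "x' \<in> X" "dist (f x) (f x') \<le> s" for x x'
    proof -
      have "dist x x' \<le> dist x (h (f x)) + dist (h (f x)) (h (f x')) + dist x' (h (f x'))" by metric
      then show ?thesis using f(2)[OF that(1)] f(2)[OF that(2)] t[OF f(1) f(1) that(3)] that(1,2) by simp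
    qed
    then show "\<exists>t. \<forall>y\<in>X. \<forall>y'\<in>X. dist (f y) (f y') \<le> s \<longrightarrow> dist y y' \<le> t" by blast
  qed
  obtain t where t: "\<And>y y'. y \<in> Y \<Longrightarrow> y' \<in> Y \<Longrightarrow> dist (h y) (h y') \<le> r \<Longrightarrow> dist y y' \<le> t"
    using coarse_embedding_lower[OF h, of "r"] by blast
  \<comment> \<open>Closeness asks for a positive and strict bound, while \<open>r\<close> is an
    arbitrary real here.\<close>
  have "dist (h (f x)) x < \<bar>r\<bar> + 1" if "x \<in> X" for x
    using f(2)[OF that] by (simp add: dist_commute)
  then have "close_maps X (h \<circ> f) id"
    unfolding close_maps_def by (intro exI[of _ "\<bar>r\<bar> + 1"]) auto
  moreover have "dist (f (h y)) y < \<bar>t\<bar> + 1" if "y \<in> Y" for y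
    using t[OF f(1)[OF hX[OF that]] that] f(2)[OF hX[OF that]] by (simp add: dist_commute)
  then have "close_maps Y (f \<circ> h) id"
    unfolding close_maps_def by (intro exI[of _ "\<bar>t\<bar> + 1"]) auto
  ultimately show ?thesis
    unfolding coarsely_equivalent_def coarse_equivalence_def
    using coarse_embedding_imp_coarse_map[OF h] coarse_embedding_imp_coarse_map[OF emb] by blast
qed

lemma coarsely_equivalent_imp_embedding:
  assumes "coarsely_equivalent X Y"
  shows "\<exists>h r. coarse_embedding Y X h \<and> (\<forall>x\<in>X. \<exists>y\<in>Y. dist x (h y) \<le> r)"
proof -
  obtain f h where f: "coarse_map X Y f" and h: "coarse_map Y X h"
    and c: "close_maps X (h \<circ> f) id" "close_maps Y (f \<circ> h) id"
    using assms unfolding coarsely_equivalent_def coarse_equivalence_def by blast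
  obtain r where r: "\<And>x. x \<in> X \<Longrightarrow> dist (h (f x)) x < r" using c(1) by (auto simp: close_maps_def)
  obtain r' where r': "\<And>y. y \<in> Y \<Longrightarrow> dist (f (h y)) y < r'" using c(2) by (auto simp: close_maps_def)
  have fX: "f \<in> X \<rightarrow> Y" and hY: "h \<in> Y \<rightarrow> X" using f h by (auto simp: coarse_map_def)
  obtain \<sigma> where \<sigma>: "mono_on {0..} \<sigma>" "\<And>x x'. x \<in> X \<Longrightarrow> x' \<in> X \<Longrightarrow> dist (f x) (f x') \<le> \<sigma> (dist x x')"
    using f unfolding coarse_map_def by blast
  obtain \<tau> where \<tau>: "mono_on {0..} \<tau>" "\<And>x x'. x \<in> Y \<Longrightarrow> x' \<in> Y \<Longrightarrow> dist (h x) (h x') \<le> \<tau> (dist x x')"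
    using h unfolding coarse_map_def by blast
  have mono: "\<phi> d \<le> \<phi> s" if "mono_on {0..} \<phi>" "0 \<le> d" "d \<le> s" for \<phi> :: "real \<Rightarrow> real" and d s
    using that by (auto intro: mono_onD)
  have "coarse_embedding Y X h"
    unfolding coarse_embedding_def
  proof (intro conjI allI)
    show "h \<in> Y \<rightarrow> X" by (rule hY)
    fix s
    have "dist (h y) (h y') \<le> \<tau> s" if "y \<in> Y" "y' \<in> Y" "dist y y' \<le> s" for y y'
      using \<tau>(2)[OF that(1,2)] mono[OF \<tau>(1) zero_le_dist that(3)] by linarith
    then show "\<exists>t. \<forall>y\<in>Y. \<forall>y'\<in>Y. dist y y' \<le> s \<longrightarrow> dist (h y) (h y') \<le> t" by blast
    have "dist y y' \<le> 2 * r' + \<sigma> s" if "y \<in> Y" "y' \<in> Y" "dist (h y) (h y') \<le> s" for y y'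
    proof -
      have "dist (f (h y)) (f (h y')) \<le> \<sigma> s"
        using \<sigma>(2)[of "h y" "h y'"] mono[OF \<sigma>(1) zero_le_dist that(3)] hY that(1,2) by fastforce
      moreover have "dist y y' \<le> dist (f (h y)) y + dist (f (h y)) (f (h y')) + dist (f (h y')) y'" by metric
      ultimately show ?thesis using r'[OF that(1)] r'[OF that(2)] by linarith
    qed
    then show "\<exists>t. \<forall>y\<in>Y. \<forall>y'\<in>Y. dist (h y) (h y') \<le> s \<longrightarrow> dist y y' \<le> t" by blast
  qed
  moreover have "\<exists>y\<in>Y. dist x (h y) \<le> r" if "x \<in> X" for x
    using r[OF that] fX that by (intro bexI[of _ "f x"]) (auto simp: dist_commute)
  ultimately show ?thesis by blast
qed

lemma coarse_embedding_divergent: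
  assumes h: "coarse_embedding Y X h" and A: "A \<subseteq> Y" and B: "B \<subseteq> Y"
  shows "divergent (h ` A) (h ` B) \<longleftrightarrow> divergent A B"
proof
  assume div: "divergent A B"
  show "divergent (h ` A) (h ` B)"
    unfolding divergent_def
  proof
    fix s
    obtain t where t: "\<And>y y'. y \<in> Y \<Longrightarrow> y' \<in> Y \<Longrightarrow> dist (h y) (h y') \<le> s \<Longrightarrow> dist y y' \<le> t"
      using coarse_embedding_lower[OF h, of "s"] by blast
    let ?S = "{a \<in> A. \<exists>b\<in>B. dist a b \<le> t}"
    have "bounded ?S" using div by (simp add: divergent_def)
    then obtain u where u: "\<forall>x\<in>?S. \<forall>y\<in>?S. dist x y \<le> u" unfolding bounded_two_points by blast
    obtain v where v: "\<And>y y'. y \<in> Y \<Longrightarrow> y' \<in> Y \<Longrightarrow> dist y y' \<le> u \<Longrightarrow> dist (h y) (h y') \<le> v"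
      using coarse_embedding_upper[OF h, of "u"] by blast
    have "bounded (h ` ?S)"
      unfolding bounded_two_points
    proof (intro exI ballI)
      fix x y assume "x \<in> h ` ?S" "y \<in> h ` ?S"
      then obtain a b where ab: "a \<in> ?S" "b \<in> ?S" "x = h a" "y = h b" by blast
      then have "dist a b \<le> u" using u by blast
      then show "dist x y \<le> v" using v[of a b] ab A by auto
    qed
    moreover have "{x \<in> h ` A. \<exists>y\<in>h ` B. dist x y \<le> s} \<subseteq> h ` ?S"
    proof
      fix x assume "x \<in> {x \<in> h ` A. \<exists>y\<in>h ` B. dist x y \<le> s}"
      then obtain a b where ab: "a \<in> A" "b \<in> B" "x = h a" "dist (h a) (h b) \<le> s" by blast
      then have "dist a b \<le> t" using t[of a b] A B by blast
      then show "x \<in> h ` ?S" using ab by blast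
    qed
    ultimately show "bounded {x \<in> h ` A. \<exists>y\<in>h ` B. dist x y \<le> s}" by (rule bounded_subset)
  qed
next
  assume div: "divergent (h ` A) (h ` B)"
  show "divergent A B"
    unfolding divergent_def
  proof
    fix s
    obtain t where t: "\<And>y y'. y \<in> Y \<Longrightarrow> y' \<in> Y \<Longrightarrow> dist y y' \<le> s \<Longrightarrow> dist (h y) (h y') \<le> t"
      using coarse_embedding_upper[OF h, of "s"] by blast
    let ?S = "{x \<in> h ` A. \<exists>y\<in>h ` B. dist x y \<le> t}"
    have "bounded ?S" using div by (simp add: divergent_def)
    then obtain u where u: "\<forall>x\<in>?S. \<forall>y\<in>?S. dist x y \<le> u" unfolding bounded_two_points by blast
    obtain v where v: "\<And>y y'. y \<in> Y \<Longrightarrow> y' \<in> Y \<Longrightarrow> dist (h y) (h y') \<le> u \<Longrightarrow> dist y y' \<le> v"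
      using coarse_embedding_lower[OF h, of "u"] by blast
    have hS: "h a \<in> ?S" if a: "a \<in> A" "\<exists>b\<in>B. dist a b \<le> s" for a
    proof -
      obtain b where b: "b \<in> B" "dist a b \<le> s" using a(2) by blast
      then have "dist (h a) (h b) \<le> t" using t[of a b] a(1) A B by blast
      then show ?thesis using a(1) b(1) by blast
    qed
    show "bounded {a \<in> A. \<exists>b\<in>B. dist a b \<le> s}"
      unfolding bounded_two_points
    proof (intro exI ballI)
      fix a b assume "a \<in> {a \<in> A. \<exists>b\<in>B. dist a b \<le> s}" "b \<in> {a \<in> A. \<exists>b\<in>B. dist a b \<le> s}"
      then have "h a \<in> ?S" "h b \<in> ?S" "a \<in> Y" "b \<in> Y" using hS A by auto
      then have "dist (h a) (h b) \<le> u" using u by blast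
      then show "dist a b \<le> v" using v \<open>a \<in> Y\<close> \<open>b \<in> Y\<close> by blast
    qed
  qed
qed

section \<open>Path metrics on nets\<close>

text \<open>The edges are the pairs at distance 1. Only the first step of a geodesic is postulated;
  inductions on the distance supply the remaining ones.\<close>

locale locally_finite_graph =
  fixes V :: "'v set" and \<rho> :: "'v \<Rightarrow> 'v \<Rightarrow> nat"
  assumes refl: "x \<in> V \<Longrightarrow> \<rho> x x = 0"
    and eq: "x \<in> V \<Longrightarrow> y \<in> V \<Longrightarrow> \<rho> x y = 0 \<Longrightarrow> x = y"
    and sym: "x \<in> V \<Longrightarrow> y \<in> V \<Longrightarrow> \<rho> x y = \<rho> y x"
    and triangle: "x \<in> V \<Longrightarrow> y \<in> V \<Longrightarrow> z \<in> V \<Longrightarrow> \<rho> x z \<le> \<rho> x y + \<rho> y z"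
    and geodesic: "x \<in> V \<Longrightarrow> y \<in> V \<Longrightarrow> \<rho> x y = Suc n \<Longrightarrow> \<exists>z\<in>V. \<rho> x z = 1 \<and> \<rho> z y = n"
    and finite_ball: "x \<in> V \<Longrightarrow> finite {y \<in> V. \<rho> x y \<le> n}"

definition chain_rel :: "'a::metric_space set \<Rightarrow> real \<Rightarrow> ('a \<times> 'a) set" where
  "chain_rel A c = {(x, y). x \<in> A \<and> y \<in> A \<and> dist x y \<le> c}"

text \<open>The path metric of the graph that joins points of \<open>A\<close> at distance at most
  \<open>c\<close>. The \<open>LEAST\<close> is meaningful only when some chain exists, hence the
  connectivity assumption where it is used.\<close>

definition chain_dist :: "'a::metric_space set \<Rightarrow> real \<Rightarrow> 'a \<Rightarrow> 'a \<Rightarrow> nat" where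
  "chain_dist A c x y = (LEAST n. (x, y) \<in> chain_rel A c ^^ n)"

lemma chain_rel_relpow_dist: "(x, y) \<in> chain_rel A c ^^ n \<Longrightarrow> dist x y \<le> c * real n"
proof (induction n arbitrary: y)
  case 0
  then show ?case by simp
next
  case (Suc n)
  then obtain z where z: "(x, z) \<in> chain_rel A c ^^ n" "(z, y) \<in> chain_rel A c" by auto
  have "dist x y \<le> dist x z + dist z y" by (rule dist_triangle)
  also have "\<dots> \<le> c * real n + c" using Suc.IH[OF z(1)] z(2) by (auto simp: chain_rel_def)
  finally show ?case by (simp add: algebra_simps)
qed

lemma chain_rel_relpow_sym: "(x, y) \<in> chain_rel A c ^^ n \<Longrightarrow> (y, x) \<in> chain_rel A c ^^ n"
proof (induction n arbitrary: y)
  case (Suc n)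
  then obtain z where z: "(x, z) \<in> chain_rel A c ^^ n" "(z, y) \<in> chain_rel A c" by auto
  then have "(y, z) \<in> chain_rel A c" by (simp add: chain_rel_def dist_commute)
  then show ?case using Suc.IH[OF z(1)] by (rule relpow_Suc_I2)
qed simp

lemma locally_finite_graph_chain_dist:
  assumes conn: "\<And>x y. x \<in> A \<Longrightarrow> y \<in> A \<Longrightarrow> \<exists>n. (x, y) \<in> chain_rel A c ^^ n"
    and fin: "\<And>x r. x \<in> A \<Longrightarrow> finite (A \<inter> cball x r)" and "0 \<le> c"
  shows "locally_finite_graph A (chain_dist A c)"
    and "x \<in> A \<Longrightarrow> y \<in> A \<Longrightarrow> dist x y \<le> c * real (chain_dist A c x y)"
proof -
  let ?E = "chain_rel A c" and ?\<rho> = "chain_dist A c"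
  have chain: "(x, y) \<in> ?E ^^ ?\<rho> x y" if "x \<in> A" "y \<in> A" for x y
    unfolding chain_dist_def using conn[OF that] by (rule LeastI_ex)
  have le: "?\<rho> x y \<le> n" if "(x, y) \<in> ?E ^^ n" for x y n
    unfolding chain_dist_def using that by (rule Least_le)
  show dist: "dist x y \<le> c * real (?\<rho> x y)" if "x \<in> A" "y \<in> A" for x y
    using chain_rel_relpow_dist chain[OF that] by blast
  have tri: "?\<rho> x z \<le> ?\<rho> x y + ?\<rho> y z" if "x \<in> A" "y \<in> A" "z \<in> A" for x y z
    using chain[OF that(1,2)] chain[OF that(2,3)] by (intro le) (auto simp: relpow_add)
  show "locally_finite_graph A ?\<rho>"
  proof
    show "?\<rho> x x = 0" for x using le[of x x 0] by simp
    show "x = y" if "x \<in> A" "y \<in> A" "?\<rho> x y = 0" for x y using chain[OF that(1,2)] that(3) by simp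
    show "?\<rho> x y = ?\<rho> y x" if "x \<in> A" "y \<in> A" for x y
      using le[OF chain_rel_relpow_sym[OF chain[OF that]]] le[OF chain_rel_relpow_sym[OF chain[OF that(2,1)]]]
      by (rule antisym[rotated])
    show "?\<rho> x z \<le> ?\<rho> x y + ?\<rho> y z" if "x \<in> A" "y \<in> A" "z \<in> A" for x y z using tri[OF that] .
    show "\<exists>z\<in>A. ?\<rho> x z = 1 \<and> ?\<rho> z y = n" if xy: "x \<in> A" "y \<in> A" "?\<rho> x y = Suc n" for x y n
    proof -
      have "(x, y) \<in> ?E ^^ Suc n" using chain[OF xy(1,2)] xy(3) by simp
      then obtain z where z: "(x, z) \<in> ?E" "(z, y) \<in> ?E ^^ n" by (meson relpow_Suc_D2)
      then have zA: "z \<in> A" by (simp add: chain_rel_def)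
      have "?\<rho> x z \<le> 1" "?\<rho> z y \<le> n" using le[of x z 1] le[OF z(2)] z(1) by auto
      then show ?thesis using tri[OF xy(1) zA xy(2)] xy(3) zA by (intro bexI[of _ z]) auto
    qed
    show "finite {y \<in> A. ?\<rho> x y \<le> n}" if "x \<in> A" for x n
    proof (rule finite_subset[OF _ fin[OF that, of "c * real n"]])
      show "{y \<in> A. ?\<rho> x y \<le> n} \<subseteq> A \<inter> cball x (c * real n)"
      proof
        fix y assume "y \<in> {y \<in> A. ?\<rho> x y \<le> n}"
        then have y: "y \<in> A" "?\<rho> x y \<le> n" by auto
        have "dist x y \<le> c * real (?\<rho> x y)" using dist that y by blast
        also have "\<dots> \<le> c * real n" using y(2) \<open>0 \<le> c\<close> by (intro mult_left_mono) auto
        finally show "y \<in> A \<inter> cball x (c * real n)" using y(1) by simp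
      qed
    qed
  qed
qed

text \<open>A geodesic of the model space is sampled at unit steps, carried to \<open>X\<close> by
  \<open>h\<close> and rounded to the net. This gives chains in the net whose length is controlled
  by the distance of their ends.\<close>

lemma coarsely_geodesic_net_graph:
  fixes X :: "'a::metric_space set"
  assumes geo: "coarsely_geodesic TYPE('b::metric_space) X" and bg: "coarse_bounded_geometry X"
  obtains A \<rho> r c where "A \<subseteq> X" "\<And>x. x \<in> X \<Longrightarrow> \<exists>a\<in>A. dist x a \<le> r" "locally_finite_graph A \<rho>"
    "\<And>x y. x \<in> A \<Longrightarrow> y \<in> A \<Longrightarrow> dist x y \<le> c * real (\<rho> x y)"
    "\<And>s. \<exists>n. \<forall>x\<in>A. \<forall>y\<in>A. dist x y \<le> s \<longrightarrow> \<rho> x y \<le> n"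
proof -
  obtain A \<Lambda> where net: "net_in X A" and "\<forall>x\<in>X. \<forall>t>0. finite (A \<inter> cball x t) \<and> real (card (A \<inter> cball x t)) \<le> \<Lambda> t"
    using bg unfolding coarse_bounded_geometry_def by blast
  then have fin0: "finite (A \<inter> cball x t)" if "x \<in> X" "0 < t" for x t using that by blast
  have AX: "A \<subseteq> X" using net by (simp add: net_in_def)
  have fin: "finite (A \<inter> cball x r)" if "x \<in> A" for x r
    by (rule finite_subset[OF _ fin0[of x "max r 1"]]) (use that AX in auto)
  obtain r where r: "0 < r" "\<And>x. x \<in> X \<Longrightarrow> \<exists>a\<in>A. dist x a < r"
    using net by (auto simp: net_in_def)
  obtain Y :: "'b set" where Y: "geodesic_metric Y" "coarsely_equivalent X Y"
    using geo by (auto simp: coarsely_geodesic_def)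
  obtain h r1 where h: "coarse_embedding Y X h" and r1: "\<And>x. x \<in> X \<Longrightarrow> \<exists>y\<in>Y. dist x (h y) \<le> r1"
    using coarsely_equivalent_imp_embedding[OF Y(2)] by blast
  have hX: "h y \<in> X" if "y \<in> Y" for y using h that by (auto simp: coarse_embedding_def)
  obtain t1 where t1: "\<And>y y'. y \<in> Y \<Longrightarrow> y' \<in> Y \<Longrightarrow> dist y y' \<le> 1 \<Longrightarrow> dist (h y) (h y') \<le> t1"
    using coarse_embedding_upper[OF h, of "1"] by blast
  \<comment> \<open>\<open>t1\<close> bounds the image of a unit step and each rounding costs
    \<open>r\<close>; the links at the two ends need \<open>r1 + r\<close>. The absolute values
    cover the possibility that \<open>t1\<close> or \<open>r1\<close> is negative.\<close>
  define c where "c = \<bar>t1\<bar> + 2 * \<bar>r1\<bar> + 2 * r"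
  let ?E = "chain_rel A c"
  have c0: "0 \<le> c" using r(1) by (simp add: c_def)
  have ctrl: "\<exists>n. \<forall>a\<in>A. \<forall>a'\<in>A. dist a a' \<le> s \<longrightarrow> (\<exists>m\<le>n. (a, a') \<in> ?E ^^ m)" for s
  proof -
    obtain t where t: "\<And>y y'. y \<in> Y \<Longrightarrow> y' \<in> Y \<Longrightarrow> dist (h y) (h y') \<le> s + 2 * r1 \<Longrightarrow> dist y y' \<le> t"
      using coarse_embedding_lower[OF h, of "s + 2 * r1"] by blast
    have "\<exists>m\<le>nat \<lceil>t\<rceil> + 2. (a, a') \<in> ?E ^^ m" if a: "a \<in> A" "a' \<in> A" "dist a a' \<le> s" for a a'
    proof -
      obtain y y' where y: "y \<in> Y" "dist a (h y) \<le> r1" "y' \<in> Y" "dist a' (h y') \<le> r1"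
        using r1 a AX by (meson subsetD)
      have "dist (h y) (h y') \<le> dist a (h y) + dist a a' + dist a' (h y')" by metric
      then have Lt: "dist y y' \<le> t" using t[OF y(1,3)] y a(3) by simp
      define L where "L = dist y y'"
      have "\<exists>\<gamma>::real \<Rightarrow> 'b. \<gamma> \<in> {0..L} \<rightarrow> Y \<and> \<gamma> 0 = y \<and> \<gamma> L = y' \<and>
          (\<forall>s\<in>{0..L}. \<forall>t\<in>{0..L}. dist (\<gamma> s) (\<gamma> t) = \<bar>s - t\<bar>)"
        using Y(1) y(1,3) unfolding geodesic_metric_def L_def by blast
      then obtain \<gamma> :: "real \<Rightarrow> 'b" where \<gamma>: "\<gamma> \<in> {0..L} \<rightarrow> Y" "\<gamma> 0 = y" "\<gamma> L = y'"
        "\<And>s t. s \<in> {0..L} \<Longrightarrow> t \<in> {0..L} \<Longrightarrow> dist (\<gamma> s) (\<gamma> t) = \<bar>s - t\<bar>" by blast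
      have L0: "0 \<le> L" by (simp add: L_def)
      \<comment> \<open>The time is truncated at \<open>L\<close>, so the sampling has arrived at
        \<open>y'\<close> after \<open>L\<close> rounded up many steps. The two links joining
        \<open>a\<close> and \<open>a'\<close> to the sampled path account for the
        \<open>+ 2\<close>.\<close>
      define w where "w i = \<gamma> (min (real i) L)" for i :: nat
      have wY: "w i \<in> Y" for i using \<gamma>(1) L0 by (auto simp: w_def)
      have wstep: "dist (h (w i)) (h (w (Suc i))) \<le> t1" for i
        using \<gamma>(4)[of "min (real i) L" "min (real (Suc i)) L"] L0 by (intro t1 wY) (auto simp: w_def)
      obtain b where b: "\<And>i. b i \<in> A" "\<And>i. dist (h (w i)) (b i) < r"
        using r(2)[OF hX[OF wY]] by metis
      have "(b i, b (Suc i)) \<in> ?E" for i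
      proof -
        have "dist (b i) (b (Suc i)) \<le> dist (h (w i)) (b i) + dist (h (w i)) (h (w (Suc i))) + dist (h (w (Suc i))) (b (Suc i))"
          by metric
        then have "dist (b i) (b (Suc i)) \<le> c" using b(2)[of i] b(2)[of "Suc i"] wstep[of i] unfolding c_def by linarith
        then show ?thesis using b(1) by (simp add: chain_rel_def)
      qed
      then have path: "(b 0, b i) \<in> ?E ^^ i" for i by (induction i) auto
      have "(a, b 0) \<in> ?E"
      proof -
        have "w 0 = y" using \<gamma>(2) L0 by (simp add: w_def)
        then have "dist a (b 0) \<le> r1 + r" using b(2)[of 0] y(2) dist_triangle[of a "b 0" "h y"] by simp
        then have "dist a (b 0) \<le> c" using r(1) unfolding c_def by linarith
        then show ?thesis using a b(1) by (simp add: chain_rel_def)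
      qed
      moreover have "(b (nat \<lceil>L\<rceil>), a') \<in> ?E"
      proof -
        have "w (nat \<lceil>L\<rceil>) = y'" using \<gamma>(3) real_nat_ceiling_ge[of L] by (simp add: w_def min_absorb2)
        then have "dist (b (nat \<lceil>L\<rceil>)) a' \<le> r1 + r"
          using b(2)[of "nat \<lceil>L\<rceil>"] y(4) dist_triangle[of a' "b (nat \<lceil>L\<rceil>)" "h y'"] by (simp add: dist_commute)
        then have "dist (b (nat \<lceil>L\<rceil>)) a' \<le> c" using r(1) unfolding c_def by linarith
        then show ?thesis using a b(1) by (simp add: chain_rel_def)
      qed
      ultimately have "(a, a') \<in> ?E ^^ Suc (Suc (nat \<lceil>L\<rceil>))"
        using path[of "nat \<lceil>L\<rceil>"] by (meson relpow_Suc_I relpow_Suc_I2)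
      moreover have "Suc (Suc (nat \<lceil>L\<rceil>)) \<le> nat \<lceil>t\<rceil> + 2"
        using Lt real_nat_ceiling_ge[of t] by (simp add: L_def)
      ultimately show ?thesis by blast
    qed
    then show ?thesis by blast
  qed
  have conn: "\<exists>n. (x, y) \<in> ?E ^^ n" if "x \<in> A" "y \<in> A" for x y
    using ctrl[of "dist x y"] that by blast
  note graph = locally_finite_graph_chain_dist[OF conn fin c0]
  have "\<exists>n. \<forall>x\<in>A. \<forall>y\<in>A. dist x y \<le> s \<longrightarrow> chain_dist A c x y \<le> n" for s
  proof -
    obtain n where n: "\<forall>a\<in>A. \<forall>a'\<in>A. dist a a' \<le> s \<longrightarrow> (\<exists>m\<le>n. (a, a') \<in> ?E ^^ m)"
      using ctrl[of s] by blast
    have "chain_dist A c x y \<le> n" if xy: "x \<in> A" "y \<in> A" "dist x y \<le> s" for x y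
    proof -
      obtain m where "m \<le> n" "(x, y) \<in> ?E ^^ m" using n xy by blast
      then show ?thesis unfolding chain_dist_def by (meson Least_le order_trans)
    qed
    then show ?thesis by blast
  qed
  note ctrl' = this
  have "\<exists>a\<in>A. dist x a \<le> r" if "x \<in> X" for x using r(2)[OF that] by (auto intro: less_imp_le)
  then show thesis by (rule that[OF AX _ graph ctrl'])
qed

lemma graph_divergent_iff_divergent:
  assumes G: "locally_finite_graph V \<rho>"
    and up: "\<And>x y. x \<in> V \<Longrightarrow> y \<in> V \<Longrightarrow> dist x y \<le> c * real (\<rho> x y)"
    and lo: "\<And>s. \<exists>n. \<forall>x\<in>V. \<forall>y\<in>V. dist x y \<le> s \<longrightarrow> \<rho> x y \<le> n"
    and A: "A \<subseteq> V" and B: "B \<subseteq> V"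
  shows "graph_divergent \<rho> A B \<longleftrightarrow> divergent A B"
proof -
  interpret locally_finite_graph V \<rho> by (rule G)
  have fin: "finite S \<longleftrightarrow> bounded S" if S: "S \<subseteq> V" for S
  proof
    assume bd: "bounded S"
    show "finite S"
    proof (cases "S = {}")
      case False
      then obtain x where x: "x \<in> S" by blast
      obtain s where s: "\<forall>x\<in>S. \<forall>y\<in>S. dist x y \<le> s" using bd unfolding bounded_two_points by blast
      obtain n where n: "\<forall>x\<in>V. \<forall>y\<in>V. dist x y \<le> s \<longrightarrow> \<rho> x y \<le> n" using lo by blast
      have "S \<subseteq> {y \<in> V. \<rho> x y \<le> n}" using s n x S by blast
      then show ?thesis using finite_ball[of x n] x S finite_subset by blast
    qed simp
  qed (rule finite_imp_bounded)
  show ?thesis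
  proof
    assume g: "graph_divergent \<rho> A B"
    show "divergent A B"
      unfolding divergent_def
    proof
      fix s
      obtain n where n: "\<forall>x\<in>V. \<forall>y\<in>V. dist x y \<le> s \<longrightarrow> \<rho> x y \<le> n" using lo by blast
      have "{a \<in> A. \<exists>b\<in>B. dist a b \<le> s} \<subseteq> {a \<in> A. \<exists>b\<in>B. \<rho> a b \<le> n}" using n A B by blast
      then have "finite {a \<in> A. \<exists>b\<in>B. dist a b \<le> s}"
        using graph_divergentD[OF g, of n] finite_subset by blast
      then show "bounded {a \<in> A. \<exists>b\<in>B. dist a b \<le> s}" by (rule finite_imp_bounded)
    qed
  next
    assume d: "divergent A B"
    show "graph_divergent \<rho> A B"
      unfolding graph_divergent_def
    proof
      fix n
      have "dist a b \<le> \<bar>c\<bar> * real n" if "a \<in> A" "b \<in> B" "\<rho> a b \<le> n" for a b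
      proof -
        have "dist a b \<le> c * real (\<rho> a b)" using up that A B by blast
        also have "\<dots> \<le> \<bar>c\<bar> * real n" using that(3) by (intro mult_mono) auto
        finally show ?thesis .
      qed
      then have "{a \<in> A. \<exists>b\<in>B. \<rho> a b \<le> n} \<subseteq> {a \<in> A. \<exists>b\<in>B. dist a b \<le> \<bar>c\<bar> * real n}" by blast
      moreover have "bounded {a \<in> A. \<exists>b\<in>B. dist a b \<le> \<bar>c\<bar> * real n}" using d by (simp add: divergent_def)
      ultimately have "bounded {a \<in> A. \<exists>b\<in>B. \<rho> a b \<le> n}" by (rule bounded_subset[rotated])
      then show "finite {a \<in> A. \<exists>b\<in>B. \<rho> a b \<le> n}" using fin[of "{a \<in> A. \<exists>b\<in>B. \<rho> a b \<le> n}"] A by auto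
    qed
  qed
qed

section \<open>Rays in locally finite graphs\<close>

context locally_finite_graph
begin

lemma graph_divergent_sym:
  assumes A: "A \<subseteq> V" and B: "B \<subseteq> V" and div: "graph_divergent \<rho> A B"
  shows "graph_divergent \<rho> B A"
  unfolding graph_divergent_def
proof
  fix n
  let ?F = "{a \<in> A. \<exists>b\<in>B. \<rho> a b \<le> n}"
  have "finite (\<Union>a\<in>?F. {b \<in> V. \<rho> a b \<le> n})"
    using graph_divergentD[OF div] A by (intro finite_UN_I finite_ball) auto
  moreover have "{b \<in> B. \<exists>a\<in>A. \<rho> b a \<le> n} \<subseteq> (\<Union>a\<in>?F. {b \<in> V. \<rho> a b \<le> n})"
  proof
    fix b assume "b \<in> {b \<in> B. \<exists>a\<in>A. \<rho> b a \<le> n}"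
    then obtain a where ab: "b \<in> B" "a \<in> A" "\<rho> b a \<le> n" by auto
    have "a \<in> V" "b \<in> V" using ab A B by auto
    then have "\<rho> a b \<le> n" using sym ab(3) by simp
    then show "b \<in> (\<Union>a\<in>?F. {b \<in> V. \<rho> a b \<le> n})" using ab B by auto
  qed
  ultimately show "finite {b \<in> B. \<exists>a\<in>A. \<rho> b a \<le> n}" by (rule finite_subset[rotated])
qed

lemma graph_divergent_mono:
  assumes "graph_divergent \<rho> A B" "A' \<subseteq> A" "B' \<subseteq> B"
  shows "graph_divergent \<rho> A' B'"
  unfolding graph_divergent_def
proof
  fix n
  show "finite {a \<in> A'. \<exists>b\<in>B'. \<rho> a b \<le> n}"
    by (rule finite_subset[OF _ graph_divergentD[OF assms(1), of n]]) (use assms in auto)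
qed

lemma graph_divergent_Un:
  assumes "graph_divergent \<rho> A B" "graph_divergent \<rho> A B'"
  shows "graph_divergent \<rho> A (B \<union> B')"
  unfolding graph_divergent_def
proof
  fix n
  have "{a \<in> A. \<exists>b\<in>B \<union> B'. \<rho> a b \<le> n} = {a \<in> A. \<exists>b\<in>B. \<rho> a b \<le> n} \<union> {a \<in> A. \<exists>b\<in>B'. \<rho> a b \<le> n}"
    by auto
  then show "finite {a \<in> A. \<exists>b\<in>B \<union> B'. \<rho> a b \<le> n}"
    using graph_divergentD[OF assms(1)] graph_divergentD[OF assms(2)] by simp
qed

text \<open>Distances are prescribed only from the base point and between successors; the triangle
  inequality then makes \<open>q\<close> isometric, see \<open>geodesic_ray_dist\<close>. The base
  point equals \<open>q 0\<close> by \<open>eq\<close>.\<close>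

definition geodesic_ray :: "'v \<Rightarrow> (nat \<Rightarrow> 'v) \<Rightarrow> bool" where
  "geodesic_ray x q \<longleftrightarrow> x \<in> V \<and> (\<forall>k. q k \<in> V \<and> \<rho> x (q k) = k \<and> \<rho> (q k) (q (Suc k)) \<le> 1)"

lemma geodesic_ray_inj:
  assumes "geodesic_ray x q"
  shows "inj q"
  using assms unfolding geodesic_ray_def inj_def by metis

lemma geodesic_ray_lower:
  assumes "geodesic_ray x q"
  shows "nat_dist i j \<le> \<rho> (q i) (q j)"
proof -
  have q: "q i \<in> V" "q j \<in> V" "x \<in> V" "\<rho> x (q i) = i" "\<rho> x (q j) = j"
    using assms by (auto simp: geodesic_ray_def)
  have "j \<le> i + \<rho> (q i) (q j)" "i \<le> j + \<rho> (q i) (q j)"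
    using triangle[OF q(3,1,2)] triangle[OF q(3,2,1)] q sym[OF q(1,2)] by simp_all
  then show ?thesis unfolding nat_dist_def by linarith
qed

lemma geodesic_ray_upper:
  assumes "geodesic_ray x q"
  shows "\<rho> (q i) (q (i + n)) \<le> n"
proof (induction n)
  case 0
  then show ?case using assms refl by (simp add: geodesic_ray_def)
next
  case (Suc n)
  have "q k \<in> V" "\<rho> (q k) (q (Suc k)) \<le> 1" for k using assms by (auto simp: geodesic_ray_def)
  then show ?case using triangle[of "q i" "q (i + n)" "q (i + Suc n)"] Suc
    by (metis Suc_eq_plus1 add_Suc_right add_le_mono order_trans)
qed

lemma geodesic_ray_dist:
  assumes "geodesic_ray x q"
  shows "\<rho> (q i) (q j) = nat_dist i j"
proof -
  have "q i \<in> V" "q j \<in> V" using assms by (auto simp: geodesic_ray_def)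
  then have "\<rho> (q i) (q j) = \<rho> (q j) (q i)" by (rule sym)
  moreover have "\<rho> (q (min i j)) (q (max i j)) \<le> max i j - min i j"
    using geodesic_ray_upper[OF assms, of "min i j" "max i j - min i j"] by simp
  ultimately have "\<rho> (q i) (q j) \<le> nat_dist i j"
    unfolding nat_dist_def by (cases "i \<le> j") (auto simp: min_def max_def)
  then show ?thesis using geodesic_ray_lower[OF assms, of i j] by simp
qed

lemma finite_set_dist_bound:
  assumes "finite M" "M \<subseteq> V" "x \<in> V"
  shows "\<exists>k0. \<forall>y\<in>M. \<rho> x y < k0"
  using assms(1) by (metis finite_imageI finite_nat_set_iff_bounded imageI)

text \<open>Koenig's lemma: keep a vertex with infinitely many descendants in \<open>B\<close>.\<close>

lemma geodesic_ray_exists: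
  assumes B: "B \<subseteq> V" "infinite B" and div: "graph_divergent \<rho> B (V - B)"
  shows "\<exists>x q k0. geodesic_ray x q \<and> (\<forall>k\<ge>k0. q k \<in> B)"
proof -
  obtain x0 where x0: "x0 \<in> B" using B(2) by (metis finite.emptyI equals0I)
  then have x0V: "x0 \<in> V" using B(1) by blast
  \<comment> \<open>The vertices of \<open>B\<close> that some geodesic from \<open>x0\<close>
    reaches by way of \<open>x\<close>.\<close>
  define D where "D x = {y \<in> B. \<rho> x0 y = \<rho> x0 x + \<rho> x y}" for x
  have step: "\<exists>z\<in>V. \<rho> x0 z = Suc (\<rho> x0 x) \<and> infinite (D z) \<and> \<rho> x z \<le> 1"
    if x: "x \<in> V" "infinite (D x)" for x
  proof -
    let ?Z = "{z \<in> V. \<rho> x z \<le> 1 \<and> \<rho> x0 z = Suc (\<rho> x0 x)}"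
    have "D x - {x} \<subseteq> (\<Union>z\<in>?Z. D z)"
    proof
      fix y assume "y \<in> D x - {x}"
      then have y: "y \<in> B" "\<rho> x0 y = \<rho> x0 x + \<rho> x y" "y \<noteq> x" by (simp_all add: D_def)
      then have yV: "y \<in> V" using B(1) by blast
      then have "\<rho> x y \<noteq> 0" using eq[OF x(1) yV] y(3) by auto
      then obtain n where n: "\<rho> x y = Suc n" using not0_implies_Suc by blast
      then obtain z where z: "z \<in> V" "\<rho> x z = 1" "\<rho> z y = n" using geodesic[OF x(1) yV n] by blast
      have "\<rho> x0 z \<le> \<rho> x0 x + 1" "\<rho> x0 y \<le> \<rho> x0 z + n"
        using triangle[OF x0V x(1) z(1)] triangle[OF x0V z(1) yV] z by simp_all
      then have "\<rho> x0 z = Suc (\<rho> x0 x)" "\<rho> x0 y = \<rho> x0 z + \<rho> z y" using y(2) n z by simp_all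
      then show "y \<in> (\<Union>z\<in>?Z. D z)" using y(1) z by (auto simp: D_def)
    qed
    moreover have "infinite (D x - {x})" using x(2) by simp
    ultimately have "infinite (\<Union>z\<in>?Z. D z)" using finite_subset by blast
    moreover have "finite ?Z" by (rule finite_subset[OF _ finite_ball[OF x(1), of 1]]) auto
    ultimately obtain z where "z \<in> ?Z" "infinite (D z)" by blast
    then show ?thesis by blast
  qed
  have "\<exists>q. \<forall>k. (q k \<in> V \<and> \<rho> x0 (q k) = k \<and> infinite (D (q k))) \<and> \<rho> (q k) (q (Suc k)) \<le> 1"
  proof (rule dependent_nat_choice)
    have "D x0 = B" using refl[OF x0V] by (auto simp: D_def)
    then show "\<exists>x. x \<in> V \<and> \<rho> x0 x = 0 \<and> infinite (D x)" using x0V refl[OF x0V] B(2) by auto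
    fix x k assume "x \<in> V \<and> \<rho> x0 x = k \<and> infinite (D x)"
    then show "\<exists>y. (y \<in> V \<and> \<rho> x0 y = Suc k \<and> infinite (D y)) \<and> \<rho> x y \<le> 1"
      using step[of x] by blast
  qed
  then obtain q where q: "\<And>k. q k \<in> V" "\<And>k. \<rho> x0 (q k) = k" "\<And>k. infinite (D (q k))"
    "\<And>k. \<rho> (q k) (q (Suc k)) \<le> 1" by blast
  let ?M = "{y \<in> V - B. \<exists>z\<in>B. \<rho> y z \<le> 1}"
  have "finite ?M" using graph_divergentD[OF graph_divergent_sym[OF B(1) _ div], of 1] by auto
  then obtain k0 where k0: "\<And>y. y \<in> ?M \<Longrightarrow> \<rho> x0 y < k0"
    using finite_set_dist_bound[of ?M x0] x0V by auto
  \<comment> \<open>The ray has descendants in \<open>B\<close> but may itself run outside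
    \<open>B\<close>. The vertices outside \<open>B\<close> adjacent to \<open>B\<close> form the
    finite set \<open>?M\<close>; beyond its radius \<open>k0\<close>, walking a geodesic backwards
    from a descendant in \<open>B\<close> cannot leave \<open>B\<close>.\<close>
  have down: "x \<in> B" if "x \<in> V" "y \<in> B" "\<rho> x y = n" "\<rho> x0 y = \<rho> x0 x + n" "k0 \<le> \<rho> x0 x" for n x y
    using that
  proof (induction n arbitrary: x)
    case 0
    then show ?case using eq[of x y] B(1) by auto
  next
    case (Suc n)
    have yV: "y \<in> V" using Suc.prems(2) B(1) by blast
    obtain z where z: "z \<in> V" "\<rho> x z = 1" "\<rho> z y = n" using geodesic[OF Suc.prems(1) yV Suc.prems(3)] by blast
    have "\<rho> x0 z \<le> \<rho> x0 x + 1" "\<rho> x0 y \<le> \<rho> x0 z + n"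
      using triangle[OF x0V Suc.prems(1) z(1)] triangle[OF x0V z(1) yV] z by simp_all
    then have "z \<in> B" using Suc.IH[OF z(1) Suc.prems(2) z(3)] Suc.prems(4,5) by simp
    show ?case
    proof (rule ccontr)
      assume "x \<notin> B"
      moreover have "\<exists>z\<in>B. \<rho> x z \<le> 1" using z(2) \<open>z \<in> B\<close> by (intro bexI[of _ z]) simp_all
      ultimately have "x \<in> ?M" using Suc.prems(1) by simp
      then show False using k0[of x] Suc.prems(5) by simp
    qed
  qed
  have "q k \<in> B" if "k0 \<le> k" for k
  proof -
    have "D (q k) \<noteq> {}" using q(3)[of k] by auto
    then obtain y where "y \<in> D (q k)" by blast
    then have y: "y \<in> B" "\<rho> x0 y = \<rho> x0 (q k) + \<rho> (q k) y" by (simp_all add: D_def)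
    show ?thesis using down[OF q(1) y(1) HOL.refl y(2)] q(2) that by simp
  qed
  moreover have "geodesic_ray x0 q" using q x0V by (simp add: geodesic_ray_def)
  ultimately show ?thesis by blast
qed

end

section \<open>Traces of neighbourhoods of rays\<close>

locale graph_boundary_model = locally_finite_graph V \<rho> + boundary_model T V cl "graph_divergent \<rho>"
  for V :: "'v set" and \<rho> and T :: "'p topology" and cl
begin

lemma cl_empty_iff: "A \<subseteq> V \<Longrightarrow> cl A = {} \<longleftrightarrow> finite A"
  using dv_self[of A] graph_divergent_self[of A \<rho>] refl by auto

text \<open>
  The set \<open>K\<close> of vertices twice as close to the ray as to \<open>E\<close> is a union of geodesics ending on the
  ray, and only finitely many of these meet a given finite set. Hence \<open>K\<close> has a connected trace;
  the trace has nonempty interior and misses that of \<open>E\<close>.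
\<close>

lemma ray_neighbourhood_connected:
  assumes ray: "geodesic_ray x0 q" and E: "E \<subseteq> V" "e0 \<in> E"
    and K: "K = {x \<in> V. \<exists>r\<in>q ` {k0..}. \<forall>e\<in>E. 2 * \<rho> x r \<le> \<rho> x e}"
  shows "connectedin T (cl K)"
proof -
  have qV: "q k \<in> V" "\<rho> (q k) (q (Suc k)) \<le> 1" for k using ray by (auto simp: geodesic_ray_def)
  have KV: "K \<subseteq> V" by (auto simp: K)
  have e0V: "e0 \<in> V" using E by blast
  have one_side: "finite A2"
    if A: "A1 \<subseteq> K" "A2 = K - A1" and fin: "finite {x \<in> A2. \<exists>y\<in>A1. \<rho> x y \<le> 1}"
      and tail: "\<And>k. k1 \<le> k \<Longrightarrow> q k \<in> A1" for A1 A2 k1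
  proof -
    \<comment> \<open>The gates: vertices of \<open>A2\<close> next to \<open>A1\<close>, and the
      initial ray vertices, at which a geodesic may end without having entered
      \<open>A1\<close>.\<close>
    define Y where "Y = {x \<in> A2. \<exists>y\<in>A1. \<rho> x y \<le> 1} \<union> q ` {..<k1}"
    have Y: "finite Y" "Y \<subseteq> V" using fin qV(1) A KV by (auto simp: Y_def)
    \<comment> \<open>Each step of a geodesic towards \<open>r\<close> lowers
      \<open>2 * \<rho> x r\<close> by 2 and \<open>\<rho> x e\<close> by at most 1, so the geodesic
      stays in \<open>K\<close>. It either reaches a vertex of \<open>A2\<close> adjacent to
      \<open>A1\<close> or ends at \<open>r\<close> inside \<open>A2\<close>; in both cases it has
      met a gate.\<close>
    have walk: "\<exists>y\<in>Y. \<rho> x y + \<rho> y r = \<rho> x r"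
      if "x \<in> A2" "r \<in> q ` {k0..}" "\<forall>e\<in>E. 2 * \<rho> x r \<le> \<rho> x e" "\<rho> x r = n" for x r n
      using that
    proof (induction n arbitrary: x)
      case 0
      have V: "x \<in> V" "r \<in> V" using 0 A KV qV(1) by auto
      then have xr: "x = r" using eq 0 by blast
      obtain k where "r = q k" using 0(2) by blast
      then have "r \<in> Y" using tail[of k] 0(1) xr A(2) by (cases "k < k1") (auto simp: Y_def)
      then show ?case using xr V refl by (intro bexI[of _ r]) auto
    next
      case (Suc n)
      have V: "x \<in> V" "r \<in> V" using Suc.prems A KV qV(1) by auto
      obtain z where z: "z \<in> V" "\<rho> x z = 1" "\<rho> z r = n" using geodesic[OF V Suc.prems(4)] by blast
      have zr: "2 * \<rho> z r \<le> \<rho> z e" if "e \<in> E" for e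
      proof -
        have "2 * \<rho> x r \<le> \<rho> x e" using Suc.prems(3) that by blast
        moreover have "\<rho> x e \<le> 1 + \<rho> z e" using triangle[of x z e] V z E that by auto
        ultimately show ?thesis using Suc.prems(4) z(3) by simp
      qed
      then have zK: "z \<in> K" using z(1) Suc.prems(2) by (auto simp: K)
      show ?case
      proof (cases "z \<in> A1")
        case True
        then have "\<exists>y\<in>A1. \<rho> x y \<le> 1" using z(2) by (intro bexI[of _ z]) simp_all
        then have "x \<in> Y" using Suc.prems(1) by (simp add: Y_def)
        then show ?thesis using refl[OF V(1)] by (intro bexI[of _ x]) auto
      next
        case False
        then have "z \<in> A2" using zK A(2) by blast
        then obtain y where y: "y \<in> Y" "\<rho> z y + \<rho> y r = \<rho> z r"
          using Suc.IH[of z] Suc.prems(2) zr z(3) by blast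
        have yV: "y \<in> V" using y(1) Y(2) by blast
        have "\<rho> x y \<le> 1 + \<rho> z y" "\<rho> x r \<le> \<rho> x y + \<rho> y r"
          using triangle[OF V(1) z(1) yV] triangle[OF V(1) yV V(2)] z(2) by simp_all
        then have "\<rho> x y + \<rho> y r = \<rho> x r" using y(2) z(3) Suc.prems(4) by simp
        then show ?thesis using y(1) by blast
      qed
    qed
    have "A2 \<subseteq> (\<Union>y\<in>Y. {x \<in> V. \<rho> y x \<le> \<rho> y e0})"
    proof
      fix x assume x: "x \<in> A2"
      then have xV: "x \<in> V" using A KV by blast
      have "x \<in> K" using x A by blast
      then obtain r where r: "r \<in> q ` {k0..}" "\<forall>e\<in>E. 2 * \<rho> x r \<le> \<rho> x e" by (auto simp: K)
      then obtain y where y: "y \<in> Y" "\<rho> x y + \<rho> y r = \<rho> x r" using walk[OF x] by blast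
      have yV: "y \<in> V" using y(1) Y(2) by blast
      have "2 * \<rho> x r \<le> \<rho> x e0" using r(2) E(2) by blast
      also have "\<dots> \<le> \<rho> x y + \<rho> y e0" by (rule triangle[OF xV yV e0V])
      finally have "\<rho> x y \<le> \<rho> y e0" using y(2) by linarith
      then show "x \<in> (\<Union>y\<in>Y. {x \<in> V. \<rho> y x \<le> \<rho> y e0})" using y(1) xV sym[OF xV yV] by auto
    qed
    moreover have "finite (\<Union>y\<in>Y. {x \<in> V. \<rho> y x \<le> \<rho> y e0})"
      using Y finite_ball by (intro finite_UN_I) auto
    ultimately show ?thesis by (rule finite_subset)
  qed
  have RK: "q k \<in> K" if "k0 \<le> k" for k
    using that refl[OF qV(1)] qV(1) unfolding K by (intro CollectI conjI bexI[of _ "q k"]) auto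
  interpret R: boundary_model "subtopology T (cl K)" K cl "graph_divergent \<rho>"
    by (rule restrict[OF KV])
  have "connected_space (subtopology T (cl K))"
  proof (rule R.connectedI)
    fix A assume A: "A \<subseteq> K" "graph_divergent \<rho> A (K - A)"
    have A': "graph_divergent \<rho> (K - A) A" by (rule graph_divergent_sym[OF _ _ A(2)]) (use A(1) KV in auto)
    define F where "F = {x \<in> A. \<exists>y\<in>K - A. \<rho> x y \<le> 1}"
    define G where "G = {x \<in> K - A. \<exists>y\<in>A. \<rho> x y \<le> 1}"
    have FG: "finite F" "finite G" using graph_divergentD[OF A(2)] graph_divergentD[OF A'] by (auto simp: F_def G_def)
    have "finite {k. q k \<in> F \<union> G}"
      using finite_vimageI[OF _ geodesic_ray_inj[OF ray], of "F \<union> G"] FG by (simp add: vimage_def)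
    then obtain m where m: "\<And>k. q k \<in> F \<union> G \<Longrightarrow> k < m" unfolding finite_nat_set_iff_bounded by blast
    \<comment> \<open>Beyond \<open>k1\<close> the ray avoids both finite boundaries, so it cannot
      change sides; the side without the tail of the ray is then finite by
      \<open>one_side\<close>.\<close>
    define k1 where "k1 = max k0 m"
    have same: "q (Suc k) \<in> A \<longleftrightarrow> q k \<in> A" if "k1 \<le> k" for k
    proof -
      have "q k \<in> K" "q (Suc k) \<in> K" "q k \<notin> F" "q k \<notin> G" using RK m[of k] that by (auto simp: k1_def)
      then show ?thesis using qV(2)[of k] by (auto simp: F_def G_def)
    qed
    have tail: "q k \<in> A \<longleftrightarrow> q k1 \<in> A" if "k1 \<le> k" for k
      using that by (induction k rule: dec_induct) (auto simp: same)
    show "cl A = {} \<or> cl (K - A) = {}"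
    proof (cases "q k1 \<in> A")
      case True
      have "finite (K - A)"
        by (rule one_side[OF A(1) _ _ tail[THEN iffD2]]) (use FG(2) True in \<open>auto simp: G_def\<close>)
      then show ?thesis using cl_empty_iff[of "K - A"] KV by auto
    next
      case False
      have "finite A"
      proof (rule one_side[of "K - A"])
        show "K - A \<subseteq> K" "A = K - (K - A)" using A(1) by auto
        show "finite {x \<in> A. \<exists>y\<in>K - A. \<rho> x y \<le> 1}" using FG(1) by (simp add: F_def)
        show "q k \<in> K - A" if "k1 \<le> k" for k using RK[of k] tail[OF that] that False by (auto simp: k1_def)
      qed
      then show ?thesis using cl_empty_iff[of A] A(1) KV by auto
    qed
  qed
  then show ?thesis using cl_subset[OF KV] by (simp add: connectedin_def)
qed

text \<open>For infinite \<open>E\<close> the trace of \<open>K\<close> would be a proper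
  subcontinuum with nonempty interior: it omits the trace of \<open>E\<close> and is a neighbourhood
  of that of the ray. Adjoining \<open>V - B\<close> to \<open>E\<close> confines \<open>K\<close>
  to \<open>B\<close>.\<close>

lemma no_set_diverging_from_ray:
  assumes B: "B \<subseteq> V" "graph_divergent \<rho> B (V - B)"
    and ind: "indecomposable_continuum (subtopology T (cl B))"
    and ray: "geodesic_ray x0 q" "\<And>k. k0 \<le> k \<Longrightarrow> q k \<in> B"
    and E: "E \<subseteq> B" "graph_divergent \<rho> (q ` {k0..}) E"
  shows "finite E"
proof (rule ccontr)
  assume inf: "infinite E"
  then obtain e0 where e0: "e0 \<in> E" by (metis finite.emptyI equals0I)
  define E2 where "E2 = E \<union> (V - B)"
  define R where "R = q ` {k0..}"
  have qV: "q k \<in> V" for k using ray(1) by (auto simp: geodesic_ray_def)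
  have RV: "R \<subseteq> V" "R \<subseteq> B" using qV ray(2) by (auto simp: R_def)
  have E2: "E2 \<subseteq> V" "e0 \<in> E2" using E B e0 by (auto simp: E2_def)
  have div: "graph_divergent \<rho> R E2"
    unfolding E2_def using E(2) graph_divergent_mono[OF B(2) RV(2), of "V - B"]
    by (intro graph_divergent_Un) (auto simp: R_def)
  define K where "K = {x \<in> V. \<exists>r\<in>q ` {k0..}. \<forall>e\<in>E2. 2 * \<rho> x r \<le> \<rho> x e}"
  have KV: "K \<subseteq> V" by (auto simp: K_def)
  have KE: "\<exists>r\<in>R. \<forall>e\<in>E2. 2 * \<rho> x r \<le> \<rho> x e" if "x \<in> K" for x using that by (simp add: K_def R_def)
  have KB: "K \<subseteq> B"
  proof
    fix x assume x: "x \<in> K"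
    then obtain r where r: "r \<in> R" "\<forall>e\<in>E2. 2 * \<rho> x r \<le> \<rho> x e" using KE by blast
    show "x \<in> B"
    proof (rule ccontr)
      assume "x \<notin> B"
      then have "x \<in> E2" using x KV by (auto simp: E2_def)
      then have "\<rho> x r = 0" using r(2) refl[of x] x KV by force
      then show False using eq[of x r] r(1) RV x KV \<open>x \<notin> B\<close> by blast
    qed
  qed
  have conn: "connectedin T (cl K)"
    by (rule ray_neighbourhood_connected[OF ray(1) E2 K_def])
  have "graph_divergent \<rho> K E2"
    unfolding graph_divergent_def
  proof
    fix n
    let ?F = "{r \<in> R. \<exists>e\<in>E2. \<rho> r e \<le> 2 * n}"
    have "{x \<in> K. \<exists>e\<in>E2. \<rho> x e \<le> n} \<subseteq> (\<Union>r\<in>?F. {x \<in> V. \<rho> r x \<le> n})"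
    proof
      fix x assume "x \<in> {x \<in> K. \<exists>e\<in>E2. \<rho> x e \<le> n}"
      then obtain e where x: "x \<in> K" "e \<in> E2" "\<rho> x e \<le> n" by auto
      then obtain r where r: "r \<in> R" "\<forall>e\<in>E2. 2 * \<rho> x r \<le> \<rho> x e" using KE by blast
      have V: "x \<in> V" "r \<in> V" "e \<in> V" using x r KV RV E2 by auto
      have "2 * \<rho> x r \<le> n" using r(2) x(2,3) by fastforce
      then have "\<rho> r x \<le> n" using sym[OF V(1,2)] by simp
      moreover from this have "\<rho> r e \<le> 2 * n" using triangle[OF V(2,1,3)] x(3) by simp
      ultimately show "x \<in> (\<Union>r\<in>?F. {x \<in> V. \<rho> r x \<le> n})" using r(1) x(2) V(1) by blast
    qed
    moreover have "finite (\<Union>r\<in>?F. {x \<in> V. \<rho> r x \<le> n})"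
      using graph_divergentD[OF div] RV finite_ball by (intro finite_UN_I) auto
    ultimately show "finite {x \<in> K. \<exists>e\<in>E2. \<rho> x e \<le> n}" by (rule finite_subset)
  qed
  then have disj: "cl K \<inter> cl E2 = {}" using dv_iff[OF KV E2(1)] by blast
  have "graph_divergent \<rho> R (V - K)"
    unfolding graph_divergent_def
  proof
    fix n
    \<comment> \<open>A point \<open>y\<close> outside \<open>K\<close> within \<open>n\<close> of
      \<open>r\<close> has some \<open>e\<close> at distance less than \<open>2 * n\<close>, so
      \<open>r\<close> is within \<open>3 * n\<close> of \<open>E2\<close>.\<close>
    have "{r \<in> R. \<exists>y\<in>V - K. \<rho> r y \<le> n} \<subseteq> {r \<in> R. \<exists>e\<in>E2. \<rho> r e \<le> 3 * n}"
    proof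
      fix r assume "r \<in> {r \<in> R. \<exists>y\<in>V - K. \<rho> r y \<le> n}"
      then obtain y where y: "r \<in> R" "y \<in> V" "y \<notin> K" "\<rho> r y \<le> n" by auto
      then obtain e where e: "e \<in> E2" "\<rho> y e < 2 * \<rho> y r" by (auto simp: K_def R_def not_le)
      have V: "r \<in> V" "e \<in> V" using y(1) e(1) RV E2 by auto
      have "\<rho> r e \<le> 3 * n" using triangle[OF V(1) y(2) V(2)] sym[OF V(1) y(2)] e(2) y(4) by simp
      then show "r \<in> {r \<in> R. \<exists>e\<in>E2. \<rho> r e \<le> 3 * n}" using y(1) e(1) by blast
    qed
    then show "finite {r \<in> R. \<exists>y\<in>V - K. \<rho> r y \<le> n}"
      using graph_divergentD[OF div] by (rule finite_subset)
  qed
  then have disjR: "cl R \<inter> cl (V - K) = {}" using dv_iff[OF RV(1)] by blast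
  have "infinite R" unfolding R_def
    using geodesic_ray_inj[OF ray(1)] by (simp add: finite_image_iff inj_on_subset infinite_Ici)
  then have Rne: "cl R \<noteq> {}" using cl_empty_iff[OF RV(1)] by blast
  let ?T = "subtopology T (cl B)"
  have clB: "topspace ?T = cl B" using cl_subset[OF B(1)] by auto
  have KBc: "cl K \<subseteq> cl B" by (rule cl_mono[OF KB B(1)])
  have RBc: "cl R \<subseteq> cl B" by (rule cl_mono[OF RV(2) B(1)])
  show False
  proof (rule indecomposable_no_interior[OF ind])
    show "closedin ?T (cl K)" using closedin_cl[OF KV] KBc by (rule closedin_subset_topspace)
    show "connectedin ?T (cl K)" using conn KBc by (simp add: connectedin_subtopology)
    show "cl K \<noteq> topspace ?T"
    proof
      assume "cl K = topspace ?T"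
      moreover have "cl E \<subseteq> cl B" "cl E \<subseteq> cl E2"
        by (rule cl_mono[OF E(1) B(1)]) (rule cl_mono[OF _ E2(1)], simp add: E2_def)
      moreover have "cl E \<noteq> {}" using cl_empty_iff[of E] inf E(1) B(1) by auto
      ultimately show False using disj clB by auto
    qed
    \<comment> \<open>Everything outside \<open>cl (V - K)\<close> lies in \<open>cl K\<close>, so
      this is an open subset of the subcontinuum; it contains the trace of the ray.\<close>
    show "openin ?T (cl B - cl (V - K))"
      unfolding openin_subtopology using cl_subset[OF B(1)]
      by (intro exI[of _ "topspace T - cl (V - K)"]) (auto simp: closedin_cl)
    show "cl B - cl (V - K) \<noteq> {}" using Rne RBc disjR by blast
    show "cl B - cl (V - K) \<subseteq> cl K" using cl_Diff[OF KV] cl_subset[OF B(1)] by blast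
  qed
qed

text \<open>Without a bound there are vertices \<open>e n\<close> of \<open>B\<close> farther than
  \<open>n\<close> from the ray. They diverge from the ray, since only those with index below
  \<open>n\<close> come within \<open>n\<close> of it, so they form a finite set, whose distances to
  the ray are bounded after all.\<close>

lemma near_ray:
  assumes B: "B \<subseteq> V" "graph_divergent \<rho> B (V - B)"
    and ind: "indecomposable_continuum (subtopology T (cl B))"
    and ray: "geodesic_ray x0 q" "\<And>k. k0 \<le> k \<Longrightarrow> q k \<in> B"
  shows "\<exists>n. \<forall>x\<in>B. \<exists>k\<ge>k0. \<rho> x (q k) \<le> n"
proof (rule ccontr)
  assume "\<not> ?thesis"
  then have "\<forall>n. \<exists>x\<in>B. \<forall>k\<ge>k0. n < \<rho> x (q k)" by (metis not_le)
  then obtain e where e: "\<And>n. e n \<in> B" "\<And>n k. k0 \<le> k \<Longrightarrow> n < \<rho> (e n) (q k)" by metis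
  have qV: "q k \<in> V" for k using ray(1) by (auto simp: geodesic_ray_def)
  have eV: "e n \<in> V" for n using e(1) B(1) by blast
  have "graph_divergent \<rho> (q ` {k0..}) (range e)"
    unfolding graph_divergent_def
  proof
    fix n
    have "{r \<in> q ` {k0..}. \<exists>x\<in>range e. \<rho> r x \<le> n} \<subseteq> (\<Union>m<n. {r \<in> V. \<rho> (e m) r \<le> n})"
    proof
      fix r assume "r \<in> {r \<in> q ` {k0..}. \<exists>x\<in>range e. \<rho> r x \<le> n}"
      then obtain k m where km: "k0 \<le> k" "r = q k" "\<rho> r (e m) \<le> n" by auto
      then have "\<rho> (e m) r \<le> n" using sym[OF eV[of m] qV[of k]] by simp
      moreover have "m < n" using e(2)[OF km(1), of m] km(2) calculation by simp
      ultimately show "r \<in> (\<Union>m<n. {r \<in> V. \<rho> (e m) r \<le> n})" using km(2) qV by blast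
    qed
    moreover have "finite (\<Union>m<n. {r \<in> V. \<rho> (e m) r \<le> n})" using finite_ball[OF eV] by simp
    ultimately show "finite {r \<in> q ` {k0..}. \<exists>x\<in>range e. \<rho> r x \<le> n}" by (rule finite_subset)
  qed
  then have "finite (range e)"
    using no_set_diverging_from_ray[OF B ind ray, where E = "range e"] e(1) by blast
  then obtain n where n: "\<And>x. x \<in> range e \<Longrightarrow> \<rho> (q k0) x < n"
    using finite_set_dist_bound[of "range e" "q k0"] eV qV by blast
  have "\<rho> (q k0) (e n) < n" using n by blast
  then show False using e(2)[of k0 n] sym[OF qV[of k0] eV[of n]] by simp
qed

text \<open>The tails of two rays, one in each part, are glued into a line that is isometric on each
  half. For vertices on different halves, the upper bound goes through the gap, and the lower bound
  is the divergence of the two parts.\<close>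

lemma coarse_line:
  assumes B: "B \<subseteq> V" "graph_divergent \<rho> B (V - B)"
    and ind: "indecomposable_continuum (subtopology T (cl B))"
      "indecomposable_continuum (subtopology T (cl (V - B)))"
  obtains h :: "int \<Rightarrow> 'v" where "range h \<subseteq> V" "\<exists>n. \<forall>x\<in>V. \<exists>z. \<rho> x (h z) \<le> n"
    "\<And>n. \<exists>m. \<forall>i j. \<bar>i - j\<bar> \<le> int n \<longrightarrow> \<rho> (h i) (h j) \<le> m"
    "\<And>n. \<exists>m. \<forall>i j. \<rho> (h i) (h j) \<le> n \<longrightarrow> \<bar>i - j\<bar> \<le> int m"
proof -
  let ?C = "V - B"
  have VC: "V - ?C = B" using B(1) by blast
  have divC: "graph_divergent \<rho> ?C B" by (rule graph_divergent_sym[OF B(1) _ B(2)]) blast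
  have inf: "infinite A" if "A \<subseteq> V" "indecomposable_continuum (subtopology T (cl A))" for A
    using that cl_empty_iff[OF that(1)] by (auto simp: indecomposable_continuum_def continuum_space_def)
  obtain x1 q1 k1 where r1: "geodesic_ray x1 q1" "\<And>k. k1 \<le> k \<Longrightarrow> q1 k \<in> B"
    using geodesic_ray_exists[OF B(1) inf[OF B(1) ind(1)] B(2)] by blast
  have C: "?C \<subseteq> V" "graph_divergent \<rho> ?C (V - ?C)" using divC VC by auto
  obtain x2 q2 k2 where r2: "geodesic_ray x2 q2" "\<And>k. k2 \<le> k \<Longrightarrow> q2 k \<in> ?C"
    using geodesic_ray_exists[OF C(1) inf[OF C(1) ind(2)] C(2)] by blast
  obtain n1 where n1: "\<And>x. x \<in> B \<Longrightarrow> \<exists>k\<ge>k1. \<rho> x (q1 k) \<le> n1"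
    using near_ray[OF B ind(1) r1] by blast
  obtain n2 where n2: "\<And>x. x \<in> ?C \<Longrightarrow> \<exists>k\<ge>k2. \<rho> x (q2 k) \<le> n2"
    using near_ray[OF C ind(2) r2] by blast
  \<comment> \<open>The rays are entered at \<open>k1\<close> and \<open>k2\<close>, from where they
    stay in their parts. The shift by one makes -1 the first index of the second ray.\<close>
  define h where "h z = (if 0 \<le> z then q1 (k1 + nat z) else q2 (k2 + nat (- z - 1)))" for z :: int
  have qV: "q1 k \<in> V" "q2 k \<in> V" for k using r1(1) r2(1) by (auto simp: geodesic_ray_def)
  have hV: "h z \<in> V" for z using qV by (simp add: h_def)
  have hB: "h z \<in> B" if "0 \<le> z" for z using r1(2) that by (simp add: h_def)
  have hC: "h z \<in> ?C" if "z < 0" for z using r2(2) that by (simp add: h_def)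
  show thesis
  proof
    show "range h \<subseteq> V" using hV by blast
    have "\<exists>z. \<rho> x (h z) \<le> n1 + n2" if x: "x \<in> V" for x
    proof (cases "x \<in> B")
      case True
      then obtain k where k: "k \<ge> k1" "\<rho> x (q1 k) \<le> n1" using n1 by blast
      then have "h (int (k - k1)) = q1 k" by (simp add: h_def nat_diff_distrib)
      then show ?thesis using k(2) by (intro exI[of _ "int (k - k1)"]) simp
    next
      case False
      then obtain k where k: "k \<ge> k2" "\<rho> x (q2 k) \<le> n2" using n2 x by blast
      then have "h (- int (k - k2) - 1) = q2 k" by (simp add: h_def nat_diff_distrib)
      then show ?thesis using k(2) by (intro exI[of _ "- int (k - k2) - 1"]) simp
    qed
    then show "\<exists>n. \<forall>x\<in>V. \<exists>z. \<rho> x (h z) \<le> n" by blast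
    fix n
    \<comment> \<open>The gap between \<open>h 0\<close> and \<open>h (- 1)\<close>, through which
      the detour for mixed pairs goes.\<close>
    define d where "d = \<rho> (q1 k1) (q2 k2)"
    have pos: "\<rho> (h i) (h j) = nat \<bar>i - j\<bar>" if "0 \<le> i" "0 \<le> j" for i j
      using that by (simp add: h_def geodesic_ray_dist[OF r1(1)] nat_dist_def)
    have neg: "\<rho> (h i) (h j) = nat \<bar>i - j\<bar>" if "i < 0" "j < 0" for i j
      using that by (simp add: h_def geodesic_ray_dist[OF r2(1)] nat_dist_def)
    have mixed: "\<rho> (h i) (h j) \<le> 2 * n + d" if "0 \<le> i" "j < 0" "\<bar>i - j\<bar> \<le> int n" for i j
    proof -
      have "\<rho> (h i) (h 0) \<le> n" "\<rho> (h (- 1)) (h j) \<le> n" using pos[of i 0] neg[of "- 1" j] that by auto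
      moreover have "\<rho> (h 0) (h (- 1)) = d" by (simp add: h_def d_def)
      moreover have "\<rho> (h i) (h j) \<le> \<rho> (h i) (h 0) + (\<rho> (h 0) (h (- 1)) + \<rho> (h (- 1)) (h j))"
        using triangle[OF hV hV hV, of i j 0] triangle[OF hV hV hV, of 0 j "- 1"] by linarith
      ultimately show ?thesis by linarith
    qed
    have "\<rho> (h i) (h j) \<le> 2 * n + d" if ij: "\<bar>i - j\<bar> \<le> int n" for i j
    proof (cases "0 \<le> i"; cases "0 \<le> j")
      assume "\<not> 0 \<le> i" "0 \<le> j"
      then show ?thesis using mixed[of j i] ij sym[OF hV hV, of i j] by (simp add: abs_minus_commute)
    qed (use pos[of i j] neg[of i j] mixed[of i j] ij in auto)
    then show "\<exists>m. \<forall>i j. \<bar>i - j\<bar> \<le> int n \<longrightarrow> \<rho> (h i) (h j) \<le> m" by blast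
    let ?F = "{b \<in> B. \<exists>c\<in>?C. \<rho> b c \<le> n}" and ?G = "{c \<in> ?C. \<exists>b\<in>B. \<rho> c b \<le> n}"
    have x12: "x1 \<in> V" "x2 \<in> V" using r1(1) r2(1) by (auto simp: geodesic_ray_def)
    obtain m1 where m1: "\<And>y. y \<in> ?F \<Longrightarrow> \<rho> x1 y < m1"
      using finite_set_dist_bound[OF graph_divergentD[OF B(2), of n] _ x12(1)] B(1) by blast
    obtain m2 where m2: "\<And>y. y \<in> ?G \<Longrightarrow> \<rho> x2 y < m2"
      using finite_set_dist_bound[OF graph_divergentD[OF divC, of n] _ x12(2)] by blast
    \<comment> \<open>By divergence a mixed pair at distance at most \<open>n\<close> lies in the
      finite sets \<open>?F\<close> and \<open>?G\<close>. Along a ray the distance to the base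
      point grows with the index, so both indices are bounded.\<close>
    have mixed: "\<bar>i - j\<bar> \<le> int (n + m1 + m2 + 1)"
      if ij: "0 \<le> i" "j < 0" "\<rho> (h i) (h j) \<le> n" for i j
    proof -
      have "h i \<in> ?F" using hB[OF ij(1)] hC[OF ij(2)] ij(3) by blast
      then have "\<rho> x1 (h i) < m1" by (rule m1)
      moreover have "\<rho> x1 (h i) = k1 + nat i" using r1(1) ij(1) by (simp add: h_def geodesic_ray_def)
      moreover have "h j \<in> ?G" using hB[OF ij(1)] hC[OF ij(2)] ij(3) sym[OF hV hV, of i j] by auto
      then have "\<rho> x2 (h j) < m2" by (rule m2)
      moreover have "\<rho> x2 (h j) = k2 + nat (- j - 1)" using r2(1) ij(2) by (simp add: h_def geodesic_ray_def)
      ultimately show ?thesis using ij(1,2) by linarith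
    qed
    have "\<bar>i - j\<bar> \<le> int (n + m1 + m2 + 1)" if ij: "\<rho> (h i) (h j) \<le> n" for i j
    proof (cases "0 \<le> i"; cases "0 \<le> j")
      assume "\<not> 0 \<le> i" "0 \<le> j"
      then show ?thesis using mixed[of j i] ij sym[OF hV hV, of i j] by (simp add: abs_minus_commute)
    qed (use pos[of i j] neg[of i j] mixed[of i j] ij in auto)
    then show "\<exists>m. \<forall>i j. \<rho> (h i) (h j) \<le> n \<longrightarrow> \<bar>i - j\<bar> \<le> int m" by blast
  qed
qed

end

section \<open>Coronas of lines\<close>

lemma indecomposable_continuum_homeomorphic:
  assumes hom: "T homeomorphic_space T'" and T: "indecomposable_continuum T"
  shows "indecomposable_continuum T'"
proof -
  have same: "continuum_space Y" if "X homeomorphic_space Y" "continuum_space X"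
    for X :: "'x topology" and Y :: "'y topology"
    using that homeomorphic_compact_space[OF that(1)] homeomorphic_connected_space[OF that(1)]
      homeomorphic_Hausdorff_space[OF that(1)] homeomorphic_empty_space[OF that(1)]
    by (simp add: continuum_space_def)
  obtain g where g: "homeomorphic_map T' T g"
    using hom homeomorphic_space_sym[of T T'] homeomorphic_space[of T' T] by blast
  have inj: "inj_on g (topspace T')" and onto: "g ` topspace T' = topspace T"
    using g by (auto simp: homeomorphic_eq_everything_map)
  have sub: "proper_subcontinuum T (g ` A)" if A: "proper_subcontinuum T' A" for A
  proof -
    have AT: "A \<subset> topspace T'" using A by (simp add: proper_subcontinuum_def)
    have "g ` A \<subset> g ` topspace T'" using inj_on_image_eq_iff[OF inj, of A "topspace T'"] AT by auto
    moreover have "homeomorphic_map (subtopology T' A) (subtopology T (g ` A)) g"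
      using AT onto by (intro homeomorphic_map_subtopologies[OF g]) (auto simp: Int_absorb1)
    then have "subtopology T' A homeomorphic_space subtopology T (g ` A)"
      by (rule homeomorphic_map_imp_homeomorphic_space)
    then have "continuum_space (subtopology T (g ` A))"
      by (rule same) (use A in \<open>simp add: proper_subcontinuum_def\<close>)
    ultimately show ?thesis using onto by (simp add: proper_subcontinuum_def)
  qed
  have "\<not> decomposable T'"
  proof
    assume "decomposable T'"
    then obtain A B where AB: "proper_subcontinuum T' A" "proper_subcontinuum T' B" "A \<union> B = topspace T'"
      by (auto simp: decomposable_def)
    then have "g ` A \<union> g ` B = topspace T" using onto by (metis image_Un)
    then have "decomposable T" using sub[OF AB(1)] sub[OF AB(2)] by (auto simp: decomposable_def)
    then show False using T by (simp add: indecomposable_continuum_def)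
  qed
  then show ?thesis using same[OF hom] T by (simp add: indecomposable_continuum_def)
qed

lemma homeomorphic_sum_of_clopen_parts:
  assumes C: "closedin X C" and D: "closedin X D" and CD: "C \<inter> D = {}" "C \<union> D = topspace X"
  shows "X homeomorphic_space
    sum_topology (\<lambda>i::bool. if i then subtopology X C else subtopology X D) UNIV" (is "X homeomorphic_space ?S")
proof -
  have "topspace X - C = D" "topspace X - D = C" using CD by auto
  then have op: "openin X C" "openin X D" using C D by (metis openin_diff openin_topspace)+
  have sub: "C \<subseteq> topspace X" "D \<subseteq> topspace X" using CD by auto
  have top: "topspace ?S = ({True} \<times> C) \<union> ({False} \<times> D)"
    using sub by (auto simp: split: if_splits)
  have "homeomorphic_map ?S X snd"
  proof (rule bijective_open_imp_homeomorphic_map)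
    show "continuous_map ?S X snd"
      unfolding continuous_map_def
    proof (intro conjI allI impI)
      show "snd \<in> topspace ?S \<rightarrow> topspace X" using sub unfolding top by auto
      fix U assume U: "openin X U"
      show "openin ?S {x \<in> topspace ?S. snd x \<in> U}"
        unfolding openin_sum_topology
      proof (intro conjI ballI)
        show "{x \<in> topspace ?S. snd x \<in> U} \<subseteq> Sigma UNIV (topspace \<circ> (\<lambda>i. if i then subtopology X C else subtopology X D))"
          by auto
        fix i :: bool
        have "{x. (i, x) \<in> {x \<in> topspace ?S. snd x \<in> U}} = U \<inter> (if i then C else D)"
          unfolding top by auto
        then show "openin (if i then subtopology X C else subtopology X D) {x. (i, x) \<in> {x \<in> topspace ?S. snd x \<in> U}}"
          using U by (auto simp: openin_subtopology)
      qed
    qed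
    show "open_map ?S X snd"
      unfolding open_map_def
    proof (intro allI impI)
      fix U assume "openin ?S U"
      then have op_i: "openin (if i then subtopology X C else subtopology X D) {x. (i, x) \<in> U}" for i
        unfolding openin_sum_topology by simp
      have U: "openin (subtopology X C) {x. (True, x) \<in> U}" "openin (subtopology X D) {x. (False, x) \<in> U}"
        using op_i[of True] op_i[of False] by simp_all
      have "snd ` U = {x. (True, x) \<in> U} \<union> {x. (False, x) \<in> U}"
      proof (intro set_eqI iffI)
        fix x assume "x \<in> snd ` U"
        then obtain i where "(i, x) \<in> U" by auto
        then show "x \<in> {x. (True, x) \<in> U} \<union> {x. (False, x) \<in> U}" by (cases i) auto
      qed (auto intro: rev_image_eqI)
      moreover have "openin X {x. (True, x) \<in> U}" "openin X {x. (False, x) \<in> U}"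
        using U op by (simp_all add: openin_open_subtopology)
      ultimately show "openin X (snd ` U)" by auto
    qed
    show "snd ` topspace ?S = topspace X" using CD(2) unfolding top by (simp add: image_Un)
    show "inj_on snd (topspace ?S)" using CD(1) unfolding top by (auto simp: inj_on_def)
  qed
  then have "?S homeomorphic_space X" by (rule homeomorphic_map_imp_homeomorphic_space)
  then show ?thesis by (rule homeomorphic_space_sym[THEN iffD1])
qed

lemma clopen_parts_of_homeomorphic_sum:
  assumes hom: "X homeomorphic_space sum_topology (\<lambda>i::bool. if i then S else T) UNIV" (is "X homeomorphic_space ?S")
    and X: "Hausdorff_space X" and "compact_space S" "compact_space T"
  obtains C D where "closedin X C" "closedin X D" "C \<inter> D = {}" "C \<union> D = topspace X"
    "S homeomorphic_space subtopology X C" "T homeomorphic_space subtopology X D"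
proof -
  obtain g where g: "homeomorphic_map ?S X g"
    using hom homeomorphic_space_sym[of X ?S] homeomorphic_space[of ?S X] by blast
  then have inj: "inj_on g (topspace ?S)" and onto: "g ` topspace ?S = topspace X"
    by (auto simp: homeomorphic_eq_everything_map)
  define C where "C = (\<lambda>x. g (True, x)) ` topspace S"
  define D where "D = (\<lambda>x. g (False, x)) ` topspace T"
  have top: "topspace ?S = (Pair True ` topspace S) \<union> (Pair False ` topspace T)"
    by (auto split: if_splits)
  have gemb: "embedding_map ?S X g" using g onto by (simp add: embedding_map_def)
  have "embedding_map S ?S (Pair True)" "embedding_map T ?S (Pair False)"
    using embedding_map_component_injection[of True UNIV "\<lambda>i. if i then S else T"]
      embedding_map_component_injection[of False UNIV "\<lambda>i. if i then S else T"] by simp_all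
  then have emb: "embedding_map S X (g \<circ> Pair True)" "embedding_map T X (g \<circ> Pair False)"
    using gemb embedding_map_compose by blast+
  have "continuous_map S ?S (Pair True)" "continuous_map T ?S (Pair False)"
    using continuous_map_component_injection[of True UNIV "\<lambda>i. if i then S else T"]
      continuous_map_component_injection[of False UNIV "\<lambda>i. if i then S else T"] by simp_all
  then have cont: "continuous_map S X (g \<circ> Pair True)" "continuous_map T X (g \<circ> Pair False)"
    using homeomorphic_imp_continuous_map[OF g] by (auto intro: continuous_map_compose)
  have "S homeomorphic_space subtopology X C" "T homeomorphic_space subtopology X D"
    using emb[THEN embedding_map_imp_homeomorphic_space] by (simp_all add: C_def D_def comp_def)
  moreover have "compactin X C" "compactin X D"
    using image_compactin[OF _ cont(1)] image_compactin[OF _ cont(2)] assms(3,4)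
    by (simp_all add: C_def D_def compact_space_def comp_def)
  then have "closedin X C" "closedin X D" using X compactin_imp_closedin by blast+
  moreover have "C \<union> D = topspace X" using onto unfolding top C_def D_def by (simp add: image_Un image_image)
  moreover have "C \<inter> D = {}"
    using inj unfolding top C_def D_def inj_on_def by auto
  ultimately show thesis using that by blast
qed

text \<open>With \<open>h = id\<close> this merely exchanges the divergence relation for an
  equivalent one, as is done for the path metric of a net.\<close>

lemma (in boundary_model) reindex:
  assumes h: "bij_betw h W V" and dv': "\<And>A B. A \<subseteq> W \<Longrightarrow> B \<subseteq> W \<Longrightarrow> dv' A B \<longleftrightarrow> dv (h ` A) (h ` B)"
  shows "boundary_model T W (\<lambda>A. cl (h ` A)) dv'"
proof
  have hV: "h ` A \<subseteq> V" if "A \<subseteq> W" for A using h that by (auto simp: bij_betw_def)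
  show "compact_space T" "Hausdorff_space T" by (rule compact, rule Hausdorff)
  show "closedin T (cl (h ` A))" if "A \<subseteq> W" for A using closedin_cl hV that by blast
  show "cl (h ` {}) = {}" by (simp add: cl_empty)
  show "cl (h ` (A \<union> B)) = cl (h ` A) \<union> cl (h ` B)" if "A \<subseteq> W" "B \<subseteq> W" for A B
    using cl_Un[OF hV hV, OF that] by (simp add: image_Un)
  show "cl (h ` W) = topspace T" using h cl_V by (simp add: bij_betw_def)
  show "dv' A B \<longleftrightarrow> cl (h ` A) \<inter> cl (h ` B) = {}" if "A \<subseteq> W" "B \<subseteq> W" for A B
    using dv'[OF that] dv_iff[OF hV hV, OF that] by simp
  show "\<exists>A\<subseteq>W. p \<notin> cl (h ` (W - A)) \<and> cl (h ` A) \<subseteq> U" if U: "openin T U" "p \<in> U" for U p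
  proof -
    obtain A where A: "A \<subseteq> V" "p \<notin> cl (V - A)" "cl A \<subseteq> U" using base[OF U] by blast
    have "h ` (W \<inter> h -` A) = A" using h A(1) by (auto simp: bij_betw_def)
    moreover have "h ` (W - W \<inter> h -` A) = V - A" using h A(1) by (auto simp: bij_betw_def)
    ultimately show ?thesis using A by (intro exI[of _ "W \<inter> h -` A"]) auto
  qed
qed

text \<open>A corona point outside the trace of \<open>W\<close> would have a neighbourhood
  \<open>A\<close> diverging from \<open>W\<close>. As all of \<open>A\<close> is within
  \<open>r\<close> of \<open>W\<close>, it would be bounded, with empty trace.\<close>

lemma corona_trace_net:
  assumes X: "proper_metric X" and W: "W \<subseteq> X" and net: "\<And>x. x \<in> X \<Longrightarrow> \<exists>w\<in>W. dist x w \<le> r"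
  shows "corona_trace X W = topspace (higson_corona X)"
proof -
  interpret boundary_model "higson_corona X" X "corona_trace X" divergent
    by (rule higson_corona_model[OF X])
  have "p \<in> corona_trace X W" if p: "p \<in> topspace (higson_corona X)" for p
  proof (rule ccontr)
    assume "p \<notin> corona_trace X W"
    then obtain A where A: "A \<subseteq> X" "p \<notin> corona_trace X (X - A)" "corona_trace X A \<inter> corona_trace X W = {}"
      using separate_point[OF p closedin_cl[OF W]] by metis
    have "divergent A W" using dv_iff[OF A(1) W] A(3) by blast
    then have "bounded {a \<in> A. \<exists>b\<in>W. dist a b \<le> r}" by (simp add: divergent_def)
    moreover have "{a \<in> A. \<exists>b\<in>W. dist a b \<le> r} = A" using net A(1) by blast
    ultimately have "bounded A" by simp
    then have "divergent A A" unfolding divergent_def by (auto intro: bounded_subset)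
    then have "corona_trace X A = {}" using dv_self[OF A(1)] by blast
    then show False using cl_Diff[OF A(1)] p A(2) by blast
  qed
  then show ?thesis using cl_subset[OF W] by blast
qed

text \<open>The sign \<open>e\<close> lets one statement serve both half lines of the integers and,
  for \<open>e = 1\<close>, the naturals themselves.\<close>

lemma graph_divergent_signed_nat:
  fixes e :: real
  assumes e: "\<bar>e\<bar> = 1"
  shows "graph_divergent nat_dist A B \<longleftrightarrow> divergent ((\<lambda>n. e * real n) ` A) ((\<lambda>n. e * real n) ` B)"
proof -
  let ?h = "\<lambda>n. e * real n"
  have dist: "dist (?h m) (?h n) = real (nat_dist m n)" for m n
  proof -
    have "?h m - ?h n = e * (real m - real n)" by (simp add: algebra_simps)
    then have "dist (?h m) (?h n) = \<bar>real m - real n\<bar>" using e by (simp add: dist_real_def abs_mult)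
    then show ?thesis by (simp add: nat_dist_def)
  qed
  have fin: "bounded (?h ` S) \<longleftrightarrow> finite S" for S
  proof
    assume "bounded (?h ` S)"
    then obtain N where "\<And>n. n \<in> S \<Longrightarrow> norm (?h n) \<le> N" unfolding bounded_iff by blast
    then have "real n \<le> N" if "n \<in> S" for n
      using that e by (simp add: abs_mult)
    then have "n \<le> nat \<lceil>N\<rceil>" if "n \<in> S" for n
      using that real_nat_ceiling_ge[of N] by (meson of_nat_le_iff order_trans)
    then show "finite S" unfolding finite_nat_set_iff_bounded_le by blast
  qed (simp add: finite_imp_bounded)
  have img: "{a \<in> ?h ` A. \<exists>b\<in>?h ` B. dist a b \<le> r} = ?h ` {a \<in> A. \<exists>b\<in>B. real (nat_dist a b) \<le> r}" for r
    by (simp add: Compr_image_eq dist)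
  show ?thesis
  proof
    assume g: "graph_divergent nat_dist A B"
    show "divergent (?h ` A) (?h ` B)"
      unfolding divergent_def img fin
    proof
      fix r
      show "finite {a \<in> A. \<exists>b\<in>B. real (nat_dist a b) \<le> r}"
      proof (rule finite_subset[OF _ graph_divergentD[OF g, of "nat \<lceil>r\<rceil>"]])
        have "n \<le> nat \<lceil>r\<rceil>" if "real n \<le> r" for n
          using that real_nat_ceiling_ge[of r] by linarith
        then show "{a \<in> A. \<exists>b\<in>B. real (nat_dist a b) \<le> r} \<subseteq> {a \<in> A. \<exists>b\<in>B. nat_dist a b \<le> nat \<lceil>r\<rceil>}"
          by blast
      qed
    qed
  next
    assume "divergent (?h ` A) (?h ` B)"
    then have "finite {a \<in> A. \<exists>b\<in>B. real (nat_dist a b) \<le> real n}" for n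
      unfolding divergent_def img fin by blast
    then show "graph_divergent nat_dist A B" unfolding graph_divergent_def by simp
  qed
qed

lemma proper_metric_Nats: "proper_metric (\<nat> :: real set)"
  unfolding proper_metric_def
  by (intro ballI allI closed_Int_compact) auto

lemma higson_corona_Nats_model:
  "boundary_model (higson_corona (\<nat> :: real set)) (UNIV :: nat set) (\<lambda>A. corona_trace \<nat> (real ` A))
    (graph_divergent nat_dist)"
proof -
  interpret boundary_model "higson_corona (\<nat> :: real set)" "\<nat> :: real set" "corona_trace \<nat>" divergent
    by (rule higson_corona_model[OF proper_metric_Nats])
  have "bij_betw real UNIV \<nat>" by (auto simp: bij_betw_def inj_def Nats_def)
  then show ?thesis using graph_divergent_signed_nat[of 1] by (intro reindex) auto
qed

lemma indecomposable_higson_corona_Nats: "indecomposable_continuum (higson_corona (\<nat> :: real set))"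
proof -
  interpret nat_boundary_model "higson_corona (\<nat> :: real set)" "\<lambda>A. corona_trace \<nat> (real ` A)"
    by (rule nat_boundary_model.intro[OF higson_corona_Nats_model])
  show ?thesis by (rule indecomposable)
qed

lemma signed_nat_in_Ints:
  fixes e :: real
  assumes "e \<in> {1, - 1}"
  shows "e * real n \<in> \<int>"
  using assms by auto

text \<open>\<open>h\<close> may fail to be injective, so the comparison goes through
  \<open>boundary_model_homeomorphic\<close> instead of \<open>reindex\<close>; preservation of
  divergence is all that is asked.\<close>

lemma half_line_trace:
  assumes X: "proper_metric X" and h: "coarse_embedding (\<int> :: real set) X h" and e: "e \<in> {1, - 1}"
  shows "higson_corona (\<nat> :: real set) homeomorphic_space
    subtopology (higson_corona X) (corona_trace X (range (\<lambda>n. h (e * real n))))"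
proof -
  interpret boundary_model "higson_corona X" X "corona_trace X" divergent
    by (rule higson_corona_model[OF X])
  let ?g = "\<lambda>n. h (e * real n)"
  have W: "range ?g \<subseteq> X" using h signed_nat_in_Ints[OF e] by (auto simp: coarse_embedding_def)
  show ?thesis
  proof (rule boundary_model_homeomorphic[OF higson_corona_Nats_model restrict[OF W]])
    show "?g \<in> UNIV \<rightarrow> range ?g" by blast
    show "corona_trace X (range ?g) = topspace (subtopology (higson_corona X) (corona_trace X (range ?g)))"
      using cl_subset[OF W] by auto
    fix A B :: "nat set"
    have "graph_divergent nat_dist A B \<longleftrightarrow> divergent ((\<lambda>n. e * real n) ` A) ((\<lambda>n. e * real n) ` B)"
      using e by (intro graph_divergent_signed_nat) auto
    also have "\<dots> \<longleftrightarrow> divergent (h ` (\<lambda>n. e * real n) ` A) (h ` (\<lambda>n. e * real n) ` B)"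
      using signed_nat_in_Ints[OF e] by (intro coarse_embedding_divergent[OF h, symmetric]) auto
    finally show "graph_divergent nat_dist A B \<longleftrightarrow> divergent (?g ` A) (?g ` B)" by (simp add: image_image)
  qed
qed

lemma line_imp_corona_sum:
  assumes X: "proper_metric X" and Z: "coarsely_equivalent X (\<int> :: real set)"
  shows "\<exists>S T :: (('a::metric_space \<Rightarrow> real) \<Rightarrow> real) topology.
       higson_corona (X :: 'a set) homeomorphic_space sum_topology (\<lambda>i::bool. if i then S else T) UNIV \<and>
       indecomposable_continuum S \<and> S homeomorphic_space higson_corona (\<nat> :: real set) \<and>
       indecomposable_continuum T \<and> T homeomorphic_space higson_corona (\<nat> :: real set)"
proof -
  interpret boundary_model "higson_corona X" X "corona_trace X" divergent
    by (rule higson_corona_model[OF X])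
  obtain h r where h: "coarse_embedding (\<int> :: real set) X h" and net: "\<And>x. x \<in> X \<Longrightarrow> \<exists>z\<in>\<int>. dist x (h z) \<le> r"
    using coarsely_equivalent_imp_embedding[OF Z] by blast
  \<comment> \<open>Both half lines contain 0, which is harmless: divergence ignores bounded
    sets.\<close>
  define W1 where "W1 = range (\<lambda>n. h (1 * real n))"
  define W2 where "W2 = range (\<lambda>n. h (- 1 * real n))"
  have hX: "h z \<in> X" if "z \<in> \<int>" for z using h that by (auto simp: coarse_embedding_def)
  have W: "W1 \<subseteq> X" "W2 \<subseteq> X" unfolding W1_def W2_def using hX by auto
  have "divergent (range (\<lambda>n. 1 * real n)) (range (\<lambda>n. - 1 * real n))"
    unfolding divergent_def
  proof
    fix s
    show "bounded {a \<in> range (\<lambda>n. 1 * real n). \<exists>b\<in>range (\<lambda>n. - 1 * real n). dist a b \<le> s}"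
      by (rule bounded_subset[OF bounded_cball[of 0 s]]) (auto simp: dist_real_def)
  qed
  then have "divergent (h ` range (\<lambda>n. 1 * real n)) (h ` range (\<lambda>n. - 1 * real n))"
    by (subst coarse_embedding_divergent[OF h]) auto
  then have "divergent W1 W2" by (simp add: W1_def W2_def image_image)
  then have disj: "corona_trace X W1 \<inter> corona_trace X W2 = {}" using dv_iff[OF W] by blast
  have "\<exists>w\<in>W1 \<union> W2. dist x w \<le> r" if x: "x \<in> X" for x
  proof -
    obtain z where z: "z \<in> \<int>" "dist x (h z) \<le> r" using net[OF x] by blast
    then obtain i where "z = real_of_int i" by (auto elim: Ints_cases)
    then have "h z \<in> W1 \<union> W2"
      unfolding W1_def W2_def by (cases i rule: int_cases2) auto
    then show ?thesis using z(2) by blast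
  qed
  then have "corona_trace X (W1 \<union> W2) = topspace (higson_corona X)"
    using W by (intro corona_trace_net[OF X]) auto
  then have un: "corona_trace X W1 \<union> corona_trace X W2 = topspace (higson_corona X)"
    using cl_Un[OF W] by simp
  let ?S = "subtopology (higson_corona X) (corona_trace X W1)"
  let ?T = "subtopology (higson_corona X) (corona_trace X W2)"
  have "higson_corona X homeomorphic_space sum_topology (\<lambda>i::bool. if i then ?S else ?T) UNIV"
    by (rule homeomorphic_sum_of_clopen_parts[OF closedin_cl[OF W(1)] closedin_cl[OF W(2)] disj un])
  moreover have hom: "higson_corona (\<nat> :: real set) homeomorphic_space ?S"
    "higson_corona (\<nat> :: real set) homeomorphic_space ?T"
    unfolding W1_def W2_def by (rule half_line_trace[OF X h], simp)+
  moreover have "indecomposable_continuum ?S" "indecomposable_continuum ?T"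
    using hom[THEN indecomposable_continuum_homeomorphic] indecomposable_higson_corona_Nats by blast+
  moreover have "?S homeomorphic_space higson_corona (\<nat> :: real set)"
    "?T homeomorphic_space higson_corona (\<nat> :: real set)"
    using hom by (simp_all add: homeomorphic_space_sym[of _ "higson_corona \<nat>"])
  ultimately show ?thesis by metis
qed

text \<open>The corona over \<open>X\<close> is first rewritten over the net and then with the path
  metric of the net; the two summands are lifted to a partition of the net, to which
  \<open>coarse_line\<close> applies.\<close>

lemma corona_sum_imp_line:
  fixes X :: "'a::metric_space set"
  assumes X: "proper_metric X" and geo: "coarsely_geodesic TYPE('b::metric_space) X"
    and bg: "coarse_bounded_geometry X"
    and hom: "higson_corona X homeomorphic_space sum_topology (\<lambda>i::bool. if i then S else T) UNIV"
    and S: "indecomposable_continuum S" and T: "indecomposable_continuum T"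
  shows "coarsely_equivalent X (\<int> :: real set)"
proof -
  interpret X: boundary_model "higson_corona X" X "corona_trace X" divergent
    by (rule higson_corona_model[OF X])
  obtain V \<rho> r c where V: "V \<subseteq> X" and net: "\<And>x. x \<in> X \<Longrightarrow> \<exists>a\<in>V. dist x a \<le> r"
    and G: "locally_finite_graph V \<rho>"
    and up: "\<And>x y. x \<in> V \<Longrightarrow> y \<in> V \<Longrightarrow> dist x y \<le> c * real (\<rho> x y)"
    and lo: "\<And>s. \<exists>n. \<forall>x\<in>V. \<forall>y\<in>V. dist x y \<le> s \<longrightarrow> \<rho> x y \<le> n"
    using coarsely_geodesic_net_graph[OF geo bg] by metis
  have "corona_trace X V = topspace (higson_corona X)" by (rule corona_trace_net[OF X V net])
  then have "boundary_model (higson_corona X) V (corona_trace X) divergent"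
    using X.restrict[OF V] by simp
  then interpret V: boundary_model "higson_corona X" V "corona_trace X" divergent .
  have "boundary_model (higson_corona X) V (\<lambda>A. corona_trace X (id ` A)) (graph_divergent \<rho>)"
    using graph_divergent_iff_divergent[OF G up lo] by (intro V.reindex) auto
  then have "boundary_model (higson_corona X) V (corona_trace X) (graph_divergent \<rho>)" by simp
  then interpret G: graph_boundary_model V \<rho> "higson_corona X" "corona_trace X"
    using G by (intro graph_boundary_model.intro)
  have "compact_space S" "compact_space T"
    using S T by (auto simp: indecomposable_continuum_def continuum_space_def)
  then obtain C D where CD: "closedin (higson_corona X) C" "closedin (higson_corona X) D" "C \<inter> D = {}"
    "C \<union> D = topspace (higson_corona X)"
    "S homeomorphic_space subtopology (higson_corona X) C" "T homeomorphic_space subtopology (higson_corona X) D"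
    using clopen_parts_of_homeomorphic_sum[OF hom X.Hausdorff] by metis
  obtain B where B: "B \<subseteq> V" "corona_trace X B = C" "corona_trace X (V - B) = D"
    by (rule G.clopen_partition[OF CD(1-4)])
  have div: "graph_divergent \<rho> B (V - B)" using G.dv_iff[of B "V - B"] B CD(3) by auto
  have ind: "indecomposable_continuum (subtopology (higson_corona X) (corona_trace X B))"
    "indecomposable_continuum (subtopology (higson_corona X) (corona_trace X (V - B)))"
    using indecomposable_continuum_homeomorphic[OF CD(5) S] indecomposable_continuum_homeomorphic[OF CD(6) T] B
    by simp_all
  obtain h where h: "range h \<subseteq> V" "\<exists>n. \<forall>x\<in>V. \<exists>z. \<rho> x (h z) \<le> n"
    "\<And>n. \<exists>m. \<forall>i j. \<bar>i - j\<bar> \<le> int n \<longrightarrow> \<rho> (h i) (h j) \<le> m"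
    "\<And>n. \<exists>m. \<forall>i j. \<rho> (h i) (h j) \<le> n \<longrightarrow> \<bar>i - j\<bar> \<le> int m"
    using G.coarse_line[OF B(1) div ind] by blast
  have hV: "h i \<in> V" for i using h(1) by blast
  have up': "dist x y \<le> \<bar>c\<bar> * real n" if "x \<in> V" "y \<in> V" "\<rho> x y \<le> n" for x y n
  proof -
    have "dist x y \<le> c * real (\<rho> x y)" using up that by blast
    also have "\<dots> \<le> \<bar>c\<bar> * real n" using that(3) by (intro mult_mono) auto
    finally show ?thesis .
  qed
  \<comment> \<open>The integers are a set of reals here, so the integer-indexed line is read off
    through the floor.\<close>
  let ?h = "\<lambda>z::real. h \<lfloor>z\<rfloor>"
  have "coarse_embedding \<int> X ?h"
    unfolding coarse_embedding_def
  proof (intro conjI allI)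
    show "?h \<in> \<int> \<rightarrow> X" using hV V by blast
    fix s :: real
    obtain m where m: "\<And>i j. \<bar>i - j\<bar> \<le> int (nat \<lceil>s\<rceil>) \<Longrightarrow> \<rho> (h i) (h j) \<le> m" using h(3) by blast
    have "dist (?h y) (?h y') \<le> \<bar>c\<bar> * real m" if yy: "y \<in> \<int>" "y' \<in> \<int>" "dist y y' \<le> s" for y y'
    proof (rule up'[OF hV hV m])
      show "\<bar>\<lfloor>y\<rfloor> - \<lfloor>y'\<rfloor>\<bar> \<le> int (nat \<lceil>s\<rceil>)"
        using yy by (auto elim!: Ints_cases simp: dist_real_def) linarith
    qed
    then show "\<exists>t. \<forall>y\<in>\<int>. \<forall>y'\<in>\<int>. dist y y' \<le> s \<longrightarrow> dist (?h y) (?h y') \<le> t" by blast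
    obtain n where n: "\<forall>x\<in>V. \<forall>y\<in>V. dist x y \<le> s \<longrightarrow> \<rho> x y \<le> n" using lo by blast
    obtain m' where m': "\<And>i j. \<rho> (h i) (h j) \<le> n \<Longrightarrow> \<bar>i - j\<bar> \<le> int m'" using h(4) by blast
    have "dist y y' \<le> real m'" if yy: "y \<in> \<int>" "y' \<in> \<int>" "dist (?h y) (?h y') \<le> s" for y y'
    proof -
      have "\<rho> (?h y) (?h y') \<le> n" using n hV yy(3) by blast
      then have "\<bar>\<lfloor>y\<rfloor> - \<lfloor>y'\<rfloor>\<bar> \<le> int m'" by (rule m')
      then show ?thesis using yy(1,2) by (auto elim!: Ints_cases simp: dist_real_def)
    qed
    then show "\<exists>t. \<forall>y\<in>\<int>. \<forall>y'\<in>\<int>. dist (?h y) (?h y') \<le> s \<longrightarrow> dist y y' \<le> t" by blast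
  qed
  moreover obtain n where n: "\<forall>x\<in>V. \<exists>z. \<rho> x (h z) \<le> n" using h(2) by blast
  have "\<exists>z\<in>\<int>. dist x (?h z) \<le> r + \<bar>c\<bar> * real n" if x: "x \<in> X" for x
  proof -
    obtain a where a: "a \<in> V" "dist x a \<le> r" using net[OF x] by blast
    obtain z where "\<rho> a (h z) \<le> n" using n a(1) by blast
    then have "dist a (h z) \<le> \<bar>c\<bar> * real n" using up' a(1) hV by blast
    then have "dist x (?h (of_int z)) \<le> r + \<bar>c\<bar> * real n"
      using a(2) dist_triangle[of x "h z" a] by simp
    then show ?thesis using Ints_of_int by blast
  qed
  ultimately show ?thesis by (rule coarsely_equivalentI)
qed

theorem corollary3p13:
  fixes X :: "'a::metric_space set"
  assumes "\<not> compact X"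
    and "proper_metric X"
    and "coarsely_geodesic TYPE('b::metric_space) X"
    and "coarse_bounded_geometry X"
  shows "coarsely_equivalent X (\<int> :: real set) \<longleftrightarrow>
    (\<exists>S T :: (('a \<Rightarrow> real) \<Rightarrow> real) topology.
       higson_corona X homeomorphic_space sum_topology (\<lambda>i::bool. if i then S else T) UNIV \<and>
       indecomposable_continuum S \<and> S homeomorphic_space higson_corona (\<nat> :: real set) \<and>
       indecomposable_continuum T \<and> T homeomorphic_space higson_corona (\<nat> :: real set))"
  using line_imp_corona_sum[OF assms(2)] corona_sum_imp_line[OF assms(2-4)] by blast

end
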